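(* Let $d\ge2$, $p\ge q>0$, $pq>1$, and let $\alpha=\frac{2(p+1)}{pq-1}$, $\beta=\frac{2(q+1)}{pq-1}$, $\gamma=\alpha-\beta$. Let $(u,v)$, $u,v\in C^2(\mathbb{R}^d)$, be a nonnegative solution of $$-\Delta u=|v|^{p-1}v,\qquad -\Delta v=|u|^{q-1}u\qquad\text{in }\mathbb{R}^d$$ which is stable outside a compact set and asymptotically homogeneous. Let $(u_\infty,v_\infty)$ denote a blow-down limit of $(u,v)$. Then, for every $\varphi\in C^1_c(\mathbb{R}^d)$, $$\int_{\mathbb{R}^d}|u_\infty|^{\frac{q-1}2}|v_\infty|^{\frac{p-1}2}\varphi^2\,dx\le\frac1{\sqrt{pq}}\left(\int_{\mathbb{R}^d}|\nabla\varphi|^2\,dx-\frac{\gamma^2}{4}\int_{\mathbb{R}^d}\frac{\varphi^2}{|x|^2}\,dx\right).$$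
   Context: Stability outside a compact set: there exist a compact set $K\subset\mathbb{R}^d$ and two positive functions $\phi,\psi\in C^2(\mathbb{R}^d\setminus K)$ such that $-\Delta\phi\ge p|v|^{p-1}\psi$ and $-\Delta\psi\ge q|u|^{q-1}\phi$ in $\mathbb{R}^d\setminus K$. Blow-down limits: for $R\ge1$ let $(u_R,v_R)(x)=(R^\alpha u(Rx),R^\beta v(Rx))$. A blow-down limit of $(u,v)$ is a cluster point $(u_\infty,v_\infty)$, as $R\to+\infty$, of the family $(u_R,v_R)_{R\ge1}$ for the topology of uniform convergence on compact sets of $\mathbb{R}^d\setminus\{0\}$. The solution $(u,v)$ is asymptotically homogeneous if all its blow-down limits are homogeneous, i.e. for each of them there exist $f,g\in C^2(S^{d-1})$ such that $(u_\infty,v_\infty)(r\theta)=(r^{-\alpha}f(\theta),r^{-\beta}g(\theta))$ for $r>0$, $\theta\in S^{d-1}$.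
   Formalization: The solution (u,v) is additionally assumed not identically zero; for u = v = 0 (e.g. d=3, p=10, q=1.1, so γ=1.78>d-2) the claimed inequality contradicts the sharpness of Hardy's inequality. *)

theory Defs
  imports "HOL-Analysis.Analysis"
begin

text \<open>The space \<open>\<real>\<^sup>d\<close> is an arbitrary type of class \<open>euclidean_space\<close> of dimension
  \<open>d\<close>.\<close>

definition partial_deriv :: "'a::euclidean_space \<Rightarrow> ('a \<Rightarrow> real) \<Rightarrow> 'a \<Rightarrow> real" where
  "partial_deriv b f x = frechet_derivative f (at x) b"

definition grad :: "('a::euclidean_space \<Rightarrow> real) \<Rightarrow> 'a \<Rightarrow> 'a" where
  "grad f x = (\<Sum>b\<in>Basis. partial_deriv b f x *\<^sub>R b)"

definition laplacian :: "('a::euclidean_space \<Rightarrow> real) \<Rightarrow> 'a \<Rightarrow> real" where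
  "laplacian f x = (\<Sum>b\<in>Basis. partial_deriv b (partial_deriv b f) x)"

text \<open>The class \<open>C\<^sup>k(S)\<close>; only meant for open \<open>S\<close>.\<close>

primrec Ck_on :: "nat \<Rightarrow> 'a::euclidean_space set \<Rightarrow> ('a \<Rightarrow> real) \<Rightarrow> bool" where
  "Ck_on 0 S f \<longleftrightarrow> continuous_on S f"
| "Ck_on (Suc k) S f \<longleftrightarrow>
     (\<forall>x\<in>S. f differentiable (at x)) \<and> (\<forall>b\<in>Basis. Ck_on k S (partial_deriv b f))"

text \<open>Functions of class \<open>C\<^sup>2\<close> on the unit sphere, as a submanifold: restrictions of \<open>C\<^sup>2\<close>
  functions defined on an open neighbourhood of it.\<close>

definition C2_sphere :: "('a::euclidean_space \<Rightarrow> real) \<Rightarrow> bool" where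
  "C2_sphere f \<longleftrightarrow>
     (\<exists>U F. open U \<and> sphere 0 1 \<subseteq> U \<and> Ck_on 2 U F \<and> (\<forall>\<theta>\<in>sphere 0 1. F \<theta> = f \<theta>))"

definition C1_compact_support :: "('a::euclidean_space \<Rightarrow> real) \<Rightarrow> bool" where
  "C1_compact_support \<phi> \<longleftrightarrow> Ck_on 1 UNIV \<phi> \<and> compact (closure {x. \<phi> x \<noteq> 0})"

text \<open>Since \<open>0 powr s = 0\<close> for every \<open>s\<close>, the source terms below vanish where \<open>v\<close>, resp.
  \<open>u\<close>, vanishes, which for \<open>q < 1\<close> is the continuous extension of \<open>\<bar>u\<bar>\<^sup>q\<^sup>-\<^sup>1u\<close>.\<close>

definition lane_emden_solution ::
  "real \<Rightarrow> real \<Rightarrow> ('a::euclidean_space \<Rightarrow> real) \<Rightarrow> ('a \<Rightarrow> real) \<Rightarrow> bool" where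
  "lane_emden_solution p q u v \<longleftrightarrow>
     Ck_on 2 UNIV u \<and> Ck_on 2 UNIV v \<and>
     (\<forall>x. - laplacian u x = \<bar>v x\<bar> powr (p - 1) * v x) \<and>
     (\<forall>x. - laplacian v x = \<bar>u x\<bar> powr (q - 1) * u x)"

text \<open>For \<open>q \<le> 1\<close> the convention \<open>0 powr s = 0\<close> differs from the usual reading of
  \<open>\<bar>u\<bar>\<^sup>q\<^sup>-\<^sup>1\<close> at zeros of \<open>u\<close>. There it can only make the condition weaker. A nonnegative
  solution that is not identically zero has no zeros, by the strong maximum principle.\<close>

definition stable_outside_compact ::
  "real \<Rightarrow> real \<Rightarrow> ('a::euclidean_space \<Rightarrow> real) \<Rightarrow> ('a \<Rightarrow> real) \<Rightarrow> bool" where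
  "stable_outside_compact p q u v \<longleftrightarrow>
     (\<exists>K \<phi> \<psi>. compact K \<and> Ck_on 2 (- K) \<phi> \<and> Ck_on 2 (- K) \<psi> \<and>
        (\<forall>x\<in>- K. \<phi> x > 0 \<and> \<psi> x > 0) \<and>
        (\<forall>x\<in>- K. - laplacian \<phi> x \<ge> p * \<bar>v x\<bar> powr (p - 1) * \<psi> x) \<and>
        (\<forall>x\<in>- K. - laplacian \<psi> x \<ge> q * \<bar>u x\<bar> powr (q - 1) * \<phi> x))"

definition rescaled :: "real \<Rightarrow> ('a::euclidean_space \<Rightarrow> real) \<Rightarrow> real \<Rightarrow> 'a \<Rightarrow> real" where
  "rescaled a w R x = R powr a * w (R *\<^sub>R x)"

text \<open>A cluster point, as \<open>R \<rightarrow> \<infinity>\<close>, of the rescaled pairs for uniform convergence on compact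
  subsets of \<open>\<real>\<^sup>d - {0}\<close>: each basic neighbourhood contains rescaled pairs with arbitrarily
  large \<open>R\<close>. The values of \<open>u_inf\<close>, \<open>v_inf\<close> at the origin are irrelevant.\<close>

definition blow_down_limit ::
  "real \<Rightarrow> real \<Rightarrow> ('a::euclidean_space \<Rightarrow> real) \<Rightarrow> ('a \<Rightarrow> real) \<Rightarrow>
     ('a \<Rightarrow> real) \<Rightarrow> ('a \<Rightarrow> real) \<Rightarrow> bool" where
  "blow_down_limit \<alpha> \<beta> u v u_inf v_inf \<longleftrightarrow>
     (\<forall>K \<epsilon>. compact K \<and> 0 \<notin> K \<and> \<epsilon> > 0 \<longrightarrow>
        (\<exists>\<^sub>F R in at_top. \<forall>x\<in>K.
           \<bar>rescaled \<alpha> u R x - u_inf x\<bar> < \<epsilon> \<and> \<bar>rescaled \<beta> v R x - v_inf x\<bar> < \<epsilon>))"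

definition homogeneous_pair ::
  "real \<Rightarrow> real \<Rightarrow> ('a::euclidean_space \<Rightarrow> real) \<Rightarrow> ('a \<Rightarrow> real) \<Rightarrow> bool" where
  "homogeneous_pair \<alpha> \<beta> u v \<longleftrightarrow>
     (\<exists>f g. C2_sphere f \<and> C2_sphere g \<and>
        (\<forall>r>0. \<forall>\<theta>\<in>sphere 0 1.
           u (r *\<^sub>R \<theta>) = r powr (- \<alpha>) * f \<theta> \<and> v (r *\<^sub>R \<theta>) = r powr (- \<beta>) * g \<theta>))"

definition asymptotically_homogeneous ::
  "real \<Rightarrow> real \<Rightarrow> ('a::euclidean_space \<Rightarrow> real) \<Rightarrow> ('a \<Rightarrow> real) \<Rightarrow> bool" where
  "asymptotically_homogeneous \<alpha> \<beta> u v \<longleftrightarrow>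
     (\<forall>u_inf v_inf. blow_down_limit \<alpha> \<beta> u v u_inf v_inf \<longrightarrow> homogeneous_pair \<alpha> \<beta> u_inf v_inf)"

end

theory Submission
  imports Defs
begin

text \<open>
  A positive supersolution \<open>w\<close> gives \<open>\<integral> \<zeta>\<^sup>2 (-\<Delta>w)/w = \<integral> 2\<zeta> \<nabla>\<zeta> \<bullet> P - \<zeta>\<^sup>2 |P|\<^sup>2\<close> with \<open>P = \<nabla> ln w\<close>. Adding
  this for the two stability functions \<open>\<phi>\<close>, \<open>\<psi>\<close> and completing the square leaves, besides
  \<open>\<integral> |\<nabla>\<zeta>|\<^sup>2\<close>, the gain \<open>-\<integral> \<zeta>\<^sup>2 |\<nabla> ln (\<phi>/\<psi>)|\<^sup>2 / 4\<close>. Scaling suggests that \<open>\<phi>/\<psi>\<close> behaves like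
  \<open>|x| powr (-\<gamma>)\<close>, which would turn the gain into \<open>-\<gamma>\<^sup>2/4 \<integral> \<zeta>\<^sup>2/|x|\<^sup>2\<close>. The deviation is linear in the radial
  derivative of \<open>ln (\<phi>/\<psi>) + \<gamma> ln |x|\<close>; along dilations \<open>exp t\<close> it is the \<open>t\<close>-derivative of
  \<open>H t = \<integral> \<zeta>\<^sup>2/|y|\<^sup>2 (ln (\<phi>/\<psi>) (exp t y) + \<gamma> t) dy\<close>. On a window of length \<open>T\<close> the mean value theorem yields a scale where
  it is at most \<open>(H (t0 + T) - H t0) / T\<close>, and the coupling of the two stability inequalities bounds
  \<open>H (t0 + T)\<close> above and \<open>H t0\<close> below independently of \<open>T\<close>, as long as the blow-down limit is positive.
  Homogeneity of the limit makes the rescaled solutions close to it on the whole window.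

  By comparison with \<open>|x| powr (-s)\<close>, \<open>s > d - 2\<close>, each component of a blow-down limit is either
  positive or zero off the origin. If one of them is zero, the left-hand side vanishes and Hardy's
  inequality is enough, because \<open>\<gamma> < \<alpha> \<le> d - 2\<close>. In dimension 2 the same comparison leaves no
  nontrivial solution.
\<close>

section \<open>Calculus preliminaries\<close>

text \<open>The obstacle is that nothing is known about \<open>\<phi>\<close> and
  \<open>\<psi>\<close> at infinity beyond positivity and the two differential inequalities: their
  ratio has no limit to compare with, and its gradient cannot be estimated at a prescribed scale.
  This is why a square is replaced by a linear term, which is a derivative along dilations and can
  be integrated. A one-sided bound for the result suffices, because p \<ge> q makes \<gamma>
  nonnegative. The bounds at the two ends of the window rest on ln s \<le> s for s =
  \<open>\<phi>/\<psi>\<close> or its inverse: each stability inequality dominates such a ratio by a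
  quotient -\<Delta>w/w, whose weighted integral is at most the Dirichlet energy of
  \<open>\<zeta>\<close>. The test functions vanish near the origin at this stage, since the dilates
  of their support must avoid the compact set and convergence to the limit holds only off the
  origin. A cutoff argument removes this restriction at the end; there, as in Hardy's inequality, d
  \<ge> 3 is used.\<close>

lemma DERIV_integral:
  fixes F F' :: "real \<Rightarrow> 'b \<Rightarrow> real"
  assumes "0 < \<delta>"
    and int: "\<And>t. \<bar>t - t0\<bar> < \<delta> \<Longrightarrow> integrable M (F t)"
    and deriv: "\<And>t x. \<bar>t - t0\<bar> < \<delta> \<Longrightarrow> x \<in> space M \<Longrightarrow>
      ((\<lambda>s. F s x) has_real_derivative F' t x) (at t)"
    and bound: "\<And>t x. \<bar>t - t0\<bar> < \<delta> \<Longrightarrow> x \<in> space M \<Longrightarrow> \<bar>F' t x\<bar> \<le> k x"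
    and k: "integrable M k"
  shows "integrable M (F' t0)"
    and "((\<lambda>t. LINT x|M. F t x) has_real_derivative (LINT x|M. F' t0 x)) (at t0)"
proof -
  \<comment> \<open>\<open>Q h\<close> is the difference quotient at \<open>t0\<close>. The mean
    value inequality bounds it by \<open>k\<close> uniformly in \<open>h\<close>, so dominated
    convergence applies along every sequence of \<open>h\<close> tending to 0.\<close>
  define Q where "Q h x = (F (t0 + h) x - F t0 x) / h" for h x
  have Qb: "\<bar>Q h x\<bar> \<le> k x" if "x \<in> space M" "\<bar>h\<bar> < \<delta>" "h \<noteq> 0" for h x
  proof -
    have "norm (F (t0 + h) x - F t0 x) \<le> k x * norm (t0 + h - t0)"
    proof (rule field_differentiable_bound[where S = "ball t0 \<delta>" and f' = "\<lambda>t. F' t x"])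
      show "((\<lambda>s. F s x) has_field_derivative F' t x) (at t within ball t0 \<delta>)"
        if "t \<in> ball t0 \<delta>" for t
      proof -
        have "\<bar>t - t0\<bar> < \<delta>"
          using that by (simp add: dist_real_def abs_minus_commute)
        from has_field_derivative_at_within[OF deriv[OF this \<open>x \<in> space M\<close>]] show ?thesis .
      qed
      show "norm (F' t x) \<le> k x" if "t \<in> ball t0 \<delta>" for t
        using bound[of t x] that \<open>x \<in> space M\<close> by (simp add: dist_real_def abs_minus_commute)
      show "convex (ball t0 \<delta>)" by simp
      show "t0 + h \<in> ball t0 \<delta>" "t0 \<in> ball t0 \<delta>"
        using that \<open>0 < \<delta>\<close> by (simp_all add: dist_real_def)
    qed
    then show ?thesis
      using that by (simp add: Q_def divide_simps)
  qed
  have main: "integrable M (F' t0) \<and> (\<lambda>n. LINT x|M. Q (X n) x) \<longlonglongrightarrow> (LINT x|M. F' t0 x)"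
    if X: "\<And>n. X n \<noteq> 0" "\<And>n. \<bar>X n\<bar> < \<delta>" "X \<longlonglongrightarrow> 0" for X :: "nat \<Rightarrow> real"
  proof -
    have lim: "(\<lambda>n. Q (X n) x) \<longlonglongrightarrow> F' t0 x" if "x \<in> space M" for x
    proof -
      have "((\<lambda>h. Q h x) \<longlongrightarrow> F' t0 x) (at 0)"
        using deriv[of t0 x] that \<open>0 < \<delta>\<close> unfolding DERIV_def Q_def by simp
      then show ?thesis
        using X unfolding tendsto_at_iff_sequentially comp_def by auto
    qed
    have Qm: "integrable M (Q (X n))" for n
      unfolding Q_def using int[of "t0 + X n"] int[of t0] X(2) \<open>0 < \<delta>\<close> by auto
    have F'm: "F' t0 \<in> borel_measurable M"
      by (rule borel_measurable_LIMSEQ_real[where u = "\<lambda>n. Q (X n)"])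
        (use lim Qm in auto)
    have *: "Q (X n) \<in> borel_measurable M" "AE x in M. norm (Q (X n) x) \<le> k x"
      "AE x in M. (\<lambda>n. Q (X n) x) \<longlonglongrightarrow> F' t0 x" for n
      using Qm lim Qb X by auto
    show ?thesis
      using integrable_dominated_convergence[OF F'm *(1) k *(3,2)]
        integral_dominated_convergence[OF F'm *(1) k *(3,2)] by simp
  qed
  \<comment> \<open>One concrete null sequence within the radius \<open>\<delta>\<close> is enough
    for the integrability of \<open>F' t0\<close>; the derivative itself needs all null
    sequences.\<close>
  have "(\<lambda>n. (\<delta>/2) * inverse (real (Suc n))) \<longlonglongrightarrow> (\<delta>/2) * 0"
    by (rule tendsto_mult[OF tendsto_const LIMSEQ_inverse_real_of_nat])
  moreover have "\<bar>(\<delta>/2) * inverse (real (Suc n))\<bar> < \<delta>" for n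
  proof -
    have "(\<delta>/2) * inverse (real (Suc n)) \<le> (\<delta>/2) * 1"
      using \<open>0 < \<delta>\<close> by (intro mult_left_mono) (auto intro: inverse_le_1_iff[THEN iffD2])
    then show ?thesis
      using \<open>0 < \<delta>\<close> by (simp add: abs_mult)
  qed
  ultimately show "integrable M (F' t0)"
    using main[of "\<lambda>n. (\<delta>/2) * inverse (real (Suc n))"] \<open>0 < \<delta>\<close> by simp
  show "((\<lambda>t. LINT x|M. F t x) has_real_derivative (LINT x|M. F' t0 x)) (at t0)"
    unfolding DERIV_def tendsto_at_iff_sequentially comp_def
  proof (intro allI impI)
    fix X :: "nat \<Rightarrow> real"
    assume *: "\<forall>i. X i \<in> UNIV - {0}" "X \<longlonglongrightarrow> 0"
    \<comment> \<open>An arbitrary null sequence enters the radius \<open>\<delta>\<close> only from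
      some index \<open>N\<close> on, hence the shift.\<close>
    from *(2) \<open>0 < \<delta>\<close> obtain N where N: "\<And>n. n \<ge> N \<Longrightarrow> \<bar>X n\<bar> < \<delta>"
      by (auto simp: LIMSEQ_iff)
    have "(\<lambda>n. LINT x|M. Q (X (n + N)) x) \<longlonglongrightarrow> (LINT x|M. F' t0 x)"
      using main[of "\<lambda>n. X (n + N)"] N * LIMSEQ_ignore_initial_segment[OF *(2), of N] by auto
    moreover have "(LINT x|M. Q (X (n + N)) x)
        = ((LINT x|M. F (t0 + X (n + N)) x) - (LINT x|M. F t0 x)) / X (n + N)" for n
      unfolding Q_def using int[of "t0 + X (n + N)"] int[of t0] N[of "n + N"] \<open>0 < \<delta>\<close>
      by simp
    ultimately show "(\<lambda>n. ((LINT x|M. F (t0 + X n) x) - (LINT x|M. F t0 x)) / X n)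
        \<longlonglongrightarrow> (LINT x|M. F' t0 x)"
      by (simp add: LIMSEQ_offset[where k = N])
  qed
qed

section \<open>Integrals of compactly supported functions\<close>

lemma integrable_compact_support:
  fixes f :: "'a::euclidean_space \<Rightarrow> real"
  assumes "compact C" "continuous_on C f" "\<And>x. x \<notin> C \<Longrightarrow> f x = 0"
  shows "integrable lborel f"
proof -
  have "integrable lborel (\<lambda>x. indicator C x *\<^sub>R f x)"
    using assms by (intro borel_integrable_compact) auto
  also have "(\<lambda>x. indicator C x *\<^sub>R f x) = f"
  proof
    show "indicator C x *\<^sub>R f x = f x" for x
      by (cases "x \<in> C") (simp_all add: assms(3))
  qed
  finally show ?thesis .
qed

lemma integrable_compact_support_mult:
  fixes f g :: "'a::euclidean_space \<Rightarrow> real"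
  assumes "compact C" "continuous_on C f" "continuous_on C g" "\<And>x. x \<notin> C \<Longrightarrow> f x = 0"
  shows "integrable lborel (\<lambda>x. f x * g x)"
  using assms by (intro integrable_compact_support[where C = C]) (auto intro!: continuous_intros)

lemma has_derivative_zero_outside:
  assumes "(G has_derivative G') (at x)" "closed C" "\<And>y. y \<notin> C \<Longrightarrow> G y = 0" "x \<notin> C"
  shows "G' = (\<lambda>h. 0)"
proof -
  have "(G has_derivative (\<lambda>h. 0)) (at x)"
    using has_derivative_transform_within_open[OF has_derivative_const[of 0], of "- C" x G]
      assms(2-4) by auto
  then show ?thesis
    using assms(1) has_derivative_unique by blast
qed

text \<open>By translation invariance, \<open>t \<mapsto> \<integral> G (t b + x) dx\<close> is constant.\<close>

lemma integral_directional_deriv_eq_0: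
  fixes G :: "'a::euclidean_space \<Rightarrow> real"
  assumes C: "compact C" and G: "\<And>x. (G has_derivative G' x) (at x)"
    and G0: "\<And>x. x \<notin> C \<Longrightarrow> G x = 0" and cont: "continuous_on C (\<lambda>x. G' x b)"
  shows "integrable lborel (\<lambda>x. G' x b)" and "(LINT x|lborel. G' x b) = 0"
proof -
  have G'0: "G' x b = 0" if "x \<notin> C" for x
    using has_derivative_zero_outside[OF G compact_imp_closed[OF C] G0 that] by simp
  have contG: "continuous_on C G"
    using G has_derivative_continuous continuous_at_imp_continuous_on by blast
  have intG: "integrable lborel G"
    using integrable_compact_support[OF C contG G0] .
  from C cont have "bounded ((\<lambda>x. G' x b) ` C)"
    by (simp add: compact_continuous_image compact_imp_bounded)
  then obtain m where m: "\<And>x. x \<in> C \<Longrightarrow> \<bar>G' x b\<bar> \<le> m" "m > 0"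
    unfolding bounded_pos by (metis image_eqI real_norm_def)
  from C obtain B where B: "\<And>x. x \<in> C \<Longrightarrow> norm x \<le> B"
    using compact_imp_bounded bounded_iff by metis
  \<comment> \<open>For |t| < 1 all translates of \<open>C\<close> by -t b lie in the ball of radius
    \<open>B + norm b\<close>, so one multiple of its indicator dominates all the derivatives
    involved.\<close>
  define k where "k = (\<lambda>x::'a. m * indicat_real (cball 0 (B + norm b)) x)"
  have shift: "integrable lborel (\<lambda>x. G (t *\<^sub>R b + x))"
    "(LINT x|lborel. G (t *\<^sub>R b + x)) = (LINT x|lborel. G x)" for t
  proof -
    have 1: "G \<in> borel_measurable lborel" "(+) (t *\<^sub>R b) \<in> lborel \<rightarrow>\<^sub>M borel"
      using intG by auto
    show "integrable lborel (\<lambda>x. G (t *\<^sub>R b + x))"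
      using integrable_distr_eq[OF 1(2), of G] intG 1 lborel_distr_plus[of "t *\<^sub>R b"] by simp
    show "(LINT x|lborel. G (t *\<^sub>R b + x)) = (LINT x|lborel. G x)"
      using integral_distr[OF 1(2), of G] 1 lborel_distr_plus[of "t *\<^sub>R b"] by simp
  qed
  have bound: "\<bar>G' (t *\<^sub>R b + x) b\<bar> \<le> k x" if "\<bar>t - 0\<bar> < 1" for t x
  proof (cases "t *\<^sub>R b + x \<in> C")
    case True
    have "norm x \<le> norm (t *\<^sub>R b + x) + norm (t *\<^sub>R b)"
      by (metis add_diff_cancel_left' norm_triangle_ineq4)
    also have "\<dots> \<le> B + norm b"
      using B[OF True] that mult_right_mono[of "\<bar>t\<bar>" 1 "norm b"] by simp
    finally show ?thesis using m True by (simp add: k_def)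
  qed (use G'0 m in \<open>auto simp: k_def indicator_def\<close>)
  have deriv: "((\<lambda>s. G (s *\<^sub>R b + x)) has_real_derivative G' (t *\<^sub>R b + x) b) (at t)" for t x
  proof -
    have "((\<lambda>s. G (s *\<^sub>R b + x)) has_derivative (\<lambda>h. G' (t *\<^sub>R b + x) (h *\<^sub>R b))) (at t)"
      by (rule has_derivative_compose[OF _ G]) (auto intro!: derivative_eq_intros)
    moreover have "G' (t *\<^sub>R b + x) (h *\<^sub>R b) = G' (t *\<^sub>R b + x) b * h" for h
      using linear_scale[OF has_derivative_linear[OF G]] by (simp add: mult.commute)
    ultimately show ?thesis
      by (simp add: has_field_derivative_def)
  qed
  have kint: "integrable lborel k"
    unfolding k_def using emeasure_lborel_cball_finite[of 0 "B + norm b"]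
    by (intro integrable_mult_right integrable_real_indicator) auto
  note D = DERIV_integral[where F = "\<lambda>t x. G (t *\<^sub>R b + x)" and F' = "\<lambda>t x. G' (t *\<^sub>R b + x) b"
      and k = k and \<delta> = 1 and ?t0.0 = 0, OF _ shift(1) deriv bound kint]
  show "integrable lborel (\<lambda>x. G' x b)"
    using D(1) by simp
  have "((\<lambda>t. LINT x|lborel. G x) has_real_derivative (LINT x|lborel. G' x b)) (at (0::real))"
    using D(2) by (simp add: shift(2))
  then show "(LINT x|lborel. G' x b) = 0"
    using DERIV_const DERIV_unique by blast
qed

section \<open>Gradients, Laplacians and classes of differentiability\<close>

lemma partial_deriv_eq:
  "(f has_derivative f') (at x) \<Longrightarrow> partial_deriv b f x = f' b"
  unfolding partial_deriv_def using frechet_derivative_at by metis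

lemma grad_inner_Basis [simp]: "b \<in> Basis \<Longrightarrow> grad f x \<bullet> b = partial_deriv b f x"
  by (simp add: grad_def)

lemma grad_inner: "grad f x \<bullet> h = (\<Sum>b\<in>Basis. partial_deriv b f x * (b \<bullet> h))"
  by (simp add: grad_def inner_sum_left)

lemma has_derivative_grad:
  fixes f :: "'a::euclidean_space \<Rightarrow> real"
  assumes "f differentiable (at x)"
  shows "(f has_derivative (\<lambda>h. grad f x \<bullet> h)) (at x)"
proof -
  let ?D = "frechet_derivative f (at x)"
  have D: "(f has_derivative ?D) (at x)"
    using assms frechet_derivative_works by blast
  have "?D h = grad f x \<bullet> h" for h
  proof -
    have "?D h = ?D (\<Sum>b\<in>Basis. (h \<bullet> b) *\<^sub>R b)"
      by (simp add: euclidean_representation)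
    also have "\<dots> = (\<Sum>b\<in>Basis. (h \<bullet> b) * ?D b)"
      using has_derivative_linear[OF D] by (simp add: linear_sum linear_scale)
    finally show ?thesis
      by (simp add: grad_inner[of f x h] partial_deriv_def inner_commute[of h] mult.commute)
  qed
  then show ?thesis
    using D by (metis (no_types, lifting) ext)
qed

lemma grad_eq:
  assumes "(f has_derivative (\<lambda>h. g \<bullet> h)) (at x)"
  shows "grad f x = g"
  by (rule euclidean_eqI) (use partial_deriv_eq[OF assms] in simp)

lemma Ck_on_1D:
  assumes "Ck_on 1 U f"
  shows "x \<in> U \<Longrightarrow> f differentiable (at x)" "continuous_on U f" "continuous_on U (grad f)"
proof -
  show d: "f differentiable (at x)" if "x \<in> U" for x
    using assms that by simp
  then show "continuous_on U f"
    by (meson continuous_at_imp_continuous_on differentiable_imp_continuous_within)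
  show "continuous_on U (grad f)"
    unfolding grad_def using assms by (auto intro!: continuous_intros)
qed

lemma Ck_on_2D:
  assumes "Ck_on 2 U f"
  shows "x \<in> U \<Longrightarrow> f differentiable (at x)" "continuous_on U f" "continuous_on U (grad f)"
    "x \<in> U \<Longrightarrow> b \<in> Basis \<Longrightarrow> partial_deriv b f differentiable (at x)"
    "b \<in> Basis \<Longrightarrow> continuous_on U (partial_deriv b f)"
    "b \<in> Basis \<Longrightarrow> c \<in> Basis \<Longrightarrow> continuous_on U (partial_deriv c (partial_deriv b f))"
    "continuous_on U (laplacian f)"
proof -
  have *: "Ck_on (Suc (Suc 0)) U f"
    using assms by (simp add: numeral_2_eq_2)
  show d: "x \<in> U \<Longrightarrow> f differentiable (at x)" 
    "x \<in> U \<Longrightarrow> b \<in> Basis \<Longrightarrow> partial_deriv b f differentiable (at x)"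
    "b \<in> Basis \<Longrightarrow> c \<in> Basis \<Longrightarrow> continuous_on U (partial_deriv c (partial_deriv b f))" for x b c
    using * by auto
  show d2: "b \<in> Basis \<Longrightarrow> continuous_on U (partial_deriv b f)" for b
    using d(2) by (meson continuous_at_imp_continuous_on differentiable_imp_continuous_within)
  show "continuous_on U f"
    using d(1) by (meson continuous_at_imp_continuous_on differentiable_imp_continuous_within)
  show "continuous_on U (grad f)"
    unfolding grad_def using d2 by (auto intro!: continuous_intros)
  show "continuous_on U (laplacian f)"
    unfolding laplacian_def using d(3) by (auto intro!: continuous_intros)
qed

text \<open>\<open>Ck_on\<close> and \<open>laplacian\<close> are built from
  \<open>frechet_derivative\<close>; this is the way to obtain both from explicit formulas. Openness
  of \<open>U\<close> allows \<open>partial_deriv b w\<close> to be replaced by the formula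
  \<open>w1\<close> near a point before it is differentiated again.\<close>

lemma C2_I:
  fixes w :: "'a::euclidean_space \<Rightarrow> real"
  assumes "open U" and w1: "\<And>x. x \<in> U \<Longrightarrow> (w has_derivative w1 x) (at x)"
    and w2: "\<And>x b. x \<in> U \<Longrightarrow> b \<in> Basis \<Longrightarrow> ((\<lambda>y. w1 y b) has_derivative w2 b x) (at x)"
    and cont: "\<And>b c. b \<in> Basis \<Longrightarrow> c \<in> Basis \<Longrightarrow> continuous_on U (\<lambda>x. w2 b x c)"
  shows "Ck_on 2 U w"
    and "x \<in> U \<Longrightarrow> laplacian w x = (\<Sum>b\<in>Basis. w2 b x b)"
proof -
  have p: "partial_deriv b w x = w1 x b" if "x \<in> U" for x b
    using partial_deriv_eq[OF w1[OF that]] .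
  have pd: "(partial_deriv b w has_derivative w2 b x) (at x)" if "x \<in> U" "b \<in> Basis" for x b
    by (rule has_derivative_transform_within_open[OF w2[OF that] \<open>open U\<close> \<open>x \<in> U\<close>])
      (use p in auto)
  then have pp: "partial_deriv c (partial_deriv b w) x = w2 b x c" if "x \<in> U" "b \<in> Basis" for x b c
    using partial_deriv_eq that by blast
  have "Ck_on (Suc (Suc 0)) U w"
  proof (simp, intro conjI ballI)
    show "w differentiable at x" if "x \<in> U" for x
      using w1[OF that] differentiable_def by blast
    show "partial_deriv b w differentiable at x" if "x \<in> U" "b \<in> Basis" for x b
      using pd[OF that] differentiable_def by blast
    show "continuous_on U (partial_deriv c (partial_deriv b w))" if "b \<in> Basis" "c \<in> Basis" for b c
      using cont[OF that] pp that by (metis (no_types, lifting) continuous_on_cong)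
  qed
  then show "Ck_on 2 U w" by (simp add: numeral_2_eq_2)
  show "x \<in> U \<Longrightarrow> laplacian w x = (\<Sum>b\<in>Basis. w2 b x b)"
    by (simp add: laplacian_def pp)
qed

lemma has_derivative_dilation:
  fixes w :: "'a::euclidean_space \<Rightarrow> real"
  assumes "w differentiable (at (R *\<^sub>R x))"
  shows "((\<lambda>y. c * w (R *\<^sub>R y)) has_derivative (\<lambda>h. ((c * R) *\<^sub>R grad w (R *\<^sub>R x)) \<bullet> h)) (at x)"
proof -
  have "((\<lambda>y. w (R *\<^sub>R y)) has_derivative (\<lambda>h. grad w (R *\<^sub>R x) \<bullet> (R *\<^sub>R h))) (at x)"
    using has_derivative_compose[of "\<lambda>y. R *\<^sub>R y" "\<lambda>h. R *\<^sub>R h" x UNIV w "\<lambda>h. grad w (R *\<^sub>R x) \<bullet> h"]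
      has_derivative_grad[OF assms] by (simp add: bounded_linear_scaleR_right bounded_linear_imp_has_derivative)
  from has_derivative_mult_right[OF this, of c] show ?thesis
    by (simp add: mult.assoc)
qed

lemma C2_dilation:
  fixes w :: "'a::euclidean_space \<Rightarrow> real" and c R :: real
  assumes w: "Ck_on 2 U w" and U: "open U" "open V" "\<And>x. x \<in> V \<Longrightarrow> R *\<^sub>R x \<in> U"
  shows "Ck_on 2 V (\<lambda>x. c * w (R *\<^sub>R x))"
    and "x \<in> V \<Longrightarrow> laplacian (\<lambda>x. c * w (R *\<^sub>R x)) x = c * R\<^sup>2 * laplacian w (R *\<^sub>R x)"
proof -
  define w1 where "w1 x h = ((c * R) *\<^sub>R grad w (R *\<^sub>R x)) \<bullet> h" for x h
  define w2 where "w2 b x h = ((c * R * R) *\<^sub>R grad (partial_deriv b w) (R *\<^sub>R x)) \<bullet> h" for b x h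
  have 1: "((\<lambda>x. c * w (R *\<^sub>R x)) has_derivative w1 x) (at x)" if "x \<in> V" for x
    unfolding w1_def using that U w
    by (intro has_derivative_dilation) (auto dest: Ck_on_2D)
  have 2: "((\<lambda>y. w1 y b) has_derivative w2 b x) (at x)" if "x \<in> V" "b \<in> Basis" for x b
  proof -
    have "w2 b x = (\<lambda>h. ((c * R * R) *\<^sub>R grad (partial_deriv b w) (R *\<^sub>R x)) \<bullet> h)"
      "(\<lambda>y. w1 y b) = (\<lambda>y. (c * R) * partial_deriv b w (R *\<^sub>R y))"
      using that(2) by (auto simp: w1_def w2_def)
    then show ?thesis
      using has_derivative_dilation[OF Ck_on_2D(4)[OF w U(3)[OF that(1)] that(2)], of "c * R"]
      by presburger
  qed
  have 3: "continuous_on V (\<lambda>x. w2 b x a)" if "b \<in> Basis" "a \<in> Basis" for a b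
    unfolding w2_def using that U
    by (auto intro!: continuous_intros continuous_on_compose2[OF Ck_on_2D(6)[OF w]])
  show "Ck_on 2 V (\<lambda>x. c * w (R *\<^sub>R x))"
    by (rule C2_I[OF U(2) 1 2 3])
  show "laplacian (\<lambda>x. c * w (R *\<^sub>R x)) x = c * R\<^sup>2 * laplacian w (R *\<^sub>R x)" if "x \<in> V"
    using C2_I(2)[OF U(2) 1 2 3 that]
    by (simp add: w2_def laplacian_def sum_distrib_left power2_eq_square mult_ac)
qed

lemma grad_zero_outside:
  fixes \<zeta> :: "'a::euclidean_space \<Rightarrow> real"
  assumes "Ck_on 1 UNIV \<zeta>" "compact C" "\<And>x. x \<notin> C \<Longrightarrow> \<zeta> x = 0" "x \<notin> C"
  shows "grad \<zeta> x = 0"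
proof -
  have "(\<zeta> has_derivative (\<lambda>h. grad \<zeta> x \<bullet> h)) (at x)"
    using assms Ck_on_1D has_derivative_grad by blast
  then have "(\<lambda>h. grad \<zeta> x \<bullet> h) = (\<lambda>h. 0)"
    using assms has_derivative_zero_outside[of \<zeta> _ x C] compact_imp_closed by blast
  then show ?thesis
    by (metis inner_eq_zero_iff)
qed

lemma integrable_grad_square:
  fixes \<zeta> :: "'a::euclidean_space \<Rightarrow> real"
  assumes "Ck_on 1 UNIV \<zeta>" "compact C" "\<And>x. x \<notin> C \<Longrightarrow> \<zeta> x = 0"
  shows "integrable lborel (\<lambda>x. (norm (grad \<zeta> x))\<^sup>2)"
  using grad_zero_outside[OF assms] Ck_on_1D(3)[OF assms(1)]
  by (intro integrable_compact_support[OF assms(2)])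
    (auto intro!: continuous_intros continuous_on_subset[of UNIV "grad \<zeta>"])

section \<open>Positive supersolutions and Picone's identity\<close>

text \<open>The field \<zeta>^2 \<nabla>w / w has compact support, so its divergence, which is 2
  \<zeta> \<nabla>\<zeta> \<bullet> P - \<zeta>^2 |P|^2 + \<zeta>^2 \<Delta>w / w, has integral 0.
  The integration is carried out component by component.\<close>

lemma picone_identity:
  fixes w \<zeta> :: "'a::euclidean_space \<Rightarrow> real"
  assumes U: "open U" and w: "Ck_on 2 U w" and pos: "\<And>x. x \<in> U \<Longrightarrow> 0 < w x"
    and \<zeta>: "Ck_on 1 UNIV \<zeta>" and C: "compact C" "C \<subseteq> U" and \<zeta>0: "\<And>x. x \<notin> C \<Longrightarrow> \<zeta> x = 0"
  defines "P \<equiv> \<lambda>x. (1 / w x) *\<^sub>R grad w x"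
  shows "integrable lborel (\<lambda>x. (\<zeta> x)\<^sup>2 * (- laplacian w x / w x))"
    and "integrable lborel (\<lambda>x. 2 * \<zeta> x * (grad \<zeta> x \<bullet> P x) - (\<zeta> x)\<^sup>2 * (norm (P x))\<^sup>2)"
    and "(LINT x|lborel. (\<zeta> x)\<^sup>2 * (- laplacian w x / w x))
      = (LINT x|lborel. 2 * \<zeta> x * (grad \<zeta> x \<bullet> P x) - (\<zeta> x)\<^sup>2 * (norm (P x))\<^sup>2)"
proof -
  have wC: "continuous_on C w" "continuous_on C (grad w)" "continuous_on C (laplacian w)"
    using Ck_on_2D(2,3,7)[OF w] C(2) continuous_on_subset by blast+
  have pC: "continuous_on C (partial_deriv b w)" "continuous_on C (partial_deriv b (partial_deriv b w))"
    if "b \<in> Basis" for b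
    using Ck_on_2D(5,6)[OF w] that C(2) continuous_on_subset by blast+
  have \<zeta>C: "continuous_on C \<zeta>" "continuous_on C (grad \<zeta>)"
    using Ck_on_1D(2,3)[OF \<zeta>] continuous_on_subset by blast+
  have w0: "w x \<noteq> 0" if "x \<in> C" for x
    using pos C(2) that by force
  have PC: "continuous_on C P"
    unfolding P_def using wC w0 by (auto intro!: continuous_intros)
  show i1: "integrable lborel (\<lambda>x. (\<zeta> x)\<^sup>2 * (- laplacian w x / w x))"
    by (rule integrable_compact_support_mult[OF C(1)])
      (use wC \<zeta>C w0 \<zeta>0 in \<open>auto intro!: continuous_intros\<close>)
  show i2: "integrable lborel (\<lambda>x. 2 * \<zeta> x * (grad \<zeta> x \<bullet> P x) - (\<zeta> x)\<^sup>2 * (norm (P x))\<^sup>2)"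
    by (rule integrable_compact_support[OF C(1)])
      (use PC \<zeta>C \<zeta>0 in \<open>auto intro!: continuous_intros\<close>)
  define G where "G b x = (\<zeta> x)\<^sup>2 * (partial_deriv b w x / w x)" for b x
  \<comment> \<open>Outside \<open>U\<close> nothing is known about \<open>w\<close> and its
    gradient is an unspecified value. The derivative is therefore set to 0 there, which is correct
    because \<open>G b\<close> vanishes on the open complement of \<open>C\<close>.\<close>
  define G' where "G' b x h = (if x \<in> U then 2 * \<zeta> x * (grad \<zeta> x \<bullet> h) * (partial_deriv b w x / w x)
    + (\<zeta> x)\<^sup>2 * ((grad (partial_deriv b w) x \<bullet> h) / w x - partial_deriv b w x * (grad w x \<bullet> h) / (w x)\<^sup>2)
    else 0)" for b x h
  have G: "(G b has_derivative G' b x) (at x)" if b: "b \<in> Basis" for b x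
  proof (cases "x \<in> U")
    case True
    have d: "(\<zeta> has_derivative (\<lambda>h. grad \<zeta> x \<bullet> h)) (at x)" "(w has_derivative (\<lambda>h. grad w x \<bullet> h)) (at x)"
      "(partial_deriv b w has_derivative (\<lambda>h. grad (partial_deriv b w) x \<bullet> h)) (at x)"
      using Ck_on_1D(1)[OF \<zeta>] Ck_on_2D(1,4)[OF w] True b by (auto intro!: has_derivative_grad)
    have "G' b x = (\<lambda>h. 2 * \<zeta> x * (grad \<zeta> x \<bullet> h) * (partial_deriv b w x / w x)
    + (\<zeta> x)\<^sup>2 * ((grad (partial_deriv b w) x \<bullet> h) / w x - partial_deriv b w x * (grad w x \<bullet> h) / (w x)\<^sup>2))"
      using True by (simp add: G'_def fun_eq_iff)
    then show ?thesis
      unfolding G_def using pos[OF True]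
      by (auto intro!: derivative_eq_intros d simp: fun_eq_iff field_simps power2_eq_square)
  next
    case False
    then have "x \<in> - C" using C by auto
    have "(G b has_derivative (\<lambda>h. 0)) (at x)"
      using has_derivative_transform_within_open[OF has_derivative_const[of 0], of "- C" x "G b"]
        \<open>x \<in> - C\<close> compact_imp_closed[OF C(1)] \<zeta>0 by (auto simp: G_def)
    then show ?thesis
      using False by (simp add: G'_def[abs_def])
  qed
  have contG': "continuous_on C (\<lambda>x. G' b x b)" if b: "b \<in> Basis" for b
  proof -
    have "continuous_on C (\<lambda>x. 2 * \<zeta> x * (grad \<zeta> x \<bullet> b) * (partial_deriv b w x / w x)
    + (\<zeta> x)\<^sup>2 * ((partial_deriv b (partial_deriv b w) x) / w x - partial_deriv b w x * (grad w x \<bullet> b) / (w x)\<^sup>2))"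
      using pC[OF b] wC \<zeta>C w0 by (auto intro!: continuous_intros)
    then show ?thesis
      by (rule continuous_on_eq) (use C(2) b in \<open>auto simp: G'_def subset_iff\<close>)
  qed
  have G0: "G b x = 0" if "x \<notin> C" for b x
    using \<zeta>0[OF that] by (simp add: G_def)
  have int0: "integrable lborel (\<lambda>x. G' b x b)" "(LINT x|lborel. G' b x b) = 0" if "b \<in> Basis" for b
    using integral_directional_deriv_eq_0[OF C(1) G[OF that] G0 contG'[OF that]] by auto
  have "0 = (LINT x|lborel. (\<Sum>b\<in>Basis. G' b x b))"
    using int0 by (simp add: Bochner_Integration.integral_sum)
  also have "(\<lambda>x. \<Sum>b\<in>Basis. G' b x b) = (\<lambda>x. 2 * \<zeta> x * (grad \<zeta> x \<bullet> P x) - (\<zeta> x)\<^sup>2 * (norm (P x))\<^sup>2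
      - (\<zeta> x)\<^sup>2 * (- laplacian w x / w x))"
  proof
    fix x
    show "(\<Sum>b\<in>Basis. G' b x b) = 2 * \<zeta> x * (grad \<zeta> x \<bullet> P x) - (\<zeta> x)\<^sup>2 * (norm (P x))\<^sup>2
      - (\<zeta> x)\<^sup>2 * (- laplacian w x / w x)"
    proof (cases "x \<in> U")
      case True
      have n: "(norm (P x))\<^sup>2 = (\<Sum>b\<in>Basis. (partial_deriv b w x)\<^sup>2 / (w x)\<^sup>2)"
        unfolding power2_norm_eq_inner euclidean_inner[of "P x" "P x"]
        by (simp add: P_def power2_eq_square)
      have i: "grad \<zeta> x \<bullet> P x = (\<Sum>b\<in>Basis. partial_deriv b \<zeta> x * partial_deriv b w x / w x)"
        unfolding euclidean_inner[of "grad \<zeta> x" "P x"] by (simp add: P_def)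
      have "(\<Sum>b\<in>Basis. G' b x b) = (\<Sum>b\<in>Basis. 2 * \<zeta> x * (partial_deriv b \<zeta> x * partial_deriv b w x / w x)
          - (\<zeta> x)\<^sup>2 * ((partial_deriv b w x)\<^sup>2 / (w x)\<^sup>2)
          + (\<zeta> x)\<^sup>2 / w x * partial_deriv b (partial_deriv b w) x)"
        using True pos[OF True] by (intro sum.cong) (auto simp: G'_def field_simps power2_eq_square)
      then show ?thesis
        unfolding n i laplacian_def
        by (simp add: sum.distrib sum_subtractf sum_distrib_left sum_divide_distrib)
    next
      case False
      then have "\<zeta> x = 0" using C(2) \<zeta>0 by blast
      then show ?thesis using False by (simp add: G'_def)
    qed
  qed
  finally show "(LINT x|lborel. (\<zeta> x)\<^sup>2 * (- laplacian w x / w x))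
      = (LINT x|lborel. 2 * \<zeta> x * (grad \<zeta> x \<bullet> P x) - (\<zeta> x)\<^sup>2 * (norm (P x))\<^sup>2)"
    using i1 i2 by simp
qed

text \<open>Pointwise, 2 \<zeta> \<nabla>\<zeta> \<bullet> P - \<zeta>^2 |P|^2 = |\<nabla>\<zeta>|^2
  - |\<nabla>\<zeta> - \<zeta> P|^2, and the last square is dropped. This is the version for a
  single supersolution, used where no gain is to be kept.\<close>

lemma barta_inequality:
  fixes w \<zeta> :: "'a::euclidean_space \<Rightarrow> real"
  assumes U: "open U" and w: "Ck_on 2 U w" and pos: "\<And>x. x \<in> U \<Longrightarrow> 0 < w x"
    and \<zeta>: "Ck_on 1 UNIV \<zeta>" and C: "compact C" "C \<subseteq> U" and \<zeta>0: "\<And>x. x \<notin> C \<Longrightarrow> \<zeta> x = 0"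
  shows "(LINT x|lborel. (\<zeta> x)\<^sup>2 * (- laplacian w x / w x)) \<le> (LINT x|lborel. (norm (grad \<zeta> x))\<^sup>2)"
proof -
  note pw = picone_identity[OF U w pos \<zeta> C \<zeta>0]
  have "(LINT x|lborel. (\<zeta> x)\<^sup>2 * (- laplacian w x / w x)) = (LINT x|lborel.
      2 * \<zeta> x * (grad \<zeta> x \<bullet> ((1 / w x) *\<^sub>R grad w x)) - (\<zeta> x)\<^sup>2 * (norm ((1 / w x) *\<^sub>R grad w x))\<^sup>2)"
    using pw by simp
  also have "\<dots> \<le> (LINT x|lborel. (norm (grad \<zeta> x))\<^sup>2)"
  proof (rule integral_mono)
    fix x
    let ?P = "(1 / w x) *\<^sub>R grad w x"
    have "0 \<le> (norm (grad \<zeta> x - \<zeta> x *\<^sub>R ?P))\<^sup>2" by simp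
    also have "\<dots> = (norm (grad \<zeta> x))\<^sup>2 - 2 * \<zeta> x * (grad \<zeta> x \<bullet> ?P) + (\<zeta> x)\<^sup>2 * (norm ?P)\<^sup>2"
    proof -
      have "(norm (g - t *\<^sub>R a))\<^sup>2 = (norm g)\<^sup>2 - 2 * t * (g \<bullet> a) + t\<^sup>2 * (norm a)\<^sup>2" for g a :: 'a and t
        unfolding power2_norm_eq_inner power2_eq_square[of t]
        by (simp add: inner_diff_left inner_diff_right inner_commute[of a g] algebra_simps)
      then show ?thesis .
    qed
    finally show "2 * \<zeta> x * (grad \<zeta> x \<bullet> ?P) - (\<zeta> x)\<^sup>2 * (norm ?P)\<^sup>2 \<le> (norm (grad \<zeta> x))\<^sup>2"
      by simp
  qed (use pw integrable_grad_square[OF \<zeta> C(1) \<zeta>0] in simp_all)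
  finally show ?thesis .
qed

text \<open>By the parallelogram identity |P|^2 + |Q|^2 = |P + Q|^2 / 2 + |P - Q|^2 / 2. The part
  with P + Q is absorbed by completing the square with \<nabla>\<zeta>; the part with P - Q, the
  gradient of the logarithm of the ratio, is the gain.\<close>

lemma barta_inequality_pair:
  fixes w z \<zeta> :: "'a::euclidean_space \<Rightarrow> real"
  assumes U: "open U" and w: "Ck_on 2 U w" "\<And>x. x \<in> U \<Longrightarrow> 0 < w x"
    and z: "Ck_on 2 U z" "\<And>x. x \<in> U \<Longrightarrow> 0 < z x"
    and \<zeta>: "Ck_on 1 UNIV \<zeta>" and C: "compact C" "C \<subseteq> U" and \<zeta>0: "\<And>x. x \<notin> C \<Longrightarrow> \<zeta> x = 0"
  defines "D \<equiv> \<lambda>x. (1 / w x) *\<^sub>R grad w x - (1 / z x) *\<^sub>R grad z x"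
  shows "integrable lborel (\<lambda>x. (\<zeta> x)\<^sup>2 * (norm (D x))\<^sup>2)"
    and "(LINT x|lborel. (\<zeta> x)\<^sup>2 * (- laplacian w x / w x - laplacian z x / z x))
      \<le> 2 * (LINT x|lborel. (norm (grad \<zeta> x))\<^sup>2) - (LINT x|lborel. (\<zeta> x)\<^sup>2 * (norm (D x))\<^sup>2) / 2"
proof -
  note pw = picone_identity[OF U w \<zeta> C \<zeta>0] and pz = picone_identity[OF U z \<zeta> C \<zeta>0]
  let ?P = "\<lambda>x. (1 / w x) *\<^sub>R grad w x" and ?Q = "\<lambda>x. (1 / z x) *\<^sub>R grad z x"
  have cont: "continuous_on C w" "continuous_on C (grad w)" "continuous_on C z" "continuous_on C (grad z)"
    "continuous_on C \<zeta>"
    using Ck_on_2D(2,3)[OF w(1)] Ck_on_2D(2,3)[OF z(1)] Ck_on_1D(2)[OF \<zeta>] C(2) continuous_on_subset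
    by blast+
  have nz: "w x \<noteq> 0" "z x \<noteq> 0" if "x \<in> C" for x
    using w(2) z(2) C(2) that by force+
  show iD: "integrable lborel (\<lambda>x. (\<zeta> x)\<^sup>2 * (norm (D x))\<^sup>2)"
    unfolding D_def using cont nz
    by (intro integrable_compact_support_mult[OF C(1)]) (auto intro!: continuous_intros simp: \<zeta>0)
  have "(LINT x|lborel. (\<zeta> x)\<^sup>2 * (- laplacian w x / w x - laplacian z x / z x))
      = (LINT x|lborel. (\<zeta> x)\<^sup>2 * (- laplacian w x / w x) + (\<zeta> x)\<^sup>2 * (- laplacian z x / z x))"
    by (simp add: algebra_simps)
  also have "\<dots> = (LINT x|lborel. (2 * \<zeta> x * (grad \<zeta> x \<bullet> ?P x) - (\<zeta> x)\<^sup>2 * (norm (?P x))\<^sup>2)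
       + (2 * \<zeta> x * (grad \<zeta> x \<bullet> ?Q x) - (\<zeta> x)\<^sup>2 * (norm (?Q x))\<^sup>2))"
    using pw pz by simp
  also have "\<dots> \<le> (LINT x|lborel. 2 * (norm (grad \<zeta> x))\<^sup>2 - (\<zeta> x)\<^sup>2 * (norm (D x))\<^sup>2 / 2)"
  proof (rule integral_mono)
    fix x
    let ?S = "(\<zeta> x / 2) *\<^sub>R (?P x + ?Q x)"
    have "0 \<le> 2 * (norm (grad \<zeta> x - ?S))\<^sup>2" by simp
    also have "\<dots> = 2 * (norm (grad \<zeta> x))\<^sup>2 - (\<zeta> x)\<^sup>2 * (norm (D x))\<^sup>2 / 2
      - ((2 * \<zeta> x * (grad \<zeta> x \<bullet> ?P x) - (\<zeta> x)\<^sup>2 * (norm (?P x))\<^sup>2)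
       + (2 * \<zeta> x * (grad \<zeta> x \<bullet> ?Q x) - (\<zeta> x)\<^sup>2 * (norm (?Q x))\<^sup>2))"
    proof -
      have *: "2 * (norm (g - (t / 2) *\<^sub>R (a + b)))\<^sup>2 = 2 * (norm g)\<^sup>2 - t\<^sup>2 * (norm (a - b))\<^sup>2 / 2
        - ((2 * t * (g \<bullet> a) - t\<^sup>2 * (norm a)\<^sup>2) + (2 * t * (g \<bullet> b) - t\<^sup>2 * (norm b)\<^sup>2))"
        for g a b :: 'a and t :: real
        unfolding power2_norm_eq_inner power2_eq_square[of t]
        by (simp add: inner_diff_left inner_diff_right inner_add_left inner_add_right
            inner_commute[of b a] inner_commute[of a g] inner_commute[of b g] field_simps)
      show ?thesis unfolding D_def by (rule *)
    qed
    finally show "(2 * \<zeta> x * (grad \<zeta> x \<bullet> ?P x) - (\<zeta> x)\<^sup>2 * (norm (?P x))\<^sup>2)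
       + (2 * \<zeta> x * (grad \<zeta> x \<bullet> ?Q x) - (\<zeta> x)\<^sup>2 * (norm (?Q x))\<^sup>2)
       \<le> 2 * (norm (grad \<zeta> x))\<^sup>2 - (\<zeta> x)\<^sup>2 * (norm (D x))\<^sup>2 / 2"
      by simp
  qed (use pw pz iD integrable_grad_square[OF \<zeta> C(1) \<zeta>0] in \<open>simp_all\<close>)
  also have "\<dots> = 2 * (LINT x|lborel. (norm (grad \<zeta> x))\<^sup>2) - (LINT x|lborel. (\<zeta> x)\<^sup>2 * (norm (D x))\<^sup>2) / 2"
    using iD integrable_grad_square[OF \<zeta> C(1) \<zeta>0] by simp
  finally show "(LINT x|lborel. (\<zeta> x)\<^sup>2 * (- laplacian w x / w x - laplacian z x / z x))
      \<le> 2 * (LINT x|lborel. (norm (grad \<zeta> x))\<^sup>2) - (LINT x|lborel. (\<zeta> x)\<^sup>2 * (norm (D x))\<^sup>2) / 2" .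
qed

section \<open>Hardy's inequality\<close>

text \<open>One computation serves two purposes: with \<open>\<epsilon>\<close> > 0 the domain is
  the whole space and the function is the supersolution for Hardy's inequality; with
  \<open>\<epsilon>\<close> = 0 the domain is the space without \<open>z\<close> and the function is
  the comparison barrier.\<close>

lemma C2_radial_power:
  fixes c a \<epsilon> :: real and z :: "'a::euclidean_space"
  defines "\<rho> \<equiv> \<lambda>x. (x - z) \<bullet> (x - z) + \<epsilon>"
  defines "U \<equiv> {x. 0 < \<rho> x}"
  shows "open U" and "Ck_on 2 U (\<lambda>x. c * \<rho> x powr a)"
    and "x \<in> U \<Longrightarrow> laplacian (\<lambda>x. c * \<rho> x powr a) x
      = c * (2 * a * real DIM('a) * \<rho> x powr (a - 1)
         + 4 * a * (a - 1) * ((x - z) \<bullet> (x - z)) * \<rho> x powr (a - 2))"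
proof -
  have cont: "continuous_on S \<rho>" for S
    unfolding \<rho>_def by (intro continuous_intros)
  show "open U"
    unfolding U_def using continuous_on_open_vimage[of UNIV \<rho>] cont[of UNIV]
    by (intro open_Collect_less) auto
  define w1 where "w1 x h = 2 * a * c * ((x - z) \<bullet> h) * \<rho> x powr (a - 1)" for x h
  define w2 where "w2 b x h = 2 * a * c * ((h \<bullet> b) * \<rho> x powr (a - 1)
      + ((x - z) \<bullet> b) * (2 * (a - 1) * ((x - z) \<bullet> h) * \<rho> x powr (a - 2)))" for b x h
  have d\<rho>: "(\<rho> has_derivative (\<lambda>h. 2 * ((x - z) \<bullet> h))) (at x)" for x
    unfolding \<rho>_def by (auto intro!: derivative_eq_intros simp: inner_commute)
  have dpow: "((\<lambda>x. \<rho> x powr e) has_derivative (\<lambda>h. 2 * e * ((x - z) \<bullet> h) * \<rho> x powr (e - 1))) (at x)"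
    if "x \<in> U" for x e
  proof -
    have "((\<lambda>t. t powr e) has_derivative (\<lambda>k. (e * \<rho> x powr (e - 1)) * k)) (at (\<rho> x))"
      using that has_real_derivative_powr[of "\<rho> x" e] by (auto simp: U_def has_field_derivative_def)
    from has_derivative_compose[OF d\<rho> this] show ?thesis
      by (simp add: mult_ac)
  qed
  have 1: "((\<lambda>x. c * \<rho> x powr a) has_derivative w1 x) (at x)" if "x \<in> U" for x
    using has_derivative_mult_right[OF dpow[OF that, of a], of c] by (simp add: w1_def[abs_def] mult_ac)
  have 2: "((\<lambda>y. w1 y b) has_derivative w2 b x) (at x)" if "x \<in> U" "b \<in> Basis" for x b
  proof -
    have "((\<lambda>y. 2 * a * c * (((y - z) \<bullet> b) * \<rho> y powr (a - 1))) has_derivative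
       (\<lambda>h. 2 * a * c * (((x - z) \<bullet> b) * (2 * (a - 1) * ((x - z) \<bullet> h) * \<rho> x powr (a - 1 - 1))
         + (h \<bullet> b) * \<rho> x powr (a - 1)))) (at x)"
      by (intro has_derivative_mult_right has_derivative_mult dpow that)
        (auto intro!: derivative_eq_intros)
    then show ?thesis
      by (simp add: w1_def w2_def[abs_def] mult.assoc add.commute)
  qed
  have 3: "continuous_on U (\<lambda>x. w2 b x k)" for b k
    unfolding w2_def using cont by (intro continuous_intros) (auto simp: U_def)
  show "Ck_on 2 U (\<lambda>x. c * \<rho> x powr a)"
    by (rule C2_I[OF \<open>open U\<close> 1 2 3])
  show "laplacian (\<lambda>x. c * \<rho> x powr a) x
      = c * (2 * a * real DIM('a) * \<rho> x powr (a - 1)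
         + 4 * a * (a - 1) * ((x - z) \<bullet> (x - z)) * \<rho> x powr (a - 2))" if "x \<in> U"
  proof -
    have "laplacian (\<lambda>x. c * \<rho> x powr a) x = (\<Sum>b\<in>Basis. w2 b x b)"
      by (rule C2_I(2)[OF \<open>open U\<close> 1 2 3 that])
    also have "\<dots> = (\<Sum>b\<in>(Basis::'a set). 2 * a * c * \<rho> x powr (a - 1)
       + 4 * a * (a - 1) * c * \<rho> x powr (a - 2) * (((x - z) \<bullet> b) * ((x - z) \<bullet> b)))"
      by (intro sum.cong) (auto simp: w2_def algebra_simps)
    also have "\<dots> = 2 * a * c * \<rho> x powr (a - 1) * real DIM('a)
       + 4 * a * (a - 1) * c * \<rho> x powr (a - 2) * ((x - z) \<bullet> (x - z))"
      unfolding euclidean_inner[of "x - z" "x - z"] by (simp add: sum.distrib sum_distrib_left)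
    finally show ?thesis by (simp add: algebra_simps)
  qed
qed

text \<open>The supersolution is \<open>(|x|\<^sup>2 + \<epsilon>) powr (-(d - 2)/4)\<close>; because of \<open>\<epsilon>\<close> the test function need not vanish
  near the origin.\<close>

lemma hardy_inequality_regularized:
  fixes \<zeta> :: "'a::euclidean_space \<Rightarrow> real"
  assumes d: "DIM('a) \<ge> 3" and \<zeta>: "Ck_on 1 UNIV \<zeta>"
    and C: "compact C" and \<zeta>0: "\<And>x. x \<notin> C \<Longrightarrow> \<zeta> x = 0" and "0 < \<epsilon>"
  shows "integrable lborel (\<lambda>x. (\<zeta> x)\<^sup>2 / ((norm x)\<^sup>2 + \<epsilon>))"
    and "(real DIM('a) - 2)\<^sup>2 / 4 * (LINT x|lborel. (\<zeta> x)\<^sup>2 / ((norm x)\<^sup>2 + \<epsilon>))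
      \<le> (LINT x|lborel. (norm (grad \<zeta> x))\<^sup>2)"
proof -
  \<comment> \<open>The quotient -\<Delta>w/w is bounded below by s (d - 2 - s) divided by
    \<open>\<rho>\<close>. This value of \<open>s\<close> maximises the numerator and gives the
    constant (d - 2)^2 / 4.\<close>
  define s where "s = (real DIM('a) - 2) / 2"
  define \<rho> where "\<rho> = (\<lambda>x::'a. (x - 0) \<bullet> (x - 0) + \<epsilon>)"
  have \<rho>: "\<rho> x = (norm x)\<^sup>2 + \<epsilon>" for x
    by (simp add: \<rho>_def power2_norm_eq_inner)
  have pos: "\<rho> x > 0" for x
    using \<open>0 < \<epsilon>\<close> by (simp add: \<rho> add_nonneg_pos)
  then have U: "{x::'a. 0 < (x - 0) \<bullet> (x - 0) + \<epsilon>} = UNIV" by (simp add: \<rho>_def)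
  define w where "w = (\<lambda>x::'a. 1 * ((x - 0) \<bullet> (x - 0) + \<epsilon>) powr (- s / 2))"
  have w\<rho>: "w x = \<rho> x powr (- s / 2)" for x
    by (simp add: w_def \<rho>_def)
  have w: "Ck_on 2 UNIV w"
    using C2_radial_power(2)[of "0::'a" \<epsilon> 1 "- s / 2"] unfolding U w_def .
  have lap: "- laplacian w x / w x \<ge> (real DIM('a) - 2)\<^sup>2 / 4 * (1 / ((norm x)\<^sup>2 + \<epsilon>))" for x
  proof -
    have "laplacian w x = 1 * (2 * (- s / 2) * real DIM('a) * \<rho> x powr (- s / 2 - 1)
         + 4 * (- s / 2) * (- s / 2 - 1) * ((x - 0) \<bullet> (x - 0)) * \<rho> x powr (- s / 2 - 2))"
      using C2_radial_power(3)[of x 0 \<epsilon> 1 "- s / 2"] unfolding U w_def \<rho>_def by blast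
    also have "\<dots> = - s * real DIM('a) * \<rho> x powr (- s / 2 - 1)
         + s * (s + 2) * (norm x)\<^sup>2 * \<rho> x powr (- s / 2 - 2)"
      by (simp add: power2_norm_eq_inner field_simps)
    finally have L: "laplacian w x = \<dots>" .
    have p: "\<rho> x powr (- s / 2 - 1) = w x / \<rho> x" "\<rho> x powr (- s / 2 - 2) = w x / (\<rho> x)\<^sup>2"
      using pos[of x] by (simp_all add: w\<rho> powr_diff)
    have "w x > 0" using pos[of x] by (simp add: w\<rho>)
    have "- laplacian w x / w x = s * real DIM('a) / \<rho> x - s * (s + 2) * (norm x)\<^sup>2 / (\<rho> x)\<^sup>2"
      unfolding L p using \<open>w x > 0\<close> pos[of x] by (simp add: field_simps power2_eq_square)
    moreover have "s * (s + 2) * (norm x)\<^sup>2 / (\<rho> x)\<^sup>2 \<le> s * (s + 2) / \<rho> x"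
    proof -
      have "s * (s + 2) * (norm x)\<^sup>2 \<le> s * (s + 2) * \<rho> x"
        using d \<open>0 < \<epsilon>\<close> by (intro mult_left_mono) (auto simp: \<rho> s_def)
      then have "s * (s + 2) * (norm x)\<^sup>2 / (\<rho> x)\<^sup>2 \<le> s * (s + 2) * \<rho> x / (\<rho> x)\<^sup>2"
        by (rule divide_right_mono) simp
      then show ?thesis
        using pos[of x] by (simp add: power2_eq_square)
    qed
    moreover have "s * real DIM('a) / \<rho> x - s * (s + 2) / \<rho> x = (real DIM('a) - 2)\<^sup>2 / 4 * (1 / \<rho> x)"
    proof -
      have "s * real DIM('a) - s * (s + 2) = (real DIM('a) - 2)\<^sup>2 / 4"
        by (simp add: s_def field_simps power2_eq_square)
      then show ?thesis by (metis diff_divide_distrib mult.right_neutral times_divide_eq_right)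
    qed
    ultimately show ?thesis by (simp add: \<rho>)
  qed
  have contC: "continuous_on C \<zeta>"
    using Ck_on_1D(2)[OF \<zeta>] continuous_on_subset by blast
  show i: "integrable lborel (\<lambda>x. (\<zeta> x)\<^sup>2 / ((norm x)\<^sup>2 + \<epsilon>))"
    using pos contC unfolding \<rho> 
    by (intro integrable_compact_support[OF C]) (auto intro!: continuous_intros simp: \<zeta>0 less_imp_neq[THEN not_sym])
  have "(real DIM('a) - 2)\<^sup>2 / 4 * (LINT x|lborel. (\<zeta> x)\<^sup>2 / ((norm x)\<^sup>2 + \<epsilon>))
     = (LINT x|lborel. (\<zeta> x)\<^sup>2 * ((real DIM('a) - 2)\<^sup>2 / 4 * (1 / ((norm x)\<^sup>2 + \<epsilon>))))"
    using i by (simp add: Bochner_Integration.integral_mult_right_zero[symmetric] mult.commute)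
  also have "\<dots> \<le> (LINT x|lborel. (\<zeta> x)\<^sup>2 * (- laplacian w x / w x))"
  proof (rule integral_mono)
    show "integrable lborel (\<lambda>x. (\<zeta> x)\<^sup>2 * ((real DIM('a) - 2)\<^sup>2 / 4 * (1 / ((norm x)\<^sup>2 + \<epsilon>))))"
      using integrable_mult_right[OF i, of "(real DIM('a) - 2)\<^sup>2 / 4"] by (simp add: mult.commute)
    show "integrable lborel (\<lambda>x. (\<zeta> x)\<^sup>2 * (- laplacian w x / w x))"
      by (rule picone_identity(1)[OF open_UNIV w _ \<zeta> C _ \<zeta>0]) (use pos in \<open>auto simp: w\<rho> less_le\<close>)
  qed (rule mult_left_mono[OF lap], simp)
  also have "\<dots> \<le> (LINT x|lborel. (norm (grad \<zeta> x))\<^sup>2)"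
    by (rule barta_inequality[OF open_UNIV w _ \<zeta> C _ \<zeta>0]) (use pos in \<open>auto simp: w\<rho> less_le\<close>)
  finally show "(real DIM('a) - 2)\<^sup>2 / 4 * (LINT x|lborel. (\<zeta> x)\<^sup>2 / ((norm x)\<^sup>2 + \<epsilon>))
      \<le> (LINT x|lborel. (norm (grad \<zeta> x))\<^sup>2)" .
qed

text \<open>The regularized weights increase to 1/|x|^2 while the bound does not depend on the
  regularization, so monotone convergence yields integrability of the singular weight together with
  the inequality.\<close>

lemma hardy_inequality:
  fixes \<zeta> :: "'a::euclidean_space \<Rightarrow> real"
  assumes d: "DIM('a) \<ge> 3" and \<zeta>: "Ck_on 1 UNIV \<zeta>"
    and C: "compact C" and \<zeta>0: "\<And>x. x \<notin> C \<Longrightarrow> \<zeta> x = 0"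
  shows "integrable lborel (\<lambda>x. (\<zeta> x)\<^sup>2 / (norm x)\<^sup>2)"
    and "(real DIM('a) - 2)\<^sup>2 / 4 * (LINT x|lborel. (\<zeta> x)\<^sup>2 / (norm x)\<^sup>2)
      \<le> (LINT x|lborel. (norm (grad \<zeta> x))\<^sup>2)"
proof -
  define B where "B = (LINT x|lborel. (norm (grad \<zeta> x))\<^sup>2)"
  define k where "k = (real DIM('a) - 2)\<^sup>2 / 4"
  have "k > 0" using d by (simp add: k_def)
  define e where "e n = inverse (real (Suc n))" for n
  have e: "e n > 0" "m \<le> n \<Longrightarrow> e n \<le> e m" for m n
    by (simp_all add: e_def le_imp_inverse_le)
  define f where "f n x = (\<zeta> x)\<^sup>2 / ((norm x)\<^sup>2 + e n)" for n x
  note hr = hardy_inequality_regularized[OF d \<zeta> C \<zeta>0 e(1)]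
  have int: "integrable lborel (f n)" and bd: "(LINT x|lborel. f n x) \<le> B / k" for n
    using hr[of n] \<open>k > 0\<close> unfolding f_def B_def[symmetric] k_def[symmetric] by (auto simp: field_simps)
  have mono: "f m x \<le> f n x" if "m \<le> n" for m n x
    unfolding f_def using e(1)[of n] e(2)[OF that]
    by (intro divide_left_mono mult_pos_pos add_nonneg_pos) auto
  have "incseq (\<lambda>n. LINT x|lborel. f n x)"
    by (intro incseq_SucI integral_mono int mono) simp
  then obtain L where L: "(\<lambda>n. LINT x|lborel. f n x) \<longlonglongrightarrow> L"
    using bd incseq_convergent by (metis (no_types, lifting) )
  \<comment> \<open>At the origin the limit is wrong in general: \<open>f n 0\<close> tends to
    infinity if \<open>\<zeta> 0\<close> is not 0, whereas division by zero makes the right-hand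
    side 0. Hence only almost everywhere.\<close>
  have lim: "AE x in lborel. (\<lambda>n. f n x) \<longlonglongrightarrow> (\<zeta> x)\<^sup>2 / (norm x)\<^sup>2"
    using AE_lborel_singleton[of 0]
  proof eventually_elim
    case (elim x)
    have "(\<lambda>n. f n x) \<longlonglongrightarrow> (\<zeta> x)\<^sup>2 / ((norm x)\<^sup>2 + 0)"
      unfolding f_def e_def using elim
      by (intro tendsto_divide tendsto_add tendsto_const LIMSEQ_inverse_real_of_nat) auto
    then show ?case by simp
  qed
  have meas: "(\<lambda>x. (\<zeta> x)\<^sup>2 / (norm x)\<^sup>2) \<in> borel_measurable lborel"
  proof -
    have "\<zeta> \<in> borel_measurable borel"
      using Ck_on_1D(2)[OF \<zeta>] by (rule borel_measurable_continuous_onI)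
    then show ?thesis by simp
  qed
  have mono': "AE x in lborel. mono (\<lambda>n. f n x)"
    using mono by (auto simp: mono_def)
  note mc = integral_monotone_convergence[OF int mono' lim L meas]
    integrable_monotone_convergence[OF int mono' lim L meas]
  show "integrable lborel (\<lambda>x. (\<zeta> x)\<^sup>2 / (norm x)\<^sup>2)"
    by (rule mc)
  have "L \<le> B / k"
    using LIMSEQ_le_const2[OF L] bd by blast
  then show "(real DIM('a) - 2)\<^sup>2 / 4 * (LINT x|lborel. (\<zeta> x)\<^sup>2 / (norm x)\<^sup>2)
      \<le> (LINT x|lborel. (norm (grad \<zeta> x))\<^sup>2)"
    using \<open>k > 0\<close> unfolding mc(1) B_def[symmetric] k_def[symmetric] by (simp add: field_simps)
qed

section \<open>Lower bounds for nonnegative superharmonic functions\<close>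

lemma second_deriv_nonneg_at_min:
  fixes f f' :: "real \<Rightarrow> real"
  assumes "0 < \<delta>" and f: "\<And>t. \<bar>t\<bar> < \<delta> \<Longrightarrow> (f has_real_derivative f' t) (at t)"
    and f': "(f' has_real_derivative c) (at 0)" and min: "\<And>t. \<bar>t\<bar> < \<delta> \<Longrightarrow> f 0 \<le> f t"
  shows "0 \<le> c"
proof (rule ccontr)
  assume "\<not> 0 \<le> c"
  have "f' 0 = 0"
    using DERIV_local_min[of f "f' 0" 0 \<delta>] f[of 0] min \<open>0 < \<delta>\<close> by (simp add: abs_minus_commute)
  obtain d where "d > 0" and d: "\<And>h. 0 < h \<Longrightarrow> h < d \<Longrightarrow> f' (0 + h) < f' 0"
    using DERIV_neg_dec_right[OF f'] \<open>\<not> 0 \<le> c\<close> by auto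
  define h where "h = min d \<delta> / 2"
  have h: "0 < h" "h < d" "h < \<delta>"
    using \<open>0 < d\<close> \<open>0 < \<delta>\<close> by (auto simp: h_def)
  obtain z where z: "0 < z" "z < h" "f h - f 0 = (h - 0) * f' z"
    using MVT2[of 0 h f f'] f h by force
  have "h * f' z < 0"
    using d[of z] z h \<open>f' 0 = 0\<close> by (simp add: mult_pos_neg)
  then show False
    using min[of h] z h by simp
qed

text \<open>Along each coordinate line the difference has a nonnegative second derivative at its
  minimum. For a superharmonic \<open>u\<close> this excludes interior minima of
  \<open>u - B\<close> when \<open>B\<close> is strictly subharmonic.\<close>

lemma laplacian_le_at_min_diff:
  fixes u B :: "'a::euclidean_space \<Rightarrow> real"
  assumes U: "open U" and u: "Ck_on 2 U u" and B: "Ck_on 2 U B" and y: "y \<in> U"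
    and min: "\<And>x. x \<in> U \<Longrightarrow> u y - B y \<le> u x - B x"
  shows "laplacian B y \<le> laplacian u y"
  unfolding laplacian_def
proof (rule sum_mono)
  fix b :: 'a assume b: "b \<in> Basis"
  obtain \<delta> where \<delta>: "0 < \<delta>" "ball y \<delta> \<subseteq> U"
    using U y openE by blast
  have inU: "y + t *\<^sub>R b \<in> U" if "\<bar>t\<bar> < \<delta>" for t
    using that \<delta>(2) b by (auto simp: subset_iff dist_norm)
  have line: "((\<lambda>t. w (y + t *\<^sub>R b)) has_real_derivative partial_deriv b w (y + t *\<^sub>R b)) (at t)"
    if "w differentiable (at (y + t *\<^sub>R b))" for w :: "'a \<Rightarrow> real" and t
  proof -
    have "((\<lambda>t. y + t *\<^sub>R b) has_derivative (\<lambda>h. h *\<^sub>R b)) (at t)"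
      by (auto intro!: derivative_eq_intros)
    from has_derivative_compose[OF this has_derivative_grad[OF that]] show ?thesis
      unfolding has_field_derivative_def
      by (rule has_derivative_eq_rhs) (use b in \<open>simp add: fun_eq_iff\<close>)
  qed
  have "0 \<le> partial_deriv b (partial_deriv b u) y - partial_deriv b (partial_deriv b B) y"
  proof (rule second_deriv_nonneg_at_min[OF \<delta>(1)])
    show "((\<lambda>t. u (y + t *\<^sub>R b) - B (y + t *\<^sub>R b)) has_real_derivative
        partial_deriv b u (y + t *\<^sub>R b) - partial_deriv b B (y + t *\<^sub>R b)) (at t)" if "\<bar>t\<bar> < \<delta>" for t
      by (intro DERIV_diff line Ck_on_2D(1)[OF u] Ck_on_2D(1)[OF B] inU that)
    show "((\<lambda>t. partial_deriv b u (y + t *\<^sub>R b) - partial_deriv b B (y + t *\<^sub>R b)) has_real_derivative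
        partial_deriv b (partial_deriv b u) y - partial_deriv b (partial_deriv b B) y) (at 0)"
      using line[of "partial_deriv b u" 0] line[of "partial_deriv b B" 0]
        Ck_on_2D(4)[OF u y b] Ck_on_2D(4)[OF B y b] by (auto intro!: DERIV_diff)
    show "u (y + 0 *\<^sub>R b) - B (y + 0 *\<^sub>R b) \<le> u (y + t *\<^sub>R b) - B (y + t *\<^sub>R b)"
      if "\<bar>t\<bar> < \<delta>" for t
      using min[OF inU[OF that]] by simp
  qed
  then show "partial_deriv b (partial_deriv b B) y \<le> partial_deriv b (partial_deriv b u) y"
    by simp
qed

text \<open>For \<open>s > d - 2\<close> the barrier \<open>|x - z| powr (-s)\<close> is strictly subharmonic, so an interior minimum of
  the difference is contradictory without any further perturbation.\<close>

lemma superharmonic_lower_bound: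
  fixes u :: "'a::euclidean_space \<Rightarrow> real"
  assumes u: "Ck_on 2 UNIV u" and sup: "\<And>x. laplacian u x \<le> 0" and nonneg: "\<And>x. 0 \<le> u x"
    and "0 < r" and "0 < m" and m: "\<And>x. x \<in> cball z r \<Longrightarrow> m \<le> u x"
    and s: "0 < s" "real DIM('a) - 2 < s" and x: "r \<le> norm (x - z)"
  shows "m * (r / norm (x - z)) powr s \<le> u x"
proof (rule ccontr)
  assume neg: "\<not> m * (r / norm (x - z)) powr s \<le> u x"
  define \<rho> where "\<rho> = norm (x - z)"
  have "\<rho> \<ge> r" "\<rho> > 0" using x \<open>0 < r\<close> by (auto simp: \<rho>_def)
  define \<eta> where "\<eta> = m * (r / \<rho>) powr s - u x"
  have "\<eta> > 0" using neg by (simp add: \<eta>_def \<rho>_def)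
  have "((\<lambda>M. m * (r / M) powr s) \<longlongrightarrow> m * 0) at_top"
    by (intro tendsto_intros tendsto_zero_powrI[where b = s] tendsto_const
        tendsto_divide_0[OF tendsto_const] filterlim_at_top_imp_at_infinity filterlim_ident)
      (use s \<open>0 < r\<close> in \<open>auto intro!: eventually_mono[OF eventually_gt_at_top[of 0]]\<close>)
  then have "eventually (\<lambda>M. m * (r / M) powr s < \<eta>) at_top"
    using \<open>\<eta> > 0\<close> by (auto dest: order_tendstoD(2))
  \<comment> \<open>\<open>M\<close> is the outer radius of the comparison annulus. It is so large
    that the barrier is below \<open>\<eta>\<close> there, so that nonnegativity of \<open>u\<close>
    alone excludes a value of the difference at most -\<open>\<eta>\<close> on the outer
    sphere.\<close>
  then obtain M where M: "m * (r / M) powr s < \<eta>" "M > \<rho>"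
    using eventually_conj[OF _ eventually_gt_at_top[of \<rho>]] eventually_happens'[OF trivial_limit_at_top_linorder]
    by (metis (mono_tags, lifting))
  define c where "c = m * r powr s"
  have "c > 0" using \<open>0 < m\<close> \<open>0 < r\<close> by (simp add: c_def)
  define B where "B = (\<lambda>y. c * ((y - z) \<bullet> (y - z) + 0) powr (- s / 2))"
  have B: "B y = m * (r / norm (y - z)) powr s" if "y \<noteq> z" for y
  proof -
    have n: "(y - z) \<bullet> (y - z) = norm (y - z) powr 2"
      using that by (simp add: power2_norm_eq_inner[symmetric] powr_numeral)
    have "B y = m * (r powr s * norm (y - z) powr (- s))"
      unfolding B_def n add_0_right powr_powr by (simp add: c_def)
    also have "\<dots> = m * (r / norm (y - z)) powr s"
      using \<open>0 < r\<close> that by (simp add: powr_divide powr_minus_divide)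
    finally show ?thesis .
  qed
  define V where "V = {y. 0 < (y - z) \<bullet> (y - z) + 0}"
  have V: "y \<in> V \<longleftrightarrow> y \<noteq> z" for y by (simp add: V_def)
  have BC: "open V" "Ck_on 2 V B"
    unfolding V_def B_def by (rule C2_radial_power)+
  define A where "A = {y. r \<le> norm (y - z) \<and> norm (y - z) \<le> M}"
  have AV: "A \<subseteq> V" using \<open>0 < r\<close> by (auto simp: A_def V)
  have "compact A"
  proof -
    have "A = cball z M - ball z r"
      by (auto simp: A_def dist_norm norm_minus_commute)
    then show ?thesis by (simp add: compact_diff)
  qed
  moreover have "x \<in> A" using M x by (simp add: A_def \<rho>_def)
  moreover have "continuous_on A (\<lambda>y. u y - B y)"
    using continuous_on_subset[OF Ck_on_2D(2)[OF u]] continuous_on_subset[OF Ck_on_2D(2)[OF BC(2)] AV]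
    by (auto intro: continuous_on_diff)
  ultimately obtain y where y: "y \<in> A" "\<And>x. x \<in> A \<Longrightarrow> u y - B y \<le> u x - B x"
    using continuous_attains_inf[of A "\<lambda>y. u y - B y"] by blast
  have "x \<noteq> z" "y \<noteq> z" using \<open>x \<in> A\<close> \<open>y \<in> A\<close> \<open>0 < r\<close> by (auto simp: A_def)
  have "u y - B y \<le> - \<eta>"
    using y(2)[OF \<open>x \<in> A\<close>] B[OF \<open>x \<noteq> z\<close>] by (simp add: \<eta>_def \<rho>_def)
  have "norm (y - z) \<noteq> r"
  proof
    assume "norm (y - z) = r"
    then have "B y = m" "u y \<ge> m"
      using B[OF \<open>y \<noteq> z\<close>] \<open>0 < r\<close> m by (auto simp: dist_norm norm_minus_commute)
    then show False using \<open>u y - B y \<le> - \<eta>\<close> \<open>\<eta> > 0\<close> by simp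
  qed
  moreover have "norm (y - z) \<noteq> M"
  proof
    assume "norm (y - z) = M"
    then have "B y < \<eta>"
      using B[OF \<open>y \<noteq> z\<close>] M by simp
    then show False using \<open>u y - B y \<le> - \<eta>\<close> nonneg[of y] by simp
  qed
  ultimately have yA: "y \<in> {y. r < norm (y - z)} \<inter> {y. norm (y - z) < M}" (is "_ \<in> ?A")
    using y(1) by (auto simp: A_def)
  have AA: "open ?A" "?A \<subseteq> A"
    by (intro open_Int open_Collect_less continuous_intros) (auto simp: A_def)
  \<comment> \<open>With both factors equal to 1, the dilation lemma restricts \<open>Ck_on\<close>
    to a smaller open set.\<close>
  have Ck: "Ck_on 2 ?A u" "Ck_on 2 ?A B"
    using C2_dilation(1)[OF u open_UNIV AA(1), of 1 1] C2_dilation(1)[OF BC(2,1) AA(1), of 1 1] AA(2) AV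
    by auto
  have "laplacian B y \<le> laplacian u y"
    by (rule laplacian_le_at_min_diff[OF AA(1) Ck yA]) (use y AA(2) in blast)
  also have "\<dots> \<le> 0" by (rule sup)
  finally have "laplacian B y \<le> 0" .
  moreover have "laplacian B y > 0"
  proof -
    define \<sigma> where "\<sigma> = (y - z) \<bullet> (y - z)"
    have "\<sigma> > 0" using \<open>y \<noteq> z\<close> by (simp add: \<sigma>_def)
    have "laplacian B y = c * (2 * (- s / 2) * real DIM('a) * (\<sigma> + 0) powr (- s / 2 - 1)
         + 4 * (- s / 2) * (- s / 2 - 1) * \<sigma> * (\<sigma> + 0) powr (- s / 2 - 2))"
      unfolding \<sigma>_def B_def by (rule C2_radial_power(3)) (use \<open>y \<noteq> z\<close> in simp)
    also have "\<sigma> * (\<sigma> + 0) powr (- s / 2 - 2) = \<sigma> powr (- s / 2 - 1)"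
      unfolding add_0_right powr_mult_base[OF less_imp_le[OF \<open>\<sigma> > 0\<close>]]
      by (rule arg_cong[where f = "\<lambda>t. \<sigma> powr t"]) simp
    then have "4 * (- s / 2) * (- s / 2 - 1) * \<sigma> * (\<sigma> + 0) powr (- s / 2 - 2)
        = 4 * (- s / 2) * (- s / 2 - 1) * \<sigma> powr (- s / 2 - 1)"
      by (simp add: mult.assoc)
    finally have "laplacian B y = c * s * (s + 2 - real DIM('a)) * \<sigma> powr (- s / 2 - 1)"
      by (simp add: field_simps)
    then show ?thesis
      using \<open>c > 0\<close> s \<open>\<sigma> > 0\<close> by simp
  qed
  ultimately show False by simp
qed

text \<open>Recentres the barrier estimate: the weight (1 + |x|) powr (-s) no longer refers to the
  point \<open>z\<close> and is defined everywhere, which is the form that can be followed under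
  dilations.\<close>

lemma superharmonic_decay_bound:
  fixes u :: "'a::euclidean_space \<Rightarrow> real"
  assumes u: "Ck_on 2 UNIV u" and sup: "\<And>x. laplacian u x \<le> 0" and nonneg: "\<And>x. 0 \<le> u x"
    and s: "0 < s" "real DIM('a) - 2 < s" and z: "0 < u z"
  obtains c where "0 < c" "\<And>x. c * (1 + norm x) powr (- s) \<le> u x"
proof -
  have "isCont u z"
    using Ck_on_2D(2)[OF u] by (simp add: continuous_on_eq_continuous_at)
  then obtain r' where r': "r' > 0" "\<And>x. dist x z < r' \<Longrightarrow> dist (u x) (u z) < u z / 2"
    unfolding continuous_at_eps_delta using z half_gt_zero by metis
  define r where "r = min 1 (r' / 2)"
  define m where "m = u z / 2"
  have r: "0 < r" "r \<le> 1" "0 < m" using r' z by (auto simp: r_def m_def)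
  have m: "m \<le> u x" if "x \<in> cball z r" for x
  proof -
    have "dist x z < r'" using that r' by (auto simp: r_def dist_commute)
    then show ?thesis using r'(2)[of x] unfolding m_def dist_real_def by linarith
  qed
  \<comment> \<open>The value comes from |x - z| \<le> (1 + |z|)(1 + |x|), which gives r / |x - z|
    \<ge> k / (1 + |x|). In addition \<open>k\<close> \<le> 1, so the same bound holds trivially in
    the small ball around \<open>z\<close>.\<close>
  define k where "k = r / (1 + norm z)"
  have k: "0 < k" "k \<le> 1" using r by (auto simp: k_def divide_simps add_pos_nonneg intro: order_trans)
  have "m * k powr s * (1 + norm x) powr (- s) \<le> u x" for x
  proof (cases "r \<le> norm (x - z)")
    case True
    have "norm (x - z) \<le> (1 + norm z) * (1 + norm x)"
    proof -
      have "(1 + norm z) * (1 + norm x) = 1 + norm x + norm z + norm x * norm z"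
        by (simp add: algebra_simps)
      moreover have "0 \<le> norm x * norm z" by simp
      ultimately show ?thesis
        using norm_triangle_ineq4[of x z] by linarith
    qed
    then have "k / (1 + norm x) \<le> r / norm (x - z)"
      unfolding k_def using r True by (auto intro!: divide_left_mono mult_pos_pos add_pos_nonneg)
    then have "(k / (1 + norm x)) powr s \<le> (r / norm (x - z)) powr s"
      using k s by (intro powr_mono2) (auto intro: divide_nonneg_nonneg)
    then have "m * (k powr s * (1 + norm x) powr (- s)) \<le> m * (r / norm (x - z)) powr s"
      using r k by (intro mult_left_mono) (auto simp: powr_divide powr_minus_divide)
    also have "\<dots> \<le> u x"
      by (rule superharmonic_lower_bound[OF u sup nonneg r(1,3) m s True])
    finally show ?thesis by (simp add: mult.assoc)
  next
    case False
    have "k powr s \<le> 1" using powr_le1[of s k] k s by simp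
    moreover have "(1 + norm x) powr (- s) \<le> 1" using powr_mono[of "- s" 0 "1 + norm x"] s norm_ge_zero[of x]
      by (simp split: if_splits)
    ultimately have "k powr s * (1 + norm x) powr (- s) \<le> 1"
      by (intro mult_le_one) auto
    then have "m * (k powr s * (1 + norm x) powr (- s)) \<le> m"
      using mult_left_mono[of _ 1 m] r by simp
    also have "m \<le> u x" using m False by (auto simp: dist_norm norm_minus_commute)
    finally show ?thesis by (simp add: mult.assoc)
  qed
  then show thesis
    using r k by (intro that[of "m * k powr s"]) auto
qed

text \<open>The strong minimum principle as a by-product of the barrier; the exponent s = d is
  admissible in every dimension.\<close>

lemma superharmonic_pos:
  fixes u :: "'a::euclidean_space \<Rightarrow> real"
  assumes "Ck_on 2 UNIV u" "\<And>x. laplacian u x \<le> 0" "\<And>x. 0 \<le> u x" "0 < u z"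
  shows "0 < u x"
proof -
  obtain c where "0 < c" "\<And>x. c * (1 + norm x) powr (- real DIM('a)) \<le> u x"
    using superharmonic_decay_bound[OF assms(1-3), of "real DIM('a)" z] assms(4) by auto
  moreover have "1 + norm x > 0" by (simp add: add_pos_nonneg)
  ultimately show ?thesis
    by (metis less_le_trans mult_pos_pos powr_gt_zero less_irrefl)
qed

text \<open>For \<open>d = 2\<close> every \<open>s > 0\<close> is admissible in the barrier; let \<open>s\<close> tend to 0.\<close>

lemma superharmonic_plane_const:
  fixes u :: "'a::euclidean_space \<Rightarrow> real"
  assumes d: "DIM('a) = 2" and u: "Ck_on 2 UNIV u" and sup: "\<And>x. laplacian u x \<le> 0"
    and nonneg: "\<And>x. 0 \<le> u x"
  shows "u z \<le> u x"
proof (rule ccontr)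
  assume "\<not> u z \<le> u x"
  \<comment> \<open>A level strictly between the two values: \<open>u\<close> stays above
    \<open>m\<close> near \<open>z\<close>, and the barrier of height \<open>m\<close> around
    \<open>z\<close> has limit \<open>m\<close> > \<open>u x\<close> at \<open>x\<close> as s tends
    to 0.\<close>
  define m where "m = (u z + u x) / 2"
  have m: "u x < m" "m < u z" "0 < m"
    using \<open>\<not> u z \<le> u x\<close> nonneg[of x] by (auto simp: m_def)
  have "isCont u z"
    using Ck_on_2D(2)[OF u] by (simp add: continuous_on_eq_continuous_at)
  then obtain r' where r': "r' > 0" "\<And>x. dist x z < r' \<Longrightarrow> dist (u x) (u z) < u z - m"
    unfolding continuous_at_eps_delta using m diff_gt_0_iff_gt by metis
  define r where "r = r' / 2"
  have "0 < r" using r' by (simp add: r_def)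
  have mr: "m \<le> u x" if "x \<in> cball z r" for x
  proof -
    have "dist x z < r'" using that r' by (auto simp: r_def dist_commute)
    then show ?thesis using r'(2)[of x] unfolding dist_real_def by linarith
  qed
  have "x \<notin> cball z r"
    using mr[of x] m by linarith
  then have x: "r \<le> norm (x - z)" "norm (x - z) \<noteq> 0"
    using \<open>0 < r\<close> by (auto simp: dist_norm norm_minus_commute)
  have "((\<lambda>s. m * (r / norm (x - z)) powr s) \<longlongrightarrow> m * (r / norm (x - z)) powr 0) (at_right 0)"
    using \<open>0 < r\<close> x by (intro tendsto_intros) auto
  moreover have "eventually (\<lambda>s. m * (r / norm (x - z)) powr s \<le> u x) (at_right 0)"
    using superharmonic_lower_bound[OF u sup nonneg \<open>0 < r\<close> m(3) mr _ _ x(1)] d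
    by (auto simp: eventually_at_right_less eventually_at_filter)
  ultimately have "m * (r / norm (x - z)) powr 0 \<le> u x"
    using tendsto_upperbound trivial_limit_at_right_real by metis
  then show False using m x \<open>0 < r\<close> by simp
qed

section \<open>Stability at a single scale\<close>

lemma integrable_hardy_weight:
  fixes \<zeta> f :: "'a::euclidean_space \<Rightarrow> real"
  assumes "continuous_on C \<zeta>" "compact C" "0 \<notin> C" "\<And>x. x \<notin> C \<Longrightarrow> \<zeta> x = 0" "continuous_on C f"
  shows "integrable lborel (\<lambda>x. (\<zeta> x)\<^sup>2 / (norm x)\<^sup>2 * f x)"
  using assms by (intro integrable_compact_support_mult[OF assms(2)]) (auto intro!: continuous_intros)

text \<open>By the arithmetic-geometric mean inequality a g/f + b f/g \<ge> 2 sqrt (a b), so the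
  unknown ratio cancels on the left. In the gain only the radial part of \<open>D\<close> is kept,
  and its square is replaced by the tangent at -\<gamma>: (x \<bullet> D)^2 \<ge> \<gamma>^2 - 2
  \<gamma> (x \<bullet> D + \<gamma>). The error is then linear in the deviation x \<bullet> D +
  \<gamma>, a form that can be recognised as a derivative along dilations.\<close>

lemma stability_single_scale:
  fixes f g \<zeta> a b :: "'a::euclidean_space \<Rightarrow> real" and \<gamma> :: real
  assumes V: "open V" and f: "Ck_on 2 V f" "\<And>x. x \<in> V \<Longrightarrow> 0 < f x"
    and g: "Ck_on 2 V g" "\<And>x. x \<in> V \<Longrightarrow> 0 < g x"
    and \<zeta>: "Ck_on 1 UNIV \<zeta>" and C: "compact C" "C \<subseteq> V" "0 \<notin> C"
    and \<zeta>0: "\<And>x. x \<notin> C \<Longrightarrow> \<zeta> x = 0"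
    and ab: "continuous_on C a" "continuous_on C b" "\<And>x. x \<in> C \<Longrightarrow> 0 \<le> a x" "\<And>x. x \<in> C \<Longrightarrow> 0 \<le> b x"
    and lf: "\<And>x. x \<in> C \<Longrightarrow> a x * g x \<le> - laplacian f x"
    and lg: "\<And>x. x \<in> C \<Longrightarrow> b x * f x \<le> - laplacian g x"
    and "0 \<le> \<gamma>"
  shows "(LINT x|lborel. (\<zeta> x)\<^sup>2 * sqrt (a x * b x)) \<le> (LINT x|lborel. (norm (grad \<zeta> x))\<^sup>2)
     - \<gamma>\<^sup>2 / 4 * (LINT x|lborel. (\<zeta> x)\<^sup>2 / (norm x)\<^sup>2)
     + \<gamma> / 2 * (LINT x|lborel. (\<zeta> x)\<^sup>2 / (norm x)\<^sup>2 *
         (x \<bullet> ((1 / f x) *\<^sub>R grad f x - (1 / g x) *\<^sub>R grad g x) + \<gamma>))"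
proof -
  define D where "D x = (1 / f x) *\<^sub>R grad f x - (1 / g x) *\<^sub>R grad g x" for x
  define k where "k x = (\<zeta> x)\<^sup>2 / (norm x)\<^sup>2" for x
  define B where "B = (LINT x|lborel. (norm (grad \<zeta> x))\<^sup>2)"
  have \<zeta>C: "continuous_on C \<zeta>"
    using Ck_on_1D(2)[OF \<zeta>] continuous_on_subset by blast
  have cont: "continuous_on C f" "continuous_on C (grad f)" "continuous_on C g" "continuous_on C (grad g)"
    "continuous_on C (laplacian f)" "continuous_on C (laplacian g)"
    using Ck_on_2D(2,3,7)[OF f(1)] Ck_on_2D(2,3,7)[OF g(1)] C(2) continuous_on_subset by blast+
  have pos: "0 < f x" "0 < g x" if "x \<in> C" for x
    using f(2) g(2) C(2) that by auto
  then have nz: "f x \<noteq> 0" "g x \<noteq> 0" if "x \<in> C" for x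
    using that by (metis less_irrefl)+
  have DC: "continuous_on C D"
    unfolding D_def using cont nz by (intro continuous_intros) auto
  have ik: "integrable lborel k"
    using integrable_hardy_weight[OF \<zeta>C C(1,3) \<zeta>0, of "\<lambda>_. 1"] by (simp add: k_def[abs_def])
  have ikE: "integrable lborel (\<lambda>x. k x * (x \<bullet> D x + \<gamma>))"
    unfolding k_def by (rule integrable_hardy_weight[OF \<zeta>C C(1,3) \<zeta>0])
      (use DC in \<open>auto intro!: continuous_intros\<close>)
  have isq: "integrable lborel (\<lambda>x. (\<zeta> x)\<^sup>2 * sqrt (a x * b x))"
    by (rule integrable_compact_support_mult[OF C(1)]) (use \<zeta>C \<zeta>0 ab in \<open>auto intro!: continuous_intros\<close>)
  note bp = barta_inequality_pair[OF V f g \<zeta> C(1,2) \<zeta>0, folded D_def B_def]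
  have "2 * (LINT x|lborel. (\<zeta> x)\<^sup>2 * sqrt (a x * b x)) = (LINT x|lborel. 2 * ((\<zeta> x)\<^sup>2 * sqrt (a x * b x)))"
    by simp
  also have "\<dots> \<le> (LINT x|lborel. (\<zeta> x)\<^sup>2 * (- laplacian f x / f x - laplacian g x / g x))"
  proof (rule integral_mono)
    show "integrable lborel (\<lambda>x. 2 * ((\<zeta> x)\<^sup>2 * sqrt (a x * b x)))"
      using isq by simp
    show "integrable lborel (\<lambda>x. (\<zeta> x)\<^sup>2 * (- laplacian f x / f x - laplacian g x / g x))"
      by (rule integrable_compact_support_mult[OF C(1)])
        (use \<zeta>C \<zeta>0 cont nz in \<open>auto intro!: continuous_intros\<close>)
    fix x
    show "2 * ((\<zeta> x)\<^sup>2 * sqrt (a x * b x)) \<le> (\<zeta> x)\<^sup>2 * (- laplacian f x / f x - laplacian g x / g x)"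
    proof (cases "x \<in> C")
      case True
      note p = pos[OF True] ab(3)[OF True] ab(4)[OF True]
      have "2 * sqrt (a x * b x) = 2 * sqrt ((a x * g x / f x) * (b x * f x / g x))"
        using p by (simp add: field_simps)
      also have "\<dots> \<le> a x * g x / f x + b x * f x / g x"
        using arith_geo_mean_sqrt[of "a x * g x / f x" "b x * f x / g x"] p by (simp add: divide_nonneg_pos)
      also have "\<dots> \<le> - laplacian f x / f x + - laplacian g x / g x"
        using lf[OF True] lg[OF True] p by (intro add_mono divide_right_mono) auto
      finally have "(\<zeta> x)\<^sup>2 * (2 * sqrt (a x * b x)) \<le> (\<zeta> x)\<^sup>2 * (- laplacian f x / f x + - laplacian g x / g x)"
        by (rule mult_left_mono) simp
      then show ?thesis by (simp add: mult_ac)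
    qed (simp add: \<zeta>0)
  qed
  also have "\<dots> \<le> 2 * B - (LINT x|lborel. (\<zeta> x)\<^sup>2 * (norm (D x))\<^sup>2) / 2"
    by (rule bp(2))
  finally have 1: "2 * (LINT x|lborel. (\<zeta> x)\<^sup>2 * sqrt (a x * b x))
    \<le> 2 * B - (LINT x|lborel. (\<zeta> x)\<^sup>2 * (norm (D x))\<^sup>2) / 2" .
  have "\<gamma>\<^sup>2 * (LINT x|lborel. k x) - 2 * \<gamma> * (LINT x|lborel. k x * (x \<bullet> D x + \<gamma>))
     = (LINT x|lborel. \<gamma>\<^sup>2 * k x - 2 * \<gamma> * (k x * (x \<bullet> D x + \<gamma>)))"
    using ik ikE by simp
  also have "\<dots> \<le> (LINT x|lborel. (\<zeta> x)\<^sup>2 * (norm (D x))\<^sup>2)"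
  proof (rule integral_mono)
    fix x
    show "\<gamma>\<^sup>2 * k x - 2 * \<gamma> * (k x * (x \<bullet> D x + \<gamma>)) \<le> (\<zeta> x)\<^sup>2 * (norm (D x))\<^sup>2"
    proof (cases "x \<in> C")
      case True
      then have "x \<noteq> 0" using C(3) by auto
      have "0 \<le> (x \<bullet> D x + \<gamma>)\<^sup>2" by simp
      then have "\<gamma>\<^sup>2 - 2 * \<gamma> * (x \<bullet> D x + \<gamma>) \<le> (x \<bullet> D x)\<^sup>2"
        by (simp add: power2_eq_square algebra_simps)
      also have "\<dots> \<le> (norm x * norm (D x))\<^sup>2"
        using Cauchy_Schwarz_ineq2[of x "D x"] by (metis abs_ge_zero power2_abs power_mono)
      finally have "k x * (\<gamma>\<^sup>2 - 2 * \<gamma> * (x \<bullet> D x + \<gamma>)) \<le> k x * (norm x * norm (D x))\<^sup>2"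
        by (rule mult_left_mono) (simp add: k_def)
      also have "\<dots> = (\<zeta> x)\<^sup>2 * (norm (D x))\<^sup>2"
        using \<open>x \<noteq> 0\<close> by (simp add: k_def power_mult_distrib)
      finally show ?thesis by (simp add: algebra_simps)
    qed (simp add: k_def \<zeta>0)
  qed (use ik ikE bp(1) in auto)
  finally have 2: "\<gamma>\<^sup>2 * (LINT x|lborel. k x) - 2 * \<gamma> * (LINT x|lborel. k x * (x \<bullet> D x + \<gamma>))
    \<le> (LINT x|lborel. (\<zeta> x)\<^sup>2 * (norm (D x))\<^sup>2)" .
  show ?thesis
    using 1 2 unfolding B_def[symmetric] D_def[symmetric] k_def[symmetric] by simp
qed

text \<open>ln (f/g) \<le> f/g \<le> (-\<Delta>g/g) / m, and the weighted integral of -\<Delta>g/g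
  is at most the Dirichlet energy. The functions \<open>f\<close> and \<open>g\<close> enter the
  bound only through \<open>m\<close>, which is what makes it uniform over scales; exchanging their
  roles bounds the mean of ln (f/g) from below.\<close>

lemma log_ratio_bound:
  fixes f g \<zeta> :: "'a::euclidean_space \<Rightarrow> real"
  assumes V: "open V" and f: "Ck_on 2 V f" "\<And>x. x \<in> V \<Longrightarrow> 0 < f x"
    and g: "Ck_on 2 V g" "\<And>x. x \<in> V \<Longrightarrow> 0 < g x"
    and \<zeta>: "Ck_on 1 UNIV \<zeta>" and C: "compact C" "C \<subseteq> V"
    and \<zeta>0: "\<And>x. x \<notin> C \<Longrightarrow> \<zeta> x = 0"
    and "0 < r" and r: "\<And>x. x \<in> C \<Longrightarrow> r \<le> norm x"
    and "0 < m" and lg: "\<And>x. x \<in> C \<Longrightarrow> m * f x \<le> - laplacian g x"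
  shows "(LINT x|lborel. (\<zeta> x)\<^sup>2 / (norm x)\<^sup>2 * (ln (f x) - ln (g x)))
    \<le> (LINT x|lborel. (norm (grad \<zeta> x))\<^sup>2) / (r\<^sup>2 * m)"
proof -
  have \<zeta>C: "continuous_on C \<zeta>"
    using Ck_on_1D(2)[OF \<zeta>] continuous_on_subset by blast
  have cont: "continuous_on C f" "continuous_on C g"
    using Ck_on_2D(2)[OF f(1)] Ck_on_2D(2)[OF g(1)] C(2) continuous_on_subset by blast+
  have pos: "0 < f x" "0 < g x" if "x \<in> C" for x
    using f(2) g(2) C(2) that by auto
  then have nz: "f x \<noteq> 0" "g x \<noteq> 0" if "x \<in> C" for x
    using that by (metis less_irrefl)+
  have "0 \<notin> C" using r \<open>0 < r\<close> by force
  have i: "integrable lborel (\<lambda>x. (\<zeta> x)\<^sup>2 * (- laplacian g x / g x))"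
    by (rule picone_identity(1)[OF V g \<zeta> C \<zeta>0])
  have "(LINT x|lborel. (\<zeta> x)\<^sup>2 / (norm x)\<^sup>2 * (ln (f x) - ln (g x)))
    \<le> (LINT x|lborel. 1 / (r\<^sup>2 * m) * ((\<zeta> x)\<^sup>2 * (- laplacian g x / g x)))"
  proof (rule integral_mono)
    show "integrable lborel (\<lambda>x. (\<zeta> x)\<^sup>2 / (norm x)\<^sup>2 * (ln (f x) - ln (g x)))"
      by (rule integrable_hardy_weight[OF \<zeta>C C(1) \<open>0 \<notin> C\<close> \<zeta>0]) (use cont pos nz in \<open>auto intro!: continuous_intros\<close>)
    show "integrable lborel (\<lambda>x. 1 / (r\<^sup>2 * m) * ((\<zeta> x)\<^sup>2 * (- laplacian g x / g x)))"
      using i by (rule integrable_mult_right)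
    fix x
    show "(\<zeta> x)\<^sup>2 / (norm x)\<^sup>2 * (ln (f x) - ln (g x)) \<le> 1 / (r\<^sup>2 * m) * ((\<zeta> x)\<^sup>2 * (- laplacian g x / g x))"
    proof (cases "x \<in> C")
      case True
      note p = pos[OF True]
      have "ln (f x) - ln (g x) = ln (f x / g x)" using p by (simp add: ln_div)
      also have "\<dots> \<le> f x / g x" using ln_le_minus_one[of "f x / g x"] p by simp
      also have "\<dots> \<le> (- laplacian g x / g x) / m"
        using lg[OF True] p \<open>0 < m\<close> by (simp add: field_simps)
      finally have l: "ln (f x) - ln (g x) \<le> (- laplacian g x / g x) / m" .
      have "(\<zeta> x)\<^sup>2 / (norm x)\<^sup>2 * (ln (f x) - ln (g x)) \<le> (\<zeta> x)\<^sup>2 / (norm x)\<^sup>2 * ((- laplacian g x / g x) / m)"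
        using l by (rule mult_left_mono) simp
      also have "\<dots> \<le> (\<zeta> x)\<^sup>2 / r\<^sup>2 * ((- laplacian g x / g x) / m)"
      proof (rule mult_right_mono)
        show "(\<zeta> x)\<^sup>2 / (norm x)\<^sup>2 \<le> (\<zeta> x)\<^sup>2 / r\<^sup>2"
          using r[OF True] less_le_trans[OF \<open>0 < r\<close> r[OF True]] \<open>0 < r\<close>
          by (intro divide_left_mono power_mono mult_pos_pos) auto
        have "0 \<le> m * f x" using p \<open>0 < m\<close> by simp
        then have "0 \<le> - laplacian g x" using lg[OF True] by linarith
        then show "0 \<le> - laplacian g x / g x / m"
          using p \<open>0 < m\<close> by (intro divide_nonneg_pos)
      qed
      finally show ?thesis by (simp add: field_simps)
    qed (simp add: \<zeta>0)
  qed
  also have "\<dots> = 1 / (r\<^sup>2 * m) * (LINT x|lborel. (\<zeta> x)\<^sup>2 * (- laplacian g x / g x))"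
    by (rule Bochner_Integration.integral_mult_right_zero)
  also have "\<dots> \<le> 1 / (r\<^sup>2 * m) * (LINT x|lborel. (norm (grad \<zeta> x))\<^sup>2)"
    using barta_inequality[OF V g \<zeta> C \<zeta>0] \<open>0 < m\<close> \<open>0 < r\<close> by (intro mult_left_mono) auto
  finally show ?thesis by simp
qed

text \<open>The t-derivative of ln w (exp t y) is x \<bullet> \<nabla>w / w at x = exp t y, so the
  deviation in \<open>stability_single_scale\<close> is the derivative of \<open>H\<close>. The mean
  value theorem selects one scale at which it equals the average slope of \<open>H\<close> over the
  window.\<close>

lemma log_ratio_mean_value:
  fixes \<phi> \<psi> \<zeta> :: "'a::euclidean_space \<Rightarrow> real" and \<gamma> t0 T :: real
  defines "H \<equiv> \<lambda>t. LINT y|lborel. (\<zeta> y)\<^sup>2 / (norm y)\<^sup>2 * (ln (\<phi> (exp t *\<^sub>R y)) - ln (\<psi> (exp t *\<^sub>R y)) + \<gamma> * t)"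
  assumes U: "open U" and \<phi>: "Ck_on 2 U \<phi>" "\<And>x. x \<in> U \<Longrightarrow> 0 < \<phi> x"
    and \<psi>: "Ck_on 2 U \<psi>" "\<And>x. x \<in> U \<Longrightarrow> 0 < \<psi> x"
    and \<zeta>C: "continuous_on C \<zeta>" and C: "compact C" "0 \<notin> C" and \<zeta>0: "\<And>x. x \<notin> C \<Longrightarrow> \<zeta> x = 0"
    and "0 < T" and inU: "\<And>t y. t0 - 1 \<le> t \<Longrightarrow> t \<le> t0 + T + 1 \<Longrightarrow> y \<in> C \<Longrightarrow> exp t *\<^sub>R y \<in> U"
  obtains t where "t0 < t" "t < t0 + T" "T * (LINT y|lborel. (\<zeta> y)\<^sup>2 / (norm y)\<^sup>2 *
     ((exp t *\<^sub>R y) \<bullet> ((1 / \<phi> (exp t *\<^sub>R y)) *\<^sub>R grad \<phi> (exp t *\<^sub>R y)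
        - (1 / \<psi> (exp t *\<^sub>R y)) *\<^sub>R grad \<psi> (exp t *\<^sub>R y)) + \<gamma>)) = H (t0 + T) - H t0"
proof -
  define E where "E x = x \<bullet> ((1 / \<phi> x) *\<^sub>R grad \<phi> x - (1 / \<psi> x) *\<^sub>R grad \<psi> x)" for x
  define k where "k y = (\<zeta> y)\<^sup>2 / (norm y)\<^sup>2" for y
  define F where "F t y = k y * (ln (\<phi> (exp t *\<^sub>R y)) - ln (\<psi> (exp t *\<^sub>R y)) + \<gamma> * t)" for t y
  define F' where "F' t y = k y * (E (exp t *\<^sub>R y) + \<gamma>)" for t y
  have k0: "k y = 0" if "y \<notin> C" for y using \<zeta>0[OF that] by (simp add: k_def)
  have ik: "integrable lborel k"
    using integrable_hardy_weight[OF \<zeta>C C \<zeta>0, of "\<lambda>_. 1"] by (simp add: k_def[abs_def])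
  have nzU: "\<phi> x \<noteq> 0" "\<psi> x \<noteq> 0" if "x \<in> U" for x
    using \<phi>(2) \<psi>(2) that by (metis less_irrefl)+
  have EU: "continuous_on U E"
    unfolding E_def using Ck_on_2D(2,3)[OF \<phi>(1)] Ck_on_2D(2,3)[OF \<psi>(1)] nzU
    by (intro continuous_intros) auto
  \<comment> \<open>The compact set swept by the dilates of \<open>C\<close>; a bound for
    \<open>E\<close> on it supplies the integrable majorant. The window is enlarged by 1 on both
    sides because differentiation under the integral, taken with radius 1, is also needed at its end
    points.\<close>
  define S where "S = (\<lambda>z. exp (fst z) *\<^sub>R snd z) ` ({t0 - 1..t0 + T + 1} \<times> C)"
  have "compact S"
    unfolding S_def by (intro compact_continuous_image compact_Times C continuous_intros) auto
  moreover have "S \<subseteq> U"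
    unfolding S_def using inU by auto
  ultimately have "bounded (E ` S)"
    using EU compact_continuous_image compact_imp_bounded continuous_on_subset by metis
  then obtain m where m: "\<And>x. x \<in> S \<Longrightarrow> \<bar>E x\<bar> \<le> m"
    unfolding bounded_iff by (metis image_eqI real_norm_def)
  have deriv: "((\<lambda>t. F t y) has_real_derivative F' t y) (at t)" if t: "t0 - 1 \<le> t" "t \<le> t0 + T + 1" for t y
  proof (cases "y \<in> C")
    case True
    let ?x = "exp t *\<^sub>R y"
    have x: "?x \<in> U" using inU[OF t True] .
    have d: "((\<lambda>t. exp t *\<^sub>R y) has_derivative (\<lambda>h. h *\<^sub>R ?x)) (at t)"
      by (auto intro!: derivative_eq_intros)
    have dl: "((\<lambda>t. w (exp t *\<^sub>R y)) has_real_derivative grad w ?x \<bullet> ?x) (at t)"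
      if "Ck_on 2 U w" for w
      using has_derivative_compose[OF d has_derivative_grad[OF Ck_on_2D(1)[OF that x]]]
      unfolding has_field_derivative_def by (rule has_derivative_eq_rhs) (simp add: fun_eq_iff)
    show ?thesis
      unfolding F_def F'_def E_def using \<phi>(2)[OF x] \<psi>(2)[OF x]
      by (auto intro!: derivative_eq_intros dl[OF \<phi>(1)] dl[OF \<psi>(1)]
          simp: inner_diff_right inner_commute[of y "grad \<phi> (exp t *\<^sub>R y)"]
            inner_commute[of y "grad \<psi> (exp t *\<^sub>R y)"])
  next
    case False
    then show ?thesis by (simp add: F_def F'_def k0)
  qed
  have intF: "integrable lborel (F t)" if t: "t0 - 1 \<le> t" "t \<le> t0 + T + 1" for t
  proof -
    have c: "continuous_on C (\<lambda>y. exp t *\<^sub>R y)" by (intro continuous_intros)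
    have "continuous_on C (\<lambda>y. \<phi> (exp t *\<^sub>R y))" "continuous_on C (\<lambda>y. \<psi> (exp t *\<^sub>R y))"
      using inU[OF t] by (auto intro!: continuous_on_compose2[OF Ck_on_2D(2)[OF \<phi>(1)] c]
          continuous_on_compose2[OF Ck_on_2D(2)[OF \<psi>(1)] c])
    then show ?thesis
      unfolding F_def[abs_def] k_def using inU[OF t] nzU
      by (intro integrable_hardy_weight[OF \<zeta>C C \<zeta>0]) (auto intro!: continuous_intros)
  qed
  have bound: "\<bar>F' t y\<bar> \<le> (m + \<bar>\<gamma>\<bar>) * k y" if t: "t0 - 1 \<le> t" "t \<le> t0 + T + 1" for t y
  proof (cases "y \<in> C")
    case True
    have "exp t *\<^sub>R y \<in> S" unfolding S_def using t True by force
    then have "\<bar>E (exp t *\<^sub>R y) + \<gamma>\<bar> \<le> m + \<bar>\<gamma>\<bar>" using m by (smt (verit))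
    then have "k y * \<bar>E (exp t *\<^sub>R y) + \<gamma>\<bar> \<le> k y * (m + \<bar>\<gamma>\<bar>)"
      by (rule mult_left_mono) (simp add: k_def)
    then show ?thesis by (simp add: F'_def abs_mult k_def mult.commute)
  qed (simp add: F'_def k0)
  have "(H has_real_derivative (LINT y|lborel. F' t y)) (at t)" if "t0 \<le> t" "t \<le> t0 + T" for t
    unfolding H_def F_def[symmetric] k_def[symmetric]
    by (rule DERIV_integral(2)[where \<delta> = 1 and k = "\<lambda>y. (m + \<bar>\<gamma>\<bar>) * k y"])
      (use that ik in \<open>auto intro!: intF deriv bound simp: abs_less_iff\<close>)
  then obtain t where t: "t0 < t" "t < t0 + T" "H (t0 + T) - H t0 = (t0 + T - t0) * (LINT y|lborel. F' t y)"
    using MVT2[of t0 "t0 + T" H "\<lambda>t. LINT y|lborel. F' t y"] \<open>0 < T\<close> by auto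
  show thesis
    using that[OF t(1,2)] t(3) unfolding F'_def E_def k_def by simp
qed

section \<open>The Lane--Emden system\<close>

text \<open>Through x = |x| \<theta> the function is determined off the origin by its values on the
  sphere. Its value at 0 is left free, hence the punctured space here and below.\<close>

lemma homogeneous_continuous:
  fixes w :: "'a::euclidean_space \<Rightarrow> real"
  assumes f: "C2_sphere f" and w: "\<And>r \<theta>. 0 < r \<Longrightarrow> \<theta> \<in> sphere 0 1 \<Longrightarrow> w (r *\<^sub>R \<theta>) = r powr a * f \<theta>"
  shows "continuous_on (- {0}) w"
    and "\<And>r x. 0 < r \<Longrightarrow> x \<noteq> 0 \<Longrightarrow> w (r *\<^sub>R x) = r powr a * w x"
proof -
  obtain U F where F: "open U" "sphere 0 1 \<subseteq> U" "Ck_on 2 U F" "\<And>\<theta>. \<theta> \<in> sphere 0 1 \<Longrightarrow> F \<theta> = f \<theta>"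
    using f unfolding C2_sphere_def by blast
  have fc: "continuous_on (sphere 0 1) f"
    using continuous_on_subset[OF Ck_on_2D(2)[OF F(3)] F(2)] F(4) continuous_on_cong by metis
  have eq: "w x = norm x powr a * f (x /\<^sub>R norm x)" if "x \<noteq> 0" for x
    using w[of "norm x" "x /\<^sub>R norm x"] that by simp
  have "continuous_on (- {0}) (\<lambda>x::'a. norm x powr a * f (x /\<^sub>R norm x))"
    by (intro continuous_intros continuous_on_compose2[OF fc]) (auto, metis left_inverse norm_eq_zero)
  then show "continuous_on (- {0}) w"
    by (rule continuous_on_eq) (use eq in auto)
  show "w (r *\<^sub>R x) = r powr a * w x" if "0 < r" "x \<noteq> 0" for r x
  proof -
    have "(r *\<^sub>R x) /\<^sub>R norm (r *\<^sub>R x) = x /\<^sub>R norm x"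
      using that by (simp add: field_simps)
    then show ?thesis
      using eq[OF that(2)] eq[of "r *\<^sub>R x"] that by (simp add: powr_mult del: scaleR_scaleR)
  qed
qed

lemma rescaled_powr:
  "0 < R \<Longrightarrow> \<bar>R powr b * t\<bar> powr e = R powr (b * e) * \<bar>t\<bar> powr e" for R b t e :: real
  by (simp add: abs_mult powr_mult powr_powr)

lemma rescaled_C2:
  fixes u :: "'a::euclidean_space \<Rightarrow> real"
  assumes "Ck_on 2 UNIV u"
  shows "Ck_on 2 UNIV (rescaled a u R)"
    and "laplacian (rescaled a u R) x = R powr a * R\<^sup>2 * laplacian u (R *\<^sub>R x)"
  using C2_dilation[OF assms open_UNIV open_UNIV, where R = R and c = "R powr a"] by (auto simp: rescaled_def[abs_def])

text \<open>The comparison bound depends on \<open>R\<close> only through the lower bound on one ball, so it survives the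
  limit.\<close>

lemma cluster_pos:
  fixes u w :: "'a::euclidean_space \<Rightarrow> real"
  assumes u: "Ck_on 2 UNIV u" and sup: "\<And>x. laplacian u x \<le> 0" and nonneg: "\<And>x. 0 \<le> u x"
    and lim: "\<And>K \<epsilon>. compact K \<Longrightarrow> 0 \<notin> K \<Longrightarrow> 0 < \<epsilon> \<Longrightarrow>
      \<exists>\<^sub>F R in at_top. \<forall>x\<in>K. \<bar>rescaled a u R x - w x\<bar> < \<epsilon>"
    and w: "continuous_on (- {0}) w" and z: "z \<noteq> 0" "w z \<noteq> 0" and x: "x \<noteq> 0"
  shows "0 < w x"
proof -
  have sc: "Ck_on 2 UNIV (rescaled a u R)" "\<And>x. laplacian (rescaled a u R) x \<le> 0"
    "\<And>x. 0 \<le> rescaled a u R x" for R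
    using rescaled_C2[OF u, of a R] sup nonneg by (auto simp: rescaled_def mult_nonneg_nonpos)
  have "0 \<le> w z"
  proof (rule ccontr)
    assume "\<not> 0 \<le> w z"
    then obtain R where "\<bar>rescaled a u R z - w z\<bar> < - w z"
      using lim[of "{z}" "- w z"] z(1) by (auto dest: frequently_ex)
    then show False using sc(3)[of R z] by linarith
  qed
  then have "w z > 0" using z(2) by simp
  define m where "m = w z / 2"
  have "0 < m" using \<open>w z > 0\<close> by (simp add: m_def)
  have "isCont w z"
    using w z(1) by (simp add: continuous_on_eq_continuous_at open_Compl)
  then obtain r' where r': "r' > 0" "\<And>x. dist x z < r' \<Longrightarrow> dist (w x) (w z) < m"
    unfolding continuous_at_eps_delta using \<open>0 < m\<close> by metis
  define r where "r = min r' (norm z) / 2"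
  have r: "0 < r" "r < r'" "r < norm z" using r'(1) zero_less_norm_iff[of z] z(1) unfolding r_def by linarith+
  have wm: "m \<le> w y" if "y \<in> cball z r" for y
  proof -
    have "dist y z < r'" using that r by (auto simp: dist_commute)
    then show ?thesis using r'(2)[of y] unfolding m_def dist_real_def by linarith
  qed
  define s where "s = real DIM('a)"
  \<comment> \<open>A lower bound for the rescaled function at \<open>x\<close>, valid for every
    \<open>R\<close> that keeps it above \<open>m / 2\<close> on the ball around \<open>z\<close>.
    It has to be known before \<open>R\<close> is chosen, since the accuracy
    \<open>\<epsilon>\<close> \<le> c/2 depends on it.\<close>
  define c where "c = (if norm (x - z) \<le> r then m / 2 else m / 2 * (r / norm (x - z)) powr s)"
  have "c > 0" using \<open>0 < m\<close> r by (auto simp: c_def intro!: mult_pos_pos)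
  define \<epsilon> where "\<epsilon> = min (m / 2) (c / 2)"
  have "0 < \<epsilon>" using \<open>0 < m\<close> \<open>0 < c\<close> by (simp add: \<epsilon>_def)
  have "compact (insert x (cball z r))" "0 \<notin> insert x (cball z r)"
    using x r by auto
  then obtain R where R: "\<And>y. y \<in> insert x (cball z r) \<Longrightarrow> \<bar>rescaled a u R y - w y\<bar> < \<epsilon>"
    using frequently_ex[OF lim[of "insert x (cball z r)" \<epsilon>]] \<open>0 < \<epsilon>\<close> by blast
  have um: "m / 2 \<le> rescaled a u R y" if "y \<in> cball z r" for y
  proof -
    have "\<bar>rescaled a u R y - w y\<bar> < m / 2" using R[of y] that by (simp add: \<epsilon>_def)
    then show ?thesis using wm[OF that] by linarith
  qed
  have "c \<le> rescaled a u R x"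
  proof (cases "norm (x - z) \<le> r")
    case True
    then show ?thesis using um[of x] by (simp add: c_def dist_norm norm_minus_commute)
  next
    case False
    have "m / 2 * (r / norm (x - z)) powr s \<le> rescaled a u R x"
      by (rule superharmonic_lower_bound[OF sc r(1) _ um]) (use \<open>0 < m\<close> False in \<open>auto simp: s_def\<close>)
    then show ?thesis using False by (simp add: c_def)
  qed
  moreover have "\<bar>rescaled a u R x - w x\<bar> < c / 2" using R[of x] by (simp add: \<epsilon>_def)
  ultimately show ?thesis using \<open>0 < c\<close> by linarith
qed

section \<open>Exponents, positivity of solutions and the bound on the exponent \<alpha>\<close>

locale lane_emden_exponents =
  fixes p q \<alpha> \<beta> \<gamma> :: real
  assumes pq: "q \<le> p" "0 < q" "1 < p * q"
    and \<alpha>: "\<alpha> = 2 * (p + 1) / (p * q - 1)"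
    and \<beta>: "\<beta> = 2 * (q + 1) / (p * q - 1)"
    and \<gamma>: "\<gamma> = \<alpha> - \<beta>"
begin

text \<open>The two relations \<beta> p = \<alpha> + 2 and \<alpha> q = \<beta> + 2 express the
  invariance of the system under rescaling. The power 2/\<alpha> is the one for which u powr
  (2/\<alpha>) scales like |x| powr (-2), that is, like a Hardy weight.\<close>

lemma exponent_facts:
  "1 < p" "0 < \<alpha>" "0 < \<beta>" "\<beta> * p = \<alpha> + 2" "\<alpha> * q = \<beta> + 2" "0 \<le> \<gamma>" "2 / \<alpha> = (p * q - 1) / (p + 1)"
proof -
  show "1 < p"
  proof (rule ccontr)
    assume "\<not> 1 < p"
    then have "p * q \<le> 1" using pq mult_le_one[of p q] by simp
    then show False using pq by simp
  qed
  then show "0 < \<alpha>" "0 < \<beta>" "\<beta> * p = \<alpha> + 2" "\<alpha> * q = \<beta> + 2" "2 / \<alpha> = (p * q - 1) / (p + 1)"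
    using pq by (auto simp: \<alpha> \<beta> field_simps)
  have "\<gamma> = 2 * (p - q) / (p * q - 1)"
    unfolding \<gamma> \<alpha> \<beta> by (simp add: diff_divide_distrib[symmetric])
  then show "0 \<le> \<gamma>" using pq by simp
qed

lemma lane_emden_rescaled:
  fixes u v :: "'a::euclidean_space \<Rightarrow> real"
  assumes sol: "lane_emden_solution p q u v" and "0 < R"
  shows "lane_emden_solution p q (rescaled \<alpha> u R) (rescaled \<beta> v R)"
proof -
  have uv: "Ck_on 2 UNIV u" "Ck_on 2 UNIV v"
    using sol by (auto simp: lane_emden_solution_def)
  have R2: "R\<^sup>2 = R powr 2" using \<open>0 < R\<close> by (simp add: powr_numeral)
  have scale: "R powr b * R\<^sup>2 * (\<bar>t\<bar> powr (e - 1) * t) = \<bar>R powr b' * t\<bar> powr (e - 1) * (R powr b' * t)"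
    if "b' * e = b + 2" for b b' e t
  proof -
    have "R powr b * R\<^sup>2 = R powr (b' * (e - 1)) * R powr b'"
      using that unfolding R2 powr_add[symmetric] by (simp add: algebra_simps)
    then show ?thesis
      unfolding rescaled_powr[OF \<open>0 < R\<close>] by (simp add: mult_ac)
  qed
  have "- laplacian u (R *\<^sub>R x) = \<bar>v (R *\<^sub>R x)\<bar> powr (p - 1) * v (R *\<^sub>R x)"
    "- laplacian v (R *\<^sub>R x) = \<bar>u (R *\<^sub>R x)\<bar> powr (q - 1) * u (R *\<^sub>R x)" for x
    using sol by (auto simp: lane_emden_solution_def)
  then have "- (R powr \<alpha> * R\<^sup>2 * laplacian u (R *\<^sub>R x)) = \<bar>R powr \<beta> * v (R *\<^sub>R x)\<bar> powr (p - 1) * (R powr \<beta> * v (R *\<^sub>R x))"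
    "- (R powr \<beta> * R\<^sup>2 * laplacian v (R *\<^sub>R x)) = \<bar>R powr \<alpha> * u (R *\<^sub>R x)\<bar> powr (q - 1) * (R powr \<alpha> * u (R *\<^sub>R x))" for x
    unfolding scale[OF exponent_facts(4), symmetric] scale[OF exponent_facts(5), symmetric]
    by (metis mult_minus_right)+
  then show ?thesis
    unfolding lane_emden_solution_def using rescaled_C2[OF uv(1)] rescaled_C2[OF uv(2)]
    by (simp add: rescaled_def)
qed

lemma lane_emden_superharmonic:
  fixes u v :: "'a::euclidean_space \<Rightarrow> real"
  assumes sol: "lane_emden_solution p q u v" and nonneg: "\<And>x. 0 \<le> u x" "\<And>x. 0 \<le> v x"
  shows "Ck_on 2 UNIV u" "Ck_on 2 UNIV v" "laplacian u x \<le> 0" "laplacian v x \<le> 0"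
    "- laplacian u x = v x powr p" "- laplacian v x = u x powr q"
proof -
  show "Ck_on 2 UNIV u" "Ck_on 2 UNIV v"
    using sol by (auto simp: lane_emden_solution_def)
  have pow: "\<bar>t\<bar> powr (e - 1) * t = t powr e" if "0 \<le> t" for t e :: real
    using that powr_mult_base[of t "e - 1"] by (simp add: mult.commute)
  show lu: "- laplacian u x = v x powr p"
    using sol pow[OF nonneg(2)[of x], of p] by (simp add: lane_emden_solution_def)
  show lv: "- laplacian v x = u x powr q"
    using sol pow[OF nonneg(1)[of x], of q] by (simp add: lane_emden_solution_def)
  show "laplacian u x \<le> 0" "laplacian v x \<le> 0"
    using lu lv powr_ge_zero[of "v x" p] powr_ge_zero[of "u x" q] by linarith+
qed

text \<open>The coupling transfers positivity: if one component vanished identically, so would its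
  Laplacian, which is minus a positive power of the other component. So neither vanishes
  identically, and the strong minimum principle applies to each.\<close>

lemma lane_emden_pos:
  fixes u v :: "'a::euclidean_space \<Rightarrow> real"
  assumes sol: "lane_emden_solution p q u v" and nonneg: "\<And>x. 0 \<le> u x" "\<And>x. 0 \<le> v x"
    and z: "u z \<noteq> 0 \<or> v z \<noteq> 0"
  shows "0 < u x" "0 < v x"
proof -
  note sup = lane_emden_superharmonic[OF sol nonneg]
  have zero: "laplacian w y = 0" if "\<And>x. w x = 0" for w :: "'a \<Rightarrow> real" and y
  proof -
    have "w = (\<lambda>_. 0)" using that by blast
    moreover have "partial_deriv b (\<lambda>_::'a. 0) = (\<lambda>_. 0)" for b
      using partial_deriv_eq[OF has_derivative_const[of 0]] by blast
    ultimately show ?thesis by (simp add: laplacian_def)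
  qed
  have "\<exists>y. 0 < u y"
  proof (rule ccontr)
    assume "\<not> (\<exists>y. 0 < u y)"
    then have "u y = 0" for y using nonneg(1)[of y] by (metis less_eq_real_def)
    then have "laplacian u y = 0" for y
      by (rule zero)
    then have "v y powr p = 0" for y
      using sup(5)[of y] by simp
    then show False using z \<open>\<And>y. u y = 0\<close> by simp
  qed
  then have upos: "0 < u y" for y
    using superharmonic_pos[OF sup(1,3) nonneg(1)] by blast
  have "\<exists>y. 0 < v y"
  proof (rule ccontr)
    assume "\<not> (\<exists>y. 0 < v y)"
    then have "v y = 0" for y using nonneg(2)[of y] by (metis less_eq_real_def)
    then have "laplacian v y = 0" for y
      by (rule zero)
    then have "u y powr q = 0" for y
      using sup(6)[of y] by simp
    then show False using upos[of z] by simp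
  qed
  then have "0 < v y" for y
    using superharmonic_pos[OF sup(2,4) nonneg(2)] by blast
  then show "0 < u x" "0 < v x" using upos by auto
qed

text \<open>In the plane \<open>u\<close> is constant, so the source term, a power of
  \<open>v\<close>, is 0, contrary to the positivity of \<open>v\<close>.\<close>

lemma lane_emden_dim_ne_2:
  fixes u v :: "'a::euclidean_space \<Rightarrow> real"
  assumes sol: "lane_emden_solution p q u v" and nonneg: "\<And>x. 0 \<le> u x" "\<And>x. 0 \<le> v x"
    and z: "u z \<noteq> 0 \<or> v z \<noteq> 0"
  shows "DIM('a) \<noteq> 2"
proof
  assume d: "DIM('a) = 2"
  note sup = lane_emden_superharmonic[OF sol nonneg]
  have "u = (\<lambda>_. u 0)"
    using superharmonic_plane_const[OF d sup(1,3) nonneg(1)] by (intro ext antisym)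
  then obtain c where u: "u = (\<lambda>_. c)" by blast
  have "partial_deriv b (\<lambda>_::'a. c) = (\<lambda>_. 0)" for b c
    using partial_deriv_eq[OF has_derivative_const[of c]] by blast
  then have "laplacian u 0 = 0"
    by (simp add: laplacian_def u)
  then have "v 0 = 0" using sup(5)[of 0] by simp
  then show False using lane_emden_pos[OF sol nonneg z] by (metis less_irrefl)
qed

text \<open>Young's inequality for \<open>-\<Delta>u/u\<close> and \<open>-\<Delta>v/v\<close> with weight \<open>1/(p + 1)\<close>, for which the powers of \<open>v\<close>
  cancel.\<close>

lemma lane_emden_power_bound:
  fixes u v \<zeta> :: "'a::euclidean_space \<Rightarrow> real"
  assumes sol: "lane_emden_solution p q u v" and pos: "\<And>x. 0 < u x" "\<And>x. 0 < v x"
    and \<zeta>: "Ck_on 1 UNIV \<zeta>" and C: "compact C" and \<zeta>0: "\<And>x. x \<notin> C \<Longrightarrow> \<zeta> x = 0"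
  shows "integrable lborel (\<lambda>x. (\<zeta> x)\<^sup>2 * u x powr (2 / \<alpha>))"
    and "(LINT x|lborel. (\<zeta> x)\<^sup>2 * u x powr (2 / \<alpha>)) \<le> (LINT x|lborel. (norm (grad \<zeta> x))\<^sup>2)"
proof -
  note sup = lane_emden_superharmonic[OF sol less_imp_le[OF pos(1)] less_imp_le[OF pos(2)]]
  define \<theta> where "\<theta> = 1 / (p + 1)"
  have \<theta>: "0 \<le> \<theta>" "0 \<le> 1 - \<theta>" "\<theta> + (1 - \<theta>) = 1"
    using exponent_facts(1) by (auto simp: \<theta>_def)
  have \<zeta>C: "continuous_on C \<zeta>" "continuous_on C u"
    using Ck_on_1D(2)[OF \<zeta>] Ck_on_2D(2)[OF sup(1)] continuous_on_subset by blast+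
  show i: "integrable lborel (\<lambda>x. (\<zeta> x)\<^sup>2 * u x powr (2 / \<alpha>))"
    using pos(1) by (intro integrable_compact_support_mult[OF C])
      (auto intro!: continuous_intros \<zeta>C simp: \<zeta>0 less_imp_neq[THEN not_sym])
  have young: "u x powr (2 / \<alpha>) \<le> \<theta> * (- laplacian u x / u x) + (1 - \<theta>) * (- laplacian v x / v x)" for x
  proof -
    let ?a = "v x powr p / u x" and ?b = "u x powr q / v x"
    have "?a powr \<theta> * ?b powr (1 - \<theta>) \<le> \<theta> * ?a + (1 - \<theta>) * ?b"
      using pos[of x] \<theta> by (intro Youngs_inequality_0) auto
    moreover have "?a powr \<theta> * ?b powr (1 - \<theta>) = u x powr (2 / \<alpha>)"
    proof -
      have e: "p * \<theta> - (1 - \<theta>) = 0" "q * (1 - \<theta>) - \<theta> = 2 / \<alpha>"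
      proof -
        have \<theta>': "1 - \<theta> = p / (p + 1)"
          using exponent_facts(1) by (simp add: \<theta>_def field_simps)
        show "p * \<theta> - (1 - \<theta>) = 0" "q * (1 - \<theta>) - \<theta> = 2 / \<alpha>"
          unfolding exponent_facts(7) \<theta>' by (auto simp: \<theta>_def diff_divide_distrib mult.commute)
      qed
      have "(b powr p / a) powr t * (a powr q / b) powr e = b powr (p * t - e) * a powr (q * e - t)"
        if "0 < a" "0 < b" for a b t e :: real
        using that by (simp add: powr_divide powr_powr powr_diff)
      from this[OF pos, of x x \<theta> "1 - \<theta>"] show ?thesis unfolding e using pos[of x] by simp
    qed
    ultimately show ?thesis using sup(5,6) by simp
  qed
  have iu: "integrable lborel (\<lambda>x. (\<zeta> x)\<^sup>2 * (- laplacian u x / u x))"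
    "integrable lborel (\<lambda>x. (\<zeta> x)\<^sup>2 * (- laplacian v x / v x))"
    by (rule picone_identity(1)[OF open_UNIV sup(1) pos(1) \<zeta> C subset_UNIV \<zeta>0]
        picone_identity(1)[OF open_UNIV sup(2) pos(2) \<zeta> C subset_UNIV \<zeta>0]; simp)+
  have "(LINT x|lborel. (\<zeta> x)\<^sup>2 * u x powr (2 / \<alpha>)) \<le> (LINT x|lborel.
      \<theta> * ((\<zeta> x)\<^sup>2 * (- laplacian u x / u x)) + (1 - \<theta>) * ((\<zeta> x)\<^sup>2 * (- laplacian v x / v x)))"
  proof (rule integral_mono[OF i])
    show "integrable lborel (\<lambda>x. \<theta> * ((\<zeta> x)\<^sup>2 * (- laplacian u x / u x)) + (1 - \<theta>) * ((\<zeta> x)\<^sup>2 * (- laplacian v x / v x)))"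
      using iu by (intro Bochner_Integration.integrable_add integrable_mult_right)
    show "(\<zeta> x)\<^sup>2 * u x powr (2 / \<alpha>)
      \<le> \<theta> * ((\<zeta> x)\<^sup>2 * (- laplacian u x / u x)) + (1 - \<theta>) * ((\<zeta> x)\<^sup>2 * (- laplacian v x / v x))" for x
      using mult_left_mono[OF young[of x], of "(\<zeta> x)\<^sup>2"] by (simp add: algebra_simps)
  qed
  also have "\<dots> = \<theta> * (LINT x|lborel. (\<zeta> x)\<^sup>2 * (- laplacian u x / u x))
      + (1 - \<theta>) * (LINT x|lborel. (\<zeta> x)\<^sup>2 * (- laplacian v x / v x))"
    using Bochner_Integration.integral_add[OF integrable_mult_right[OF iu(1)] integrable_mult_right[OF iu(2)]]
    by (simp only: Bochner_Integration.integral_mult_right_zero)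
  also have "\<dots> \<le> \<theta> * (LINT x|lborel. (norm (grad \<zeta> x))\<^sup>2) + (1 - \<theta>) * (LINT x|lborel. (norm (grad \<zeta> x))\<^sup>2)"
    using barta_inequality[OF open_UNIV sup(1) pos(1) \<zeta> C subset_UNIV \<zeta>0]
      barta_inequality[OF open_UNIV sup(2) pos(2) \<zeta> C subset_UNIV \<zeta>0] \<theta>
    by (intro add_mono mult_left_mono) auto
  finally show "(LINT x|lborel. (\<zeta> x)\<^sup>2 * u x powr (2 / \<alpha>)) \<le> (LINT x|lborel. (norm (grad \<zeta> x))\<^sup>2)"
    by (simp add: algebra_simps)
qed

text \<open>For every s > d - 2 the decay bound makes the rescaled \<open>u\<close> at least a
  constant times R powr (\<alpha> - s) on \<open>C\<close>, while the bound on its power 2/\<alpha>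
  by the Dirichlet energy of \<open>\<zeta>\<close> does not depend on \<open>R\<close>. Letting
  \<open>R\<close> grow gives \<alpha> \<le> s. The function \<open>\<zeta>\<close> is merely a
  fixed test function of nonzero norm.\<close>

lemma lane_emden_alpha_le:
  fixes u v \<zeta> :: "'a::euclidean_space \<Rightarrow> real"
  assumes sol: "lane_emden_solution p q u v" and pos: "\<And>x. 0 < u x" "\<And>x. 0 < v x"
    and \<zeta>: "Ck_on 1 UNIV \<zeta>" and C: "compact C" and \<zeta>0: "\<And>x. x \<notin> C \<Longrightarrow> \<zeta> x = 0"
    and nz: "0 < (LINT x|lborel. (\<zeta> x)\<^sup>2)" and d: "DIM('a) \<ge> 2"
  shows "\<alpha> \<le> real DIM('a) - 2"
proof (rule dense_ge)
  fix s assume s: "real DIM('a) - 2 < s"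
  then have "0 < s" using d by simp
  note sup = lane_emden_superharmonic[OF sol less_imp_le[OF pos(1)] less_imp_le[OF pos(2)]]
  obtain c where c: "0 < c" "\<And>x. c * (1 + norm x) powr (- s) \<le> u x"
    using superharmonic_decay_bound[OF sup(1,3) less_imp_le[OF pos(1)] \<open>0 < s\<close> s pos(1)[of 0]] by blast
  obtain M where M: "0 < M" "\<And>x. x \<in> C \<Longrightarrow> norm x \<le> M"
    using compact_imp_bounded[OF C] unfolding bounded_pos by blast
  define B where "B = (LINT x|lborel. (norm (grad \<zeta> x))\<^sup>2)"
  define I where "I = (LINT x|lborel. (\<zeta> x)\<^sup>2)"
  define k where "k = (c * (1 + M) powr (- s)) powr (2 / \<alpha>)"
  have "0 < k" using c M by (simp add: k_def)
  have bound: "R powr ((\<alpha> - s) * (2 / \<alpha>)) \<le> B / (k * I)" if "1 \<le> R" for R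
  proof -
    have "0 < R" using that by simp
    have posR: "\<And>x. 0 < rescaled \<alpha> u R x" "\<And>x. 0 < rescaled \<beta> v R x"
      using pos \<open>0 < R\<close> by (auto simp: rescaled_def)
    have le: "(\<zeta> x)\<^sup>2 * (k * R powr ((\<alpha> - s) * (2 / \<alpha>))) \<le> (\<zeta> x)\<^sup>2 * rescaled \<alpha> u R x powr (2 / \<alpha>)" for x
    proof (cases "x \<in> C")
      case True
      have "1 + norm (R *\<^sub>R x) \<le> R * (1 + M)"
        using M(2)[OF True] that by (simp add: algebra_simps add_mono)
      then have "(R * (1 + M)) powr (- s) \<le> (1 + norm (R *\<^sub>R x)) powr (- s)"
        using \<open>0 < s\<close> norm_ge_zero[of "R *\<^sub>R x"] by (intro powr_mono2') (auto intro: add_pos_nonneg)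
      then have "c * (R * (1 + M)) powr (- s) \<le> u (R *\<^sub>R x)"
        using c(2)[of "R *\<^sub>R x"] c(1) mult_left_mono[of _ _ c] by (meson less_imp_le order_trans)
      then have "R powr \<alpha> * (c * (R * (1 + M)) powr (- s)) \<le> rescaled \<alpha> u R x"
        unfolding rescaled_def by (rule mult_left_mono) simp
      also have "R powr \<alpha> * (c * (R * (1 + M)) powr (- s)) = c * (1 + M) powr (- s) * R powr (\<alpha> - s)"
        using \<open>0 < R\<close> M(1) by (simp add: powr_mult powr_diff powr_minus_divide mult_ac)
      finally have "(c * (1 + M) powr (- s) * R powr (\<alpha> - s)) powr (2 / \<alpha>) \<le> rescaled \<alpha> u R x powr (2 / \<alpha>)"
        using c(1) exponent_facts(2) by (intro powr_mono2) auto
      also have "(c * (1 + M) powr (- s) * R powr (\<alpha> - s)) powr (2 / \<alpha>) = k * R powr ((\<alpha> - s) * (2 / \<alpha>))"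
        using c(1) by (simp add: k_def powr_mult powr_powr)
      finally show ?thesis by (rule mult_left_mono) simp
    qed (simp add: \<zeta>0)
    have "continuous_on C \<zeta>" using Ck_on_1D(2)[OF \<zeta>] continuous_on_subset by blast
    then have "integrable lborel (\<lambda>x. (\<zeta> x)\<^sup>2)"
      by (intro integrable_compact_support[OF C]) (auto intro!: continuous_intros simp: \<zeta>0)
    then have "I * (k * R powr ((\<alpha> - s) * (2 / \<alpha>))) \<le> (LINT x|lborel. (\<zeta> x)\<^sup>2 * rescaled \<alpha> u R x powr (2 / \<alpha>))"
      unfolding I_def Bochner_Integration.integral_mult_left_zero[symmetric]
      by (intro integral_mono le integrable_mult_left
          lane_emden_power_bound(1)[OF lane_emden_rescaled[OF sol \<open>0 < R\<close>] posR \<zeta> C \<zeta>0])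
    also have "\<dots> \<le> B"
      unfolding B_def by (rule lane_emden_power_bound(2)[OF lane_emden_rescaled[OF sol \<open>0 < R\<close>] posR \<zeta> C \<zeta>0])
    finally show ?thesis
      using \<open>0 < k\<close> nz unfolding I_def[symmetric] by (simp add: field_simps)
  qed
  show "\<alpha> \<le> s"
  proof (rule ccontr)
    assume "\<not> \<alpha> \<le> s"
    define e where "e = (\<alpha> - s) * (2 / \<alpha>)"
    have "0 < e" using \<open>\<not> \<alpha> \<le> s\<close> exponent_facts(2) by (simp add: e_def)
    \<comment> \<open>\<open>b\<close> exceeds the claimed bound and is at least 1, so its root
      \<open>R\<close> is an admissible scale with R powr e = b.\<close>
    define b where "b = max 1 (B / (k * I)) + 1"
    define R where "R = b powr (1 / e)"
    have b: "1 \<le> b" "B / (k * I) < b" by (auto simp: b_def)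
    have "1 \<le> R" unfolding R_def using b(1) \<open>0 < e\<close> by (intro ge_one_powr_ge_zero) auto
    moreover have "R powr e = b"
      unfolding R_def powr_powr using \<open>0 < e\<close> b(1) by simp
    ultimately have "b \<le> B / (k * I)"
      using bound[of R] by (simp add: e_def)
    then show False using b(2) by simp
  qed
qed

text \<open>The bound on \<alpha> is obtained by testing with \<open>\<zeta>\<close> itself, which
  must then have nonzero norm. A \<open>\<zeta>\<close> that is 0 almost everywhere is treated
  apart: its weighted integral is 0.\<close>

lemma hardy_gamma:
  fixes u v \<zeta> :: "'a::euclidean_space \<Rightarrow> real"
  assumes sol: "lane_emden_solution p q u v" and pos: "\<And>x. 0 < u x" "\<And>x. 0 < v x"
    and \<zeta>: "Ck_on 1 UNIV \<zeta>" and C: "compact C" and \<zeta>0: "\<And>x. x \<notin> C \<Longrightarrow> \<zeta> x = 0" and d: "DIM('a) \<ge> 3"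
  shows "\<gamma>\<^sup>2 / 4 * (LINT x|lborel. (\<zeta> x)\<^sup>2 / (norm x)\<^sup>2) \<le> (LINT x|lborel. (norm (grad \<zeta> x))\<^sup>2)"
proof (cases "0 < (LINT x|lborel. (\<zeta> x)\<^sup>2)")
  case True
  have "\<gamma> \<le> real DIM('a) - 2"
    using lane_emden_alpha_le[OF sol pos \<zeta> C \<zeta>0 True] d exponent_facts(3) \<gamma> by simp
  then have "\<gamma>\<^sup>2 / 4 * (LINT x|lborel. (\<zeta> x)\<^sup>2 / (norm x)\<^sup>2)
      \<le> (real DIM('a) - 2)\<^sup>2 / 4 * (LINT x|lborel. (\<zeta> x)\<^sup>2 / (norm x)\<^sup>2)"
    using exponent_facts(6) by (intro mult_right_mono divide_right_mono power_mono integral_nonneg_AE) auto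
  also have "\<dots> \<le> (LINT x|lborel. (norm (grad \<zeta> x))\<^sup>2)"
    by (rule hardy_inequality(2)[OF d \<zeta> C \<zeta>0])
  finally show ?thesis .
next
  case False
  moreover have "0 \<le> (LINT x|lborel. (\<zeta> x)\<^sup>2)" by simp
  ultimately have "(LINT x|lborel. (\<zeta> x)\<^sup>2) = 0" by simp
  moreover have "continuous_on C \<zeta>" using Ck_on_1D(2)[OF \<zeta>] continuous_on_subset by blast
  then have i: "integrable lborel (\<lambda>x. (\<zeta> x)\<^sup>2)"
    by (intro integrable_compact_support[OF C]) (auto intro!: continuous_intros simp: \<zeta>0)
  ultimately have "AE x in lborel. (\<zeta> x)\<^sup>2 = 0"
    using integral_nonneg_eq_0_iff_AE[OF i] by simp
  then have "(LINT x|lborel. (\<zeta> x)\<^sup>2 / (norm x)\<^sup>2) = 0"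
    by (intro integral_eq_zero_AE) (auto elim!: eventually_mono)
  then show ?thesis by simp
qed

end

section \<open>Stability along dilations and passage to the blow-down limit\<close>

text \<open>Meant for the exponents q - 1 and p - 1 and their halves. Since \<open>q\<close> may be
  less than 1, the power may be decreasing, and both end points have to be taken into
  account.\<close>

lemma powr_between:
  fixes l h t e :: real
  assumes "0 < l" "l \<le> t" "t \<le> h"
  shows "min (l powr e) (h powr e) \<le> t powr e" "t powr e \<le> max (l powr e) (h powr e)"
proof -
  have "l powr e \<le> t powr e \<and> t powr e \<le> h powr e \<or> h powr e \<le> t powr e \<and> t powr e \<le> l powr e"
    using assms by (cases "0 \<le> e") (auto intro: powr_mono2 powr_mono2')
  then show "min (l powr e) (h powr e) \<le> t powr e" "t powr e \<le> max (l powr e) (h powr e)"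
    by auto
qed

lemma sqrt_powr: "0 \<le> x \<Longrightarrow> sqrt (x powr e) = x powr (e / 2)" for x e :: real
  by (simp add: powr_half_sqrt[symmetric] powr_powr)

lemma compact_pos_bounds:
  fixes f :: "'a::topological_space \<Rightarrow> real"
  assumes "compact C" "continuous_on C f" "\<And>x. x \<in> C \<Longrightarrow> 0 < f x"
  obtains l h where "0 < l" "\<And>x. x \<in> C \<Longrightarrow> l \<le> f x" "\<And>x. x \<in> C \<Longrightarrow> f x \<le> h"
proof (cases "C = {}")
  case True
  then show ?thesis using that[of 1] by simp
next
  case False
  obtain a where "a \<in> C" "\<And>x. x \<in> C \<Longrightarrow> f a \<le> f x"
    using continuous_attains_inf[OF assms(1) False assms(2)] by blast
  moreover obtain b where "b \<in> C" "\<And>x. x \<in> C \<Longrightarrow> f x \<le> f b"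
    using continuous_attains_sup[OF assms(1) False assms(2)] by blast
  ultimately show ?thesis using that assms(3) by blast
qed

lemma grad_dilation:
  fixes w :: "'a::euclidean_space \<Rightarrow> real"
  assumes "w differentiable (at (R *\<^sub>R x))"
  shows "grad (\<lambda>y. c * w (R *\<^sub>R y)) x = (c * R) *\<^sub>R grad w (R *\<^sub>R x)"
  by (rule grad_eq[OF has_derivative_dilation[OF assms]])

context lane_emden_exponents
begin

text \<open>The powers of the rescaled \<open>v\<close> and \<open>u\<close> produce factors R powr
  (2 + \<gamma>) and R powr (2 - \<gamma>), whereas the Laplacian of a dilated function produces
  R^2. Multiplying \<open>\<psi>\<close> by R powr (-\<gamma>) compensates the mismatch in both
  inequalities at once, and it leaves the logarithmic gradients unaffected.\<close>

lemma stability_rescaled: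
  fixes u v \<phi> \<psi> :: "'a::euclidean_space \<Rightarrow> real"
  assumes K: "closed K" and C2: "Ck_on 2 (- K) \<phi>" "Ck_on 2 (- K) \<psi>"
    and pos0: "\<forall>x\<in>- K. \<phi> x > 0 \<and> \<psi> x > 0"
    and lap0: "\<forall>x\<in>- K. - laplacian \<phi> x \<ge> p * \<bar>v x\<bar> powr (p - 1) * \<psi> x"
      "\<forall>x\<in>- K. - laplacian \<psi> x \<ge> q * \<bar>u x\<bar> powr (q - 1) * \<phi> x"
    and "0 < R"
  defines "V \<equiv> {x. R *\<^sub>R x \<in> - K}"
    and "f \<equiv> \<lambda>x. 1 * \<phi> (R *\<^sub>R x)" and "g \<equiv> \<lambda>x. R powr (- \<gamma>) * \<psi> (R *\<^sub>R x)"
  shows "open V" "Ck_on 2 V f" "Ck_on 2 V g" "\<And>x. x \<in> V \<Longrightarrow> 0 < f x" "\<And>x. x \<in> V \<Longrightarrow> 0 < g x"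
    and "\<And>x. x \<in> V \<Longrightarrow> p * \<bar>rescaled \<beta> v R x\<bar> powr (p - 1) * g x \<le> - laplacian f x"
    and "\<And>x. x \<in> V \<Longrightarrow> q * \<bar>rescaled \<alpha> u R x\<bar> powr (q - 1) * f x \<le> - laplacian g x"
    and "\<And>x. x \<in> V \<Longrightarrow> x \<bullet> ((1 / f x) *\<^sub>R grad f x - (1 / g x) *\<^sub>R grad g x)
      = (R *\<^sub>R x) \<bullet> ((1 / \<phi> (R *\<^sub>R x)) *\<^sub>R grad \<phi> (R *\<^sub>R x) - (1 / \<psi> (R *\<^sub>R x)) *\<^sub>R grad \<psi> (R *\<^sub>R x))"
proof -
  have \<phi>: "Ck_on 2 (- K) \<phi>" "\<And>x. x \<in> - K \<Longrightarrow> 0 < \<phi> x"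
    and \<psi>: "Ck_on 2 (- K) \<psi>" "\<And>x. x \<in> - K \<Longrightarrow> 0 < \<psi> x"
    and lap\<phi>: "\<And>x. x \<in> - K \<Longrightarrow> - laplacian \<phi> x \<ge> p * \<bar>v x\<bar> powr (p - 1) * \<psi> x"
    and lap\<psi>: "\<And>x. x \<in> - K \<Longrightarrow> - laplacian \<psi> x \<ge> q * \<bar>u x\<bar> powr (q - 1) * \<phi> x"
    using C2 pos0 lap0 by blast+
  have U: "open (- K)" using K by (simp add: open_Compl)
  have "V = (\<lambda>x. R *\<^sub>R x) -` (- K)" by (auto simp: V_def)
  then show V: "open V"
    using continuous_open_vimage[OF U, of "\<lambda>x. R *\<^sub>R x"] by (simp add: continuous_intros)
  have inV: "R *\<^sub>R x \<in> - K" if "x \<in> V" for x using that by (simp add: V_def)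
  show "Ck_on 2 V f" "Ck_on 2 V g"
    unfolding f_def g_def by (rule C2_dilation(1)[OF C2(1) U V inV] C2_dilation(1)[OF C2(2) U V inV]; assumption)+
  show "0 < f x" "0 < g x" if "x \<in> V" for x
    using \<phi>(2)[OF inV[OF that]] \<psi>(2)[OF inV[OF that]] \<open>0 < R\<close> by (auto simp: f_def g_def)
  have R2: "R\<^sup>2 = R powr 2" using \<open>0 < R\<close> by (simp add: powr_numeral)
  have e: "\<beta> * (p - 1) = 2 + \<gamma>" "\<alpha> * (q - 1) = 2 - \<gamma>"
    using exponent_facts(4,5) by (simp_all add: \<gamma> algebra_simps)
  show "p * \<bar>rescaled \<beta> v R x\<bar> powr (p - 1) * g x \<le> - laplacian f x" if "x \<in> V" for x
  proof -
    have "p * \<bar>rescaled \<beta> v R x\<bar> powr (p - 1) * g x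
        = R\<^sup>2 * (p * \<bar>v (R *\<^sub>R x)\<bar> powr (p - 1) * \<psi> (R *\<^sub>R x))"
      unfolding rescaled_def rescaled_powr[OF \<open>0 < R\<close>] g_def e R2
      using \<open>0 < R\<close> by (simp add: powr_add powr_minus field_simps)
    also have "\<dots> \<le> R\<^sup>2 * (- laplacian \<phi> (R *\<^sub>R x))"
      using lap\<phi>[OF inV[OF that]] by (rule mult_left_mono) simp
    also have "\<dots> = - laplacian f x"
      using C2_dilation(2)[OF C2(1) U V inV that, of 1] by (simp add: f_def)
    finally show ?thesis .
  qed
  show "q * \<bar>rescaled \<alpha> u R x\<bar> powr (q - 1) * f x \<le> - laplacian g x" if "x \<in> V" for x
  proof -
    have "q * \<bar>rescaled \<alpha> u R x\<bar> powr (q - 1) * f x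
        = R powr (- \<gamma>) * R\<^sup>2 * (q * \<bar>u (R *\<^sub>R x)\<bar> powr (q - 1) * \<phi> (R *\<^sub>R x))"
      unfolding rescaled_def rescaled_powr[OF \<open>0 < R\<close>] f_def e R2
      using \<open>0 < R\<close> by (simp add: powr_diff powr_minus field_simps)
    also have "\<dots> \<le> R powr (- \<gamma>) * R\<^sup>2 * (- laplacian \<psi> (R *\<^sub>R x))"
      using lap\<psi>[OF inV[OF that]] by (rule mult_left_mono) simp
    also have "\<dots> = - laplacian g x"
      using C2_dilation(2)[OF C2(2) U V inV that, of "R powr (- \<gamma>)"] by (simp add: g_def)
    finally show ?thesis .
  qed
  show "x \<bullet> ((1 / f x) *\<^sub>R grad f x - (1 / g x) *\<^sub>R grad g x)
      = (R *\<^sub>R x) \<bullet> ((1 / \<phi> (R *\<^sub>R x)) *\<^sub>R grad \<phi> (R *\<^sub>R x) - (1 / \<psi> (R *\<^sub>R x)) *\<^sub>R grad \<psi> (R *\<^sub>R x))"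
    if "x \<in> V" for x
  proof -
    have "grad f x = R *\<^sub>R grad \<phi> (R *\<^sub>R x)" "grad g x = (R powr (- \<gamma>) * R) *\<^sub>R grad \<psi> (R *\<^sub>R x)"
      unfolding f_def g_def using grad_dilation[OF Ck_on_2D(1)[OF \<phi>(1) inV[OF that]], of 1]
        grad_dilation[OF Ck_on_2D(1)[OF \<psi>(1) inV[OF that]]] by simp_all
    then show ?thesis
      unfolding f_def g_def using \<open>0 < R\<close> by (simp add: inner_diff_right field_simps)
  qed
qed

text \<open>At the upper end of the window the second inequality, with \<open>u\<close> bounded away
  from degeneracy by \<open>mu\<close>, bounds ln (f/g) from above; at the lower end the first
  inequality, with \<open>v\<close> and \<open>mv\<close>, bounds it from below. The increment of
  \<open>H\<close> is thus bounded independently of the length \<open>T\<close>, so the error at the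
  selected scale is of order 1/T.\<close>

lemma stability_at_scale:
  fixes u v \<phi> \<psi> \<zeta> :: "'a::euclidean_space \<Rightarrow> real"
  assumes K: "closed K" and C2: "Ck_on 2 (- K) \<phi>" "Ck_on 2 (- K) \<psi>"
    and pos0: "\<forall>x\<in>- K. \<phi> x > 0 \<and> \<psi> x > 0"
    and lap0: "\<forall>x\<in>- K. - laplacian \<phi> x \<ge> p * \<bar>v x\<bar> powr (p - 1) * \<psi> x"
      "\<forall>x\<in>- K. - laplacian \<psi> x \<ge> q * \<bar>u x\<bar> powr (q - 1) * \<phi> x"
    and uv: "continuous_on UNIV u" "continuous_on UNIV v" and pos: "\<And>x. 0 < u x" "\<And>x. 0 < v x"
    and \<zeta>: "Ck_on 1 UNIV \<zeta>" and C: "compact C" and \<zeta>0: "\<And>x. x \<notin> C \<Longrightarrow> \<zeta> x = 0"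
    and "0 < r" and r: "\<And>x. x \<in> C \<Longrightarrow> r \<le> norm x"
    and "0 < T" and outside: "\<And>t y. t0 - 1 \<le> t \<Longrightarrow> t \<le> t0 + T + 1 \<Longrightarrow> y \<in> C \<Longrightarrow> exp t *\<^sub>R y \<notin> K"
    and m: "0 < mu" "0 < mv" "\<And>x. x \<in> C \<Longrightarrow> mu \<le> rescaled \<alpha> u (exp (t0 + T)) x powr (q - 1)"
      "\<And>x. x \<in> C \<Longrightarrow> mv \<le> rescaled \<beta> v (exp t0) x powr (p - 1)"
  defines "B \<equiv> LINT x|lborel. (norm (grad \<zeta> x))\<^sup>2"
  obtains t where "t0 < t" "t < t0 + T"
    "sqrt (p * q) * (LINT x|lborel. (\<zeta> x)\<^sup>2 *
        (rescaled \<alpha> u (exp t) x powr ((q - 1) / 2) * rescaled \<beta> v (exp t) x powr ((p - 1) / 2)))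
      \<le> B - \<gamma>\<^sup>2 / 4 * (LINT x|lborel. (\<zeta> x)\<^sup>2 / (norm x)\<^sup>2)
        + \<gamma> / 2 * (B / (r\<^sup>2 * (q * mu)) + B / (r\<^sup>2 * (p * mv))) / T"
proof -
  note sr = stability_rescaled[OF K C2 pos0 lap0]
  have \<zeta>C: "continuous_on C \<zeta>" using Ck_on_1D(2)[OF \<zeta>] continuous_on_subset by blast
  have "0 \<notin> C" using r \<open>0 < r\<close> by force
  have CV: "C \<subseteq> {x. exp t *\<^sub>R x \<in> - K}" if "t0 - 1 \<le> t" "t \<le> t0 + T + 1" for t
    using outside[OF that] by auto
  have in\<phi>: "0 < \<phi> (exp t *\<^sub>R y)" "0 < \<psi> (exp t *\<^sub>R y)" if "t0 - 1 \<le> t" "t \<le> t0 + T + 1" "y \<in> C" for t y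
    using outside[OF that] pos0 by auto
  define H where "H t = (LINT y|lborel. (\<zeta> y)\<^sup>2 / (norm y)\<^sup>2 *
     (ln (\<phi> (exp t *\<^sub>R y)) - ln (\<psi> (exp t *\<^sub>R y)) + \<gamma> * t))" for t
  define f where "f t = (\<lambda>x. 1 * \<phi> (exp t *\<^sub>R x))" for t
  define g where "g t = (\<lambda>x. exp t powr (- \<gamma>) * \<psi> (exp t *\<^sub>R x))" for t
  \<comment> \<open>The factor R powr (-\<gamma>) with R = exp t is the origin of the term \<gamma>
    t: \<open>H t\<close> is the weighted mean of ln (f/g) for the pair rescaled by exp t.\<close>
  have lnfg: "ln (f t y) - ln (g t y) = ln (\<phi> (exp t *\<^sub>R y)) - ln (\<psi> (exp t *\<^sub>R y)) + \<gamma> * t"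
    if "t0 - 1 \<le> t" "t \<le> t0 + T + 1" "y \<in> C" for t y
    using in\<phi>[OF that] by (simp add: f_def g_def ln_mult ln_powr)
  have H: "H t = (LINT y|lborel. (\<zeta> y)\<^sup>2 / (norm y)\<^sup>2 * (ln (f t y) - ln (g t y)))"
    if "t0 - 1 \<le> t" "t \<le> t0 + T + 1" for t
    unfolding H_def
  proof (rule Bochner_Integration.integral_cong[OF refl])
    show "(\<zeta> y)\<^sup>2 / (norm y)\<^sup>2 * (ln (\<phi> (exp t *\<^sub>R y)) - ln (\<psi> (exp t *\<^sub>R y)) + \<gamma> * t)
      = (\<zeta> y)\<^sup>2 / (norm y)\<^sup>2 * (ln (f t y) - ln (g t y))" for y
      using lnfg[OF that, of y] \<zeta>0[of y] by (cases "y \<in> C") auto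
  qed
  have posR: "0 < rescaled \<alpha> u (exp t) x" "0 < rescaled \<beta> v (exp t) x" for t x
    using pos by (auto simp: rescaled_def)
  have tT: "t0 - 1 \<le> t0 + T" "t0 + T \<le> t0 + T + 1" "t0 - 1 \<le> t0" "t0 \<le> t0 + T + 1"
    using \<open>0 < T\<close> by auto
  have "H (t0 + T) \<le> B / (r\<^sup>2 * (q * mu))"
    unfolding H[OF tT(1,2)] B_def f_def g_def
  proof (rule log_ratio_bound[OF sr(1,2,4,3,5)[OF exp_gt_zero] \<zeta> C CV[OF tT(1,2)] \<zeta>0 \<open>0 < r\<close> r])
    show "0 < q * mu" using pq m by simp
    fix x assume x: "x \<in> C"
    then have xV: "x \<in> {x. exp (t0 + T) *\<^sub>R x \<in> - K}" using CV[OF tT(1,2)] by blast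
    have "q * mu * (1 * \<phi> (exp (t0 + T) *\<^sub>R x))
        \<le> q * \<bar>rescaled \<alpha> u (exp (t0 + T)) x\<bar> powr (q - 1) * (1 * \<phi> (exp (t0 + T) *\<^sub>R x))"
      using m(3)[OF x] pq in\<phi>[OF tT(1,2) x] posR(1)[of "t0 + T" x] by (intro mult_right_mono mult_left_mono) auto
    also have "\<dots> \<le> - laplacian (\<lambda>x. exp (t0 + T) powr - \<gamma> * \<psi> (exp (t0 + T) *\<^sub>R x)) x"
      by (rule sr(7)[OF exp_gt_zero xV])
    finally show "q * mu * (1 * \<phi> (exp (t0 + T) *\<^sub>R x))
        \<le> - laplacian (\<lambda>x. exp (t0 + T) powr - \<gamma> * \<psi> (exp (t0 + T) *\<^sub>R x)) x" .
  qed
  moreover have "- H t0 \<le> B / (r\<^sup>2 * (p * mv))"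
  proof -
    have "- H t0 = (LINT y|lborel. (\<zeta> y)\<^sup>2 / (norm y)\<^sup>2 * (ln (g t0 y) - ln (f t0 y)))"
      unfolding H[OF tT(3,4)] Bochner_Integration.integral_minus[symmetric]
      by (rule Bochner_Integration.integral_cong[OF refl]) (metis minus_diff_eq mult_minus_right)
    also have "\<dots> \<le> B / (r\<^sup>2 * (p * mv))"
      unfolding B_def f_def g_def
    proof (rule log_ratio_bound[OF sr(1,3,5,2,4)[OF exp_gt_zero] \<zeta> C CV[OF tT(3,4)] \<zeta>0 \<open>0 < r\<close> r])
      show "0 < p * mv" using exponent_facts(1) m by simp
      fix x assume x: "x \<in> C"
      then have xV: "x \<in> {x. exp t0 *\<^sub>R x \<in> - K}" using CV[OF tT(3,4)] by blast
      have "p * mv * (exp t0 powr - \<gamma> * \<psi> (exp t0 *\<^sub>R x))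
          \<le> p * \<bar>rescaled \<beta> v (exp t0) x\<bar> powr (p - 1) * (exp t0 powr - \<gamma> * \<psi> (exp t0 *\<^sub>R x))"
        using m(4)[OF x] exponent_facts(1) in\<phi>[OF tT(3,4) x] posR(2)[of t0 x]
        by (intro mult_right_mono mult_left_mono) auto
      also have "\<dots> \<le> - laplacian (\<lambda>x. 1 * \<phi> (exp t0 *\<^sub>R x)) x"
        by (rule sr(6)[OF exp_gt_zero xV])
      finally show "p * mv * (exp t0 powr - \<gamma> * \<psi> (exp t0 *\<^sub>R x)) \<le> - laplacian (\<lambda>x. 1 * \<phi> (exp t0 *\<^sub>R x)) x" .
    qed
    finally show ?thesis .
  qed
  ultimately have HH: "H (t0 + T) - H t0 \<le> B / (r\<^sup>2 * (q * mu)) + B / (r\<^sup>2 * (p * mv))"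
    by linarith
  have inK: "exp t *\<^sub>R y \<in> - K" if "t0 - 1 \<le> t" "t \<le> t0 + T + 1" "y \<in> C" for t y
    using outside[OF that] by simp
  have oK: "open (- K)" using K by (simp add: open_Compl)
  obtain t where t: "t0 < t" "t < t0 + T" and J: "T * (LINT y|lborel. (\<zeta> y)\<^sup>2 / (norm y)\<^sup>2 *
     ((exp t *\<^sub>R y) \<bullet> ((1 / \<phi> (exp t *\<^sub>R y)) *\<^sub>R grad \<phi> (exp t *\<^sub>R y)
        - (1 / \<psi> (exp t *\<^sub>R y)) *\<^sub>R grad \<psi> (exp t *\<^sub>R y)) + \<gamma>)) = H (t0 + T) - H t0"
    using log_ratio_mean_value[OF oK C2(1) _ C2(2) _ \<zeta>C C \<open>0 \<notin> C\<close> \<zeta>0 \<open>0 < T\<close> inK, of t0 \<gamma>] pos0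
    unfolding H_def[symmetric] by blast
  have tt: "t0 - 1 \<le> t" "t \<le> t0 + T + 1" using t by auto
  define J where "J = (LINT y|lborel. (\<zeta> y)\<^sup>2 / (norm y)\<^sup>2 *
     (y \<bullet> ((1 / f t y) *\<^sub>R grad (f t) y - (1 / g t y) *\<^sub>R grad (g t) y) + \<gamma>))"
  have "J = (LINT y|lborel. (\<zeta> y)\<^sup>2 / (norm y)\<^sup>2 *
     ((exp t *\<^sub>R y) \<bullet> ((1 / \<phi> (exp t *\<^sub>R y)) *\<^sub>R grad \<phi> (exp t *\<^sub>R y)
        - (1 / \<psi> (exp t *\<^sub>R y)) *\<^sub>R grad \<psi> (exp t *\<^sub>R y)) + \<gamma>))"
    unfolding J_def
  proof (rule Bochner_Integration.integral_cong[OF refl])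
    fix y :: 'a
    show "(\<zeta> y)\<^sup>2 / (norm y)\<^sup>2 * (y \<bullet> ((1 / f t y) *\<^sub>R grad (f t) y - (1 / g t y) *\<^sub>R grad (g t) y) + \<gamma>)
      = (\<zeta> y)\<^sup>2 / (norm y)\<^sup>2 * ((exp t *\<^sub>R y) \<bullet> ((1 / \<phi> (exp t *\<^sub>R y)) *\<^sub>R grad \<phi> (exp t *\<^sub>R y)
        - (1 / \<psi> (exp t *\<^sub>R y)) *\<^sub>R grad \<psi> (exp t *\<^sub>R y)) + \<gamma>)"
    proof (cases "y \<in> C")
      case True
      then have "y \<in> {x. exp t *\<^sub>R x \<in> - K}" using CV[OF tt] by blast
      from sr(8)[OF exp_gt_zero this] show ?thesis
        unfolding f_def g_def by simp
    qed (simp add: \<zeta>0)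
  qed
  then have TJ: "T * J = H (t0 + T) - H t0" using J by simp
  define a where "a x = p * rescaled \<beta> v (exp t) x powr (p - 1)" for x
  define b where "b x = q * rescaled \<alpha> u (exp t) x powr (q - 1)" for x
  have contR: "continuous_on C (rescaled \<alpha> u (exp t))" "continuous_on C (rescaled \<beta> v (exp t))"
    unfolding rescaled_def[abs_def]
    by (intro continuous_intros continuous_on_compose2[OF uv(1)] continuous_on_compose2[OF uv(2)]; simp)+
  have contab: "continuous_on C a" "continuous_on C b"
    unfolding a_def b_def using posR[of t] less_imp_neq[OF posR(1)] less_imp_neq[OF posR(2)]
    by (intro continuous_intros contR; force)+
  have ab0: "0 \<le> a x" "0 \<le> b x" for x
    using exponent_facts(1) pq by (simp_all add: a_def b_def)
  have la: "a x * g t x \<le> - laplacian (f t) x" "b x * f t x \<le> - laplacian (g t) x" if "x \<in> C" for x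
  proof -
    have xV: "x \<in> {x. exp t *\<^sub>R x \<in> - K}" using CV[OF tt] that by blast
    show "a x * g t x \<le> - laplacian (f t) x" "b x * f t x \<le> - laplacian (g t) x"
      using sr(6,7)[OF exp_gt_zero xV] posR[of t x] unfolding a_def b_def f_def g_def by simp_all
  qed
  have "(LINT x|lborel. (\<zeta> x)\<^sup>2 * sqrt (a x * b x)) \<le> B
     - \<gamma>\<^sup>2 / 4 * (LINT x|lborel. (\<zeta> x)\<^sup>2 / (norm x)\<^sup>2) + \<gamma> / 2 * J"
    unfolding B_def J_def
    by (rule stability_single_scale[OF _ _ _ _ _ \<zeta> C CV[OF tt] \<open>0 \<notin> C\<close> \<zeta>0 contab ab0 la exponent_facts(6)])
      (use sr(1-5)[OF exp_gt_zero] in \<open>auto simp: f_def g_def\<close>)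
  moreover have "\<gamma> / 2 * J \<le> \<gamma> / 2 * (B / (r\<^sup>2 * (q * mu)) + B / (r\<^sup>2 * (p * mv))) / T"
  proof -
    have "J \<le> (B / (r\<^sup>2 * (q * mu)) + B / (r\<^sup>2 * (p * mv))) / T"
      using TJ HH \<open>0 < T\<close> by (simp add: pos_le_divide_eq mult.commute)
    then have "\<gamma> / 2 * J \<le> \<gamma> / 2 * ((B / (r\<^sup>2 * (q * mu)) + B / (r\<^sup>2 * (p * mv))) / T)"
      by (rule mult_left_mono) (use exponent_facts(6) in simp)
    then show ?thesis by (simp only: times_divide_eq_right)
  qed
  moreover have "(LINT x|lborel. (\<zeta> x)\<^sup>2 * sqrt (a x * b x)) = sqrt (p * q) * (LINT x|lborel. (\<zeta> x)\<^sup>2 *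
        (rescaled \<alpha> u (exp t) x powr ((q - 1) / 2) * rescaled \<beta> v (exp t) x powr ((p - 1) / 2)))"
    unfolding Bochner_Integration.integral_mult_right_zero[symmetric]
    by (rule Bochner_Integration.integral_cong)
      (auto simp: a_def b_def real_sqrt_mult sqrt_powr less_imp_le[OF posR(1)] less_imp_le[OF posR(2)])
  ultimately show thesis
    by (intro that[OF t]) linarith
qed


text \<open>For each \<open>n\<close> the window has length \<open>n + 1\<close>. The cluster point
  property supplies its left end, and the selected scale lies somewhere inside, in general not among
  the scales given by that property. It is close to the limit all the same, so dominated convergence
  along the selected scales produces the limit pair, while the error, \<open>D\<close> over the
  window length, disappears.\<close>

lemma positive_limit_inequality:
  fixes u v \<phi> \<psi> \<zeta> U W :: "'a::euclidean_space \<Rightarrow> real"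
  assumes uv: "continuous_on UNIV u" "continuous_on UNIV v" and pos: "\<And>x. 0 < u x" "\<And>x. 0 < v x"
    and stable: "stable_outside_compact p q u v"
    and lim: "blow_down_limit \<alpha> \<beta> u v U W"
    and U: "continuous_on (- {0}) U" "\<And>x. x \<noteq> 0 \<Longrightarrow> 0 < U x"
      "\<And>r x. 0 < r \<Longrightarrow> x \<noteq> 0 \<Longrightarrow> U (r *\<^sub>R x) = r powr (- \<alpha>) * U x"
    and W: "continuous_on (- {0}) W" "\<And>x. x \<noteq> 0 \<Longrightarrow> 0 < W x"
      "\<And>r x. 0 < r \<Longrightarrow> x \<noteq> 0 \<Longrightarrow> W (r *\<^sub>R x) = r powr (- \<beta>) * W x"
    and \<zeta>: "Ck_on 1 UNIV \<zeta>" and C: "compact C" "0 \<notin> C" and \<zeta>0: "\<And>x. x \<notin> C \<Longrightarrow> \<zeta> x = 0"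
  shows "sqrt (p * q) * (LINT x|lborel. (\<zeta> x)\<^sup>2 * (U x powr ((q - 1) / 2) * W x powr ((p - 1) / 2)))
    \<le> (LINT x|lborel. (norm (grad \<zeta> x))\<^sup>2) - \<gamma>\<^sup>2 / 4 * (LINT x|lborel. (\<zeta> x)\<^sup>2 / (norm x)\<^sup>2)"
proof -
  obtain K \<phi> \<psi> where K: "compact K" and C2: "Ck_on 2 (- K) \<phi>" "Ck_on 2 (- K) \<psi>"
    and pos0: "\<forall>x\<in>- K. \<phi> x > 0 \<and> \<psi> x > 0"
    and lap0: "\<forall>x\<in>- K. - laplacian \<phi> x \<ge> p * \<bar>v x\<bar> powr (p - 1) * \<psi> x"
      "\<forall>x\<in>- K. - laplacian \<psi> x \<ge> q * \<bar>u x\<bar> powr (q - 1) * \<phi> x"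
    using stable unfolding stable_outside_compact_def by blast
  have \<zeta>C: "continuous_on C \<zeta>" using Ck_on_1D(2)[OF \<zeta>] continuous_on_subset by blast
  have CC: "C \<subseteq> - {0}" using C(2) by auto
  obtain r where r: "0 < r" "\<And>x. x \<in> C \<Longrightarrow> r \<le> norm x"
    using separate_point_closed[OF compact_imp_closed[OF C(1)] C(2)] by auto
  obtain b where b: "0 < b" "\<And>x. x \<in> K \<Longrightarrow> norm x \<le> b"
    using compact_imp_bounded[OF K] unfolding bounded_pos by blast
  obtain lU hU where lU: "0 < lU" "\<And>x. x \<in> C \<Longrightarrow> lU \<le> U x" "\<And>x. x \<in> C \<Longrightarrow> U x \<le> hU"
    using compact_pos_bounds[OF C(1) continuous_on_subset[OF U(1) CC]] U(2) CC by blast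
  obtain lW hW where lW: "0 < lW" "\<And>x. x \<in> C \<Longrightarrow> lW \<le> W x" "\<And>x. x \<in> C \<Longrightarrow> W x \<le> hW"
    using compact_pos_bounds[OF C(1) continuous_on_subset[OF W(1) CC]] W(2) CC by blast
  \<comment> \<open>Half of the common lower bound: an error below \<open>l\<close> keeps the
    rescaled values above \<open>l\<close>. The 1 in \<open>h\<close> leaves room for an error below
    1 on the other side.\<close>
  define l h where "l = min lU lW / 2" and "h = \<bar>hU\<bar> + \<bar>hW\<bar> + 1"
  have "0 < l" using lU lW by (simp add: l_def)
  have "0 < h" by (simp add: h_def)
  define mu mv where "mu = min (l powr (q - 1)) (h powr (q - 1))"
    and "mv = min (l powr (p - 1)) (h powr (p - 1))"
  define B where "B = (LINT x|lborel. (norm (grad \<zeta> x))\<^sup>2)"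
  define J where "J = (LINT x|lborel. (\<zeta> x)\<^sup>2 / (norm x)\<^sup>2)"
  define D where "D = \<gamma> / 2 * (B / (r\<^sup>2 * (q * mu)) + B / (r\<^sup>2 * (p * mv)))"
  define w where "w f g x = f x powr ((q - 1) / 2) * g x powr ((p - 1) / 2)"
    for f g :: "'a \<Rightarrow> real" and x
  have range: "l \<le> t \<and> t \<le> h" if "\<bar>t - U x\<bar> < l \<and> \<bar>t - U x\<bar> < 1 \<or> \<bar>t - W x\<bar> < l \<and> \<bar>t - W x\<bar> < 1" "x \<in> C" for t x
    using that(1) lU(2,3)[OF that(2)] lW(2,3)[OF that(2)] unfolding l_def h_def by linarith
  have main: "\<exists>R>0. (\<forall>x\<in>C. \<bar>rescaled \<alpha> u R x - U x\<bar> < inverse (real (Suc n)) \<and> \<bar>rescaled \<alpha> u R x - U x\<bar> < l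
      \<and> \<bar>rescaled \<beta> v R x - W x\<bar> < inverse (real (Suc n)) \<and> \<bar>rescaled \<beta> v R x - W x\<bar> < l)
      \<and> sqrt (p * q) * (LINT x|lborel. (\<zeta> x)\<^sup>2 * w (rescaled \<alpha> u R) (rescaled \<beta> v R) x)
       \<le> B - \<gamma>\<^sup>2 / 4 * J + D * inverse (real (Suc n))" for n
  proof -
    define T where "T = real (Suc n)"
    have "0 < T" by (simp add: T_def)
    define \<delta> where "\<delta> = min l (inverse T)"
    have "0 < \<delta>" "\<delta> \<le> l" "\<delta> \<le> inverse T" "\<delta> \<le> 1"
      using \<open>0 < l\<close> by (auto simp: \<delta>_def T_def min_le_iff_disj inverse_le_1_iff)
    \<comment> \<open>Between the left end and a scale of the window, the rescaled function and the
      limit acquire the same factor exp (a (t - t0)), with a equal to \<alpha> or \<beta>. As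
      \<beta> \<le> \<alpha>, the error grows at most by exp (\<alpha> T), which is compensated here
      in advance.\<close>
    define \<epsilon> where "\<epsilon> = \<delta> * exp (- (\<alpha> * T))"
    have "0 < \<epsilon>" using \<open>0 < \<delta>\<close> by (simp add: \<epsilon>_def)
    define S where "S = (\<lambda>z. exp (fst z) *\<^sub>R snd z) ` ({0..T} \<times> C)"
    have "compact S"
      unfolding S_def by (intro compact_continuous_image compact_Times C continuous_intros) auto
    moreover have "0 \<notin> S" using C(2) by (auto simp: S_def)
    ultimately have "\<exists>\<^sub>F R in at_top. \<forall>x\<in>S.
        \<bar>rescaled \<alpha> u R x - U x\<bar> < \<epsilon> \<and> \<bar>rescaled \<beta> v R x - W x\<bar> < \<epsilon>"
      using lim \<open>0 < \<epsilon>\<close> unfolding blow_down_limit_def by blast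
    \<comment> \<open>The threshold makes exp (t0 - 1) r at least b + 1, so that every dilate of
      \<open>C\<close> in the enlarged window lies outside \<open>K\<close>.\<close>
    then have "\<exists>\<^sub>F R in at_top. (\<forall>x\<in>S.
        \<bar>rescaled \<alpha> u R x - U x\<bar> < \<epsilon> \<and> \<bar>rescaled \<beta> v R x - W x\<bar> < \<epsilon>) \<and> exp 1 * (b + 1) / r \<le> R"
      by (rule frequently_eventually_frequently) (rule eventually_ge_at_top)
    then obtain R0 where R0: "\<And>x. x \<in> S \<Longrightarrow> \<bar>rescaled \<alpha> u R0 x - U x\<bar> < \<epsilon>"
      "\<And>x. x \<in> S \<Longrightarrow> \<bar>rescaled \<beta> v R0 x - W x\<bar> < \<epsilon>" "exp 1 * (b + 1) / r \<le> R0"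
      by (blast dest: frequently_ex)
    have "0 < exp 1 * (b + 1) / r" using b r by simp
    then have "0 < R0" using R0(3) by linarith
    define t0 where "t0 = ln R0"
    have et0: "exp t0 = R0" using \<open>0 < R0\<close> by (simp add: t0_def)
    have close: "\<bar>rescaled a f (exp t) x - F x\<bar> < \<delta>"
      if t: "t0 \<le> t" "t \<le> t0 + T" and x: "x \<in> C" and a: "0 < a" "a \<le> \<alpha>"
        and f: "\<And>x. x \<in> S \<Longrightarrow> \<bar>rescaled a f R0 x - F x\<bar> < \<epsilon>"
        and F: "\<And>r x. 0 < r \<Longrightarrow> x \<noteq> 0 \<Longrightarrow> F (r *\<^sub>R x) = r powr (- a) * F x"
      for a t x and f F :: "'a \<Rightarrow> real"
    proof -
      define y where "y = exp (t - t0) *\<^sub>R x"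
      have "x \<noteq> 0" using x C(2) by auto
      have "y \<in> S" unfolding S_def y_def using t x by (auto intro!: image_eqI[where x = "(t - t0, x)"])
      have R: "exp t = exp (t - t0) * R0" using et0 \<open>0 < R0\<close> by (simp add: exp_diff)
      have "F x = exp (a * (t - t0)) * F y"
        unfolding y_def using F[OF exp_gt_zero \<open>x \<noteq> 0\<close>, of "t - t0"]
        by (simp add: powr_def mult_exp_exp[symmetric] exp_minus)
      moreover have "rescaled a f (exp t) x = exp (a * (t - t0)) * rescaled a f R0 y"
        unfolding rescaled_def y_def R using \<open>0 < R0\<close> by (simp add: powr_mult powr_def[of "exp _"] mult_ac)
      ultimately have "\<bar>rescaled a f (exp t) x - F x\<bar> = exp (a * (t - t0)) * \<bar>rescaled a f R0 y - F y\<bar>"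
        by (simp add: right_diff_distrib[symmetric] abs_mult)
      also have "\<dots> < exp (a * (t - t0)) * \<epsilon>"
        using f[OF \<open>y \<in> S\<close>] by simp
      also have "\<dots> \<le> exp (\<alpha> * T) * \<epsilon>"
        using t a \<open>0 < \<epsilon>\<close> by (auto intro!: mult_mono)
      also have "\<dots> = \<delta>" by (simp add: \<epsilon>_def exp_minus)
      finally show ?thesis .
    qed
    have ab: "0 < \<alpha>" "\<alpha> \<le> \<alpha>" "0 < \<beta>" "\<beta> \<le> \<alpha>"
      using exponent_facts(2,3,6) \<gamma> by auto
    have closeU: "\<bar>rescaled \<alpha> u (exp t) x - U x\<bar> < \<delta>"
      and closeW: "\<bar>rescaled \<beta> v (exp t) x - W x\<bar> < \<delta>" if "t0 \<le> t" "t \<le> t0 + T" "x \<in> C" for t x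
      using close[OF that ab(1,2) R0(1) U(3)] close[OF that ab(3,4) R0(2) W(3)] by auto
    have outside: "exp t *\<^sub>R y \<notin> K" if "t0 - 1 \<le> t" "t \<le> t0 + T + 1" "y \<in> C" for t y
    proof
      assume "exp t *\<^sub>R y \<in> K"
      then have "exp t * norm y \<le> b" using b(2) by force
      moreover have "exp (t0 - 1) * r \<le> exp t * norm y"
        using that r by (intro mult_mono) auto
      moreover have "b + 1 \<le> exp (t0 - 1) * r"
        using R0(3) r(1) by (simp add: exp_diff et0 field_simps)
      ultimately show False by linarith
    qed
    have mm: "0 < mu" "0 < mv"
      using \<open>0 < l\<close> \<open>0 < h\<close> unfolding mu_def mv_def by auto
    have mu: "mu \<le> rescaled \<alpha> u (exp (t0 + T)) x powr (q - 1)" if "x \<in> C" for x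
      unfolding mu_def using closeU[of "t0 + T" x] range[of _ x] that \<open>0 < T\<close> \<open>\<delta> \<le> l\<close> \<open>\<delta> \<le> 1\<close> \<open>0 < l\<close>
      by (intro powr_between) (force dest: less_le_trans)+
    have mv: "mv \<le> rescaled \<beta> v (exp t0) x powr (p - 1)" if "x \<in> C" for x
      unfolding mv_def using closeW[of "t0" x] range[of _ x] that \<open>0 < T\<close> \<open>\<delta> \<le> l\<close> \<open>\<delta> \<le> 1\<close> \<open>0 < l\<close>
      by (intro powr_between) (force dest: less_le_trans)+
    obtain t where t: "t0 < t" "t < t0 + T" "sqrt (p * q) * (LINT x|lborel. (\<zeta> x)\<^sup>2 *
        (rescaled \<alpha> u (exp t) x powr ((q - 1) / 2) * rescaled \<beta> v (exp t) x powr ((p - 1) / 2)))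
      \<le> B - \<gamma>\<^sup>2 / 4 * J + \<gamma> / 2 * (B / (r\<^sup>2 * (q * mu)) + B / (r\<^sup>2 * (p * mv))) / T"
      unfolding B_def J_def
      by (rule stability_at_scale[OF compact_imp_closed[OF K] C2 pos0 lap0 uv pos \<zeta> C(1) \<zeta>0 r \<open>0 < T\<close>
            outside mm mu mv])
    then have "sqrt (p * q) * (LINT x|lborel. (\<zeta> x)\<^sup>2 * w (rescaled \<alpha> u (exp t)) (rescaled \<beta> v (exp t)) x)
       \<le> B - \<gamma>\<^sup>2 / 4 * J + D * inverse (real (Suc n))"
      unfolding w_def D_def T_def divide_inverse[symmetric] by blast
    moreover have "\<bar>rescaled \<alpha> u (exp t) x - U x\<bar> < inverse (real (Suc n))"
      "\<bar>rescaled \<alpha> u (exp t) x - U x\<bar> < l" "\<bar>rescaled \<beta> v (exp t) x - W x\<bar> < inverse (real (Suc n))"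
      "\<bar>rescaled \<beta> v (exp t) x - W x\<bar> < l" if "x \<in> C" for x
      using closeU[of t x] closeW[of t x] t(1,2) that \<open>\<delta> \<le> l\<close> \<open>\<delta> \<le> inverse T\<close> unfolding T_def by auto
    ultimately show ?thesis
      by (intro exI[of _ "exp t"]) simp
  qed
  have "\<exists>R. \<forall>n. 0 < R n \<and> (\<forall>x\<in>C. \<bar>rescaled \<alpha> u (R n) x - U x\<bar> < inverse (real (Suc n))
      \<and> \<bar>rescaled \<alpha> u (R n) x - U x\<bar> < l
      \<and> \<bar>rescaled \<beta> v (R n) x - W x\<bar> < inverse (real (Suc n)) \<and> \<bar>rescaled \<beta> v (R n) x - W x\<bar> < l)
      \<and> sqrt (p * q) * (LINT x|lborel. (\<zeta> x)\<^sup>2 * w (rescaled \<alpha> u (R n)) (rescaled \<beta> v (R n)) x)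
       \<le> B - \<gamma>\<^sup>2 / 4 * J + D * inverse (real (Suc n))"
    by (rule choice) (use main in simp)
  then obtain R where R: "\<And>n. 0 < R n"
    "\<And>n x. x \<in> C \<Longrightarrow> \<bar>rescaled \<alpha> u (R n) x - U x\<bar> < inverse (real (Suc n))"
    "\<And>n x. x \<in> C \<Longrightarrow> \<bar>rescaled \<alpha> u (R n) x - U x\<bar> < l"
    "\<And>n x. x \<in> C \<Longrightarrow> \<bar>rescaled \<beta> v (R n) x - W x\<bar> < inverse (real (Suc n))"
    "\<And>n x. x \<in> C \<Longrightarrow> \<bar>rescaled \<beta> v (R n) x - W x\<bar> < l"
    "\<And>n. sqrt (p * q) * (LINT x|lborel. (\<zeta> x)\<^sup>2 * w (rescaled \<alpha> u (R n)) (rescaled \<beta> v (R n)) x)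
       \<le> B - \<gamma>\<^sup>2 / 4 * J + D * inverse (real (Suc n))"
    by blast
  define s where "s n x = (\<zeta> x)\<^sup>2 * w (rescaled \<alpha> u (R n)) (rescaled \<beta> v (R n)) x" for n x
  have le1: "inverse (real (Suc n)) \<le> 1" for n
    by (simp add: inverse_le_1_iff)
  have posR: "0 < rescaled \<alpha> u (R n) x" "0 < rescaled \<beta> v (R n) x" for n x
    using pos R(1)[of n] by (auto simp: rescaled_def intro!: mult_pos_pos)
  have contR: "continuous_on C (rescaled \<alpha> u (R n))" "continuous_on C (rescaled \<beta> v (R n))" for n
    unfolding rescaled_def[abs_def]
    by (intro continuous_intros continuous_on_compose2[OF uv(1)] continuous_on_compose2[OF uv(2)]; simp)+
  have ints: "integrable lborel (s n)" for n
    unfolding s_def[abs_def] w_def using posR less_imp_neq[OF posR(1)] less_imp_neq[OF posR(2)]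
    by (intro integrable_compact_support_mult[OF C(1)] continuous_intros \<zeta>C contR) (auto simp: \<zeta>0)
  have UW0: "U x \<noteq> 0" "W x \<noteq> 0" if "x \<in> C" for x
    using U(2)[of x] W(2)[of x] C(2) that by (metis less_irrefl)+
  have intf: "integrable lborel (\<lambda>x. (\<zeta> x)\<^sup>2 * w U W x)"
    unfolding w_def
    by (intro integrable_compact_support_mult[OF C(1)] continuous_intros \<zeta>C continuous_on_subset[OF U(1) CC]
        continuous_on_subset[OF W(1) CC]) (auto simp: \<zeta>0 UW0)
  \<comment> \<open>On \<open>C\<close> all rescaled values lie between \<open>l\<close> and
    \<open>h\<close>, so \<open>Q\<close> dominates the weights for every \<open>n\<close>, negative
    exponents included, because \<open>l\<close> > 0.\<close>
  define Q where "Q = max (l powr ((q - 1) / 2)) (h powr ((q - 1) / 2)) * max (l powr ((p - 1) / 2)) (h powr ((p - 1) / 2))"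
  have int\<zeta>: "integrable lborel (\<lambda>x. (\<zeta> x)\<^sup>2 * Q)"
    by (intro integrable_compact_support_mult[OF C(1)] continuous_intros \<zeta>C) (auto simp: \<zeta>0)
  have bound: "norm (s n x) \<le> (\<zeta> x)\<^sup>2 * Q" for n x
  proof (cases "x \<in> C")
    case True
    have ru: "l \<le> rescaled \<alpha> u (R n) x \<and> rescaled \<alpha> u (R n) x \<le> h"
      by (rule range[OF _ True]) (use R(2,3)[OF True, of n] le1[of n] in auto)
    have rv: "l \<le> rescaled \<beta> v (R n) x \<and> rescaled \<beta> v (R n) x \<le> h"
      by (rule range[OF _ True]) (use R(4,5)[OF True, of n] le1[of n] in auto)
    have "w (rescaled \<alpha> u (R n)) (rescaled \<beta> v (R n)) x \<le> Q"
      unfolding w_def Q_def using ru rv \<open>0 < l\<close> by (intro mult_mono powr_between) (auto simp: le_max_iff_disj)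
    moreover have "0 \<le> w (rescaled \<alpha> u (R n)) (rescaled \<beta> v (R n)) x"
      by (simp add: w_def)
    ultimately show ?thesis
      by (auto simp: s_def abs_mult intro: mult_left_mono)
  qed (simp add: s_def \<zeta>0)
  have lims: "(\<lambda>n. s n x) \<longlonglongrightarrow> (\<zeta> x)\<^sup>2 * w U W x" for x
  proof (cases "x \<in> C")
    case True
    have conv: "f \<longlonglongrightarrow> L" if "\<And>n. \<bar>f n - L\<bar> < inverse (real (Suc n))" for f :: "nat \<Rightarrow> real" and L
    proof -
      have "(\<lambda>n. f n - L) \<longlonglongrightarrow> 0"
        by (rule Lim_null_comparison[OF _ LIMSEQ_inverse_real_of_nat])
          (use that in \<open>auto intro!: always_eventually less_imp_le\<close>)
      then show ?thesis by (rule LIM_zero_cancel)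
    qed
    show ?thesis
      unfolding s_def w_def using conv[OF R(2)[OF True]] conv[OF R(4)[OF True]] UW0[OF True]
      by (intro tendsto_intros) auto
  qed (simp add: s_def \<zeta>0)
  have "(\<lambda>n. LINT x|lborel. s n x) \<longlonglongrightarrow> (LINT x|lborel. (\<zeta> x)\<^sup>2 * w U W x)"
    by (rule integral_dominated_convergence[OF _ _ int\<zeta>]) (use ints intf lims bound in auto)
  then have "(\<lambda>n. sqrt (p * q) * (LINT x|lborel. s n x)) \<longlonglongrightarrow> sqrt (p * q) * (LINT x|lborel. (\<zeta> x)\<^sup>2 * w U W x)"
    by (rule tendsto_mult_left)
  moreover have "(\<lambda>n. B - \<gamma>\<^sup>2 / 4 * J + D * inverse (real (Suc n))) \<longlonglongrightarrow> B - \<gamma>\<^sup>2 / 4 * J + D * 0"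
    by (rule tendsto_add[OF tendsto_const tendsto_mult_left[OF LIMSEQ_inverse_real_of_nat]])
  ultimately have "sqrt (p * q) * (LINT x|lborel. (\<zeta> x)\<^sup>2 * w U W x) \<le> B - \<gamma>\<^sup>2 / 4 * J + D * 0"
    by (rule LIMSEQ_le) (use R(6) in \<open>auto simp: s_def\<close>)
  then show ?thesis
    unfolding w_def B_def J_def by simp
qed

end

section \<open>Removing the origin\<close>

lemma C1_I:
  fixes f :: "'a::euclidean_space \<Rightarrow> real"
  assumes "\<And>x. (f has_derivative (\<lambda>h. g x \<bullet> h)) (at x)" "continuous_on UNIV g"
  shows "Ck_on 1 UNIV f" "grad f x = g x"
proof -
  have p: "partial_deriv b f = (\<lambda>x. g x \<bullet> b)" for b
    using partial_deriv_eq[OF assms(1)] by blast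
  have "f differentiable (at x)" for x
    using assms(1) differentiable_def by blast
  then show "Ck_on 1 UNIV f"
    using assms(2) by (simp add: p continuous_intros)
  show "grad f x = g x"
    by (rule grad_eq[OF assms(1)])
qed

text \<open>The function is the square of max 0 (1 - \<epsilon>^2/|x|^2); squaring makes it
  continuously differentiable across |x| = \<epsilon>. Of the two gradient bounds, 4/|x| is
  independent of \<epsilon> and provides a majorant, while the other one tends to 0 with \<epsilon>
  at each point. The lower bound gives pointwise convergence to 1.\<close>

lemma punctured_cutoff:
  fixes \<epsilon> :: real
  assumes "0 < \<epsilon>"
  obtains \<xi> :: "'a::euclidean_space \<Rightarrow> real"
  where "Ck_on 1 UNIV \<xi>" "\<And>x. norm x < \<epsilon> \<Longrightarrow> \<xi> x = 0" "\<And>x. 0 \<le> \<xi> x" "\<And>x. \<xi> x \<le> 1"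
    "\<And>x. norm (grad \<xi> x) \<le> 4 / norm x" "\<And>x. norm (grad \<xi> x) \<le> 4 * \<epsilon>\<^sup>2 / norm x ^ 3"
    "\<And>x. x \<noteq> 0 \<Longrightarrow> 1 - 2 * \<epsilon>\<^sup>2 / (norm x)\<^sup>2 \<le> \<xi> x"
proof -
  define n where "n x = x \<bullet> x" for x :: 'a
  have n: "n x = (norm x)\<^sup>2" for x by (simp add: n_def power2_norm_eq_inner)
  \<comment> \<open>Not \<open>1 - \<epsilon>\<^sup>2 / n x\<close>, which is 1 instead of 0 at the origin since \<open>\<epsilon>\<^sup>2 / 0 = 0\<close>.\<close>
  define t where "t x = max 0 ((n x - \<epsilon>\<^sup>2) / n x)" for x :: 'a
  define \<xi> where "\<xi> x = (t x)\<^sup>2" for x :: 'a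
  define g where "g x = (4 * \<epsilon>\<^sup>2 * t x / (n x)\<^sup>2) *\<^sub>R x" for x :: 'a
  have t0: "t x = 0" if "norm x < \<epsilon>" for x
  proof -
    have "n x < \<epsilon>\<^sup>2" using that unfolding n by (simp add: power_strict_mono)
    then show ?thesis by (simp add: t_def n divide_nonpos_nonneg)
  qed
  have t01: "0 \<le> t x" "t x \<le> 1" for x
    using zero_le_power2[of "norm x"] by (auto simp: t_def n divide_le_eq_1)
  have sq: "((\<lambda>s. (max 0 s)\<^sup>2) has_real_derivative 2 * max 0 s) (at s)" for s :: real
  proof (cases s "0::real" rule: linorder_cases)
    case less
    have "((\<lambda>s. 0) has_real_derivative 0) (at s)" by simp
    then have "((\<lambda>s. (max 0 s)\<^sup>2) has_real_derivative 0) (at s)"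
      by (rule has_field_derivative_transform_within_open[where S = "{..<0}"]) (use less in auto)
    then show ?thesis using less by simp
  next
    case greater
    have "((\<lambda>s. s\<^sup>2) has_real_derivative 2 * s) (at s)" by (auto intro!: derivative_eq_intros)
    then have "((\<lambda>s. (max 0 s)\<^sup>2) has_real_derivative 2 * s) (at s)"
      by (rule has_field_derivative_transform_within_open[where S = "{0<..}"]) (use greater in auto)
    then show ?thesis using greater by simp
  next
    case equal
    have "((\<lambda>h. ((max 0 h)\<^sup>2 - 0) / h) \<longlongrightarrow> 0) (at (0::real))"
    proof (rule Lim_null_comparison)
      show "((\<lambda>h::real. \<bar>h\<bar>) \<longlongrightarrow> 0) (at 0)" by (rule tendsto_eq_intros refl | simp)+
      show "\<forall>\<^sub>F h in at (0::real). norm (((max 0 h)\<^sup>2 - 0) / h) \<le> \<bar>h\<bar>"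
        by (rule always_eventually) (auto simp: max_def power2_eq_square)
    qed
    then show ?thesis using equal by (simp add: DERIV_def)
  qed
  have d: "(\<xi> has_derivative (\<lambda>h. g x \<bullet> h)) (at x)" for x
  proof (cases "norm x < \<epsilon>")
    case True
    have "(\<xi> has_derivative (\<lambda>h. 0)) (at x)"
      using has_derivative_transform_within_open[OF has_derivative_const[of 0], of "ball 0 \<epsilon>" x \<xi>] t0 True
      by (auto simp: \<xi>_def)
    then show ?thesis using t0[OF True] by (simp add: g_def)
  next
    case False
    then have "x \<noteq> 0" using \<open>0 < \<epsilon>\<close> by auto
    then have "n x \<noteq> 0" by (simp add: n_def)
    have "((\<lambda>x. (n x - \<epsilon>\<^sup>2) / n x) has_derivative (\<lambda>h. 2 * \<epsilon>\<^sup>2 * (x \<bullet> h) / (n x)\<^sup>2)) (at x)"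
      using \<open>n x \<noteq> 0\<close> unfolding n_def
      by (auto intro!: derivative_eq_intros simp: fun_eq_iff inner_commute field_simps power2_eq_square)
    from has_derivative_compose[OF this sq[unfolded has_field_derivative_def]]
    show ?thesis
      unfolding \<xi>_def t_def g_def by (rule has_derivative_eq_rhs) (simp add: fun_eq_iff)
  qed
  have "continuous_on (- {0}) g"
    unfolding g_def t_def n_def by (intro continuous_intros) auto
  moreover have "continuous_on (ball 0 \<epsilon>) g"
    by (rule continuous_on_eq[OF continuous_on_const[of _ 0]]) (use t0 in \<open>auto simp: g_def\<close>)
  ultimately have "continuous_on (- {0} \<union> ball 0 \<epsilon>) g"
    by (intro continuous_on_open_Un) auto
  moreover have "- {0} \<union> ball (0::'a) \<epsilon> = UNIV" using \<open>0 < \<epsilon>\<close> by auto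
  ultimately have g: "continuous_on UNIV g" by simp
  note C1 = C1_I[OF d g]
  have ng: "norm (g x) = 4 * \<epsilon>\<^sup>2 * t x / norm x ^ 3" for x
  proof -
    have "0 \<le> 4 * \<epsilon>\<^sup>2 * t x / (n x)\<^sup>2" using t01(1)[of x] by simp
    then have "norm (g x) = 4 * \<epsilon>\<^sup>2 * t x / (n x)\<^sup>2 * norm x"
      unfolding g_def norm_scaleR by (simp only: abs_of_nonneg)
    then show ?thesis by (simp add: n power2_eq_square power3_eq_cube)
  qed
  have b3: "norm (g x) \<le> 4 * \<epsilon>\<^sup>2 / norm x ^ 3" for x
    unfolding ng using t01[of x] by (intro divide_right_mono) (auto simp: mult_left_le)
  have b1: "norm (g x) \<le> 4 / norm x" for x
  proof (cases "norm x < \<epsilon>")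
    case False
    then have "0 < norm x" "\<epsilon>\<^sup>2 \<le> (norm x)\<^sup>2" using \<open>0 < \<epsilon>\<close> by (auto intro: power_mono)
    then have "4 * \<epsilon>\<^sup>2 / norm x ^ 3 \<le> 4 * (norm x)\<^sup>2 / norm x ^ 3"
      by (intro divide_right_mono) auto
    also have "\<dots> = 4 / norm x"
      using \<open>0 < norm x\<close> by (simp add: power2_eq_square power3_eq_cube)
    finally show ?thesis using b3[of x] by simp
  qed (use t0 in \<open>simp add: g_def\<close>)
  have low: "1 - 2 * \<epsilon>\<^sup>2 / (norm x)\<^sup>2 \<le> \<xi> x" if "x \<noteq> 0" for x
  proof -
    let ?s = "(n x - \<epsilon>\<^sup>2) / n x"
    have s: "?s = 1 - \<epsilon>\<^sup>2 / n x" using that by (simp add: n diff_divide_distrib)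
    have "1 - 2 * (\<epsilon>\<^sup>2 / n x) \<le> (t x)\<^sup>2"
    proof (cases "0 \<le> ?s")
      case True
      then have "(t x)\<^sup>2 = (1 - \<epsilon>\<^sup>2 / n x)\<^sup>2" by (simp add: t_def s)
      moreover have "(1 - e)\<^sup>2 = 1 - 2 * e + e\<^sup>2" for e :: real by (simp add: power2_eq_square algebra_simps)
      ultimately show ?thesis by simp
    next
      case False
      then have "1 < \<epsilon>\<^sup>2 / n x" by (simp add: s)
      then show ?thesis using zero_le_power2[of "t x"] by linarith
    qed
    then show ?thesis by (simp add: \<xi>_def n)
  qed
  show thesis
    by (rule that[of \<xi>]) (use C1 t0 t01 b1 b3 low in \<open>auto simp: \<xi>_def power_le_one\<close>)
qed

lemma C1_mult:
  fixes f g :: "'a::euclidean_space \<Rightarrow> real"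
  assumes "Ck_on 1 UNIV f" "Ck_on 1 UNIV g"
  shows "Ck_on 1 UNIV (\<lambda>x. f x * g x)" "grad (\<lambda>x. f x * g x) x = f x *\<^sub>R grad g x + g x *\<^sub>R grad f x"
proof -
  have d: "((\<lambda>x. f x * g x) has_derivative (\<lambda>h. (f x *\<^sub>R grad g x + g x *\<^sub>R grad f x) \<bullet> h)) (at x)" for x
    using has_derivative_mult[OF has_derivative_grad[OF Ck_on_1D(1)[OF assms(1)]]
        has_derivative_grad[OF Ck_on_1D(1)[OF assms(2)]], of x]
    by (simp add: inner_add_left mult.commute)
  have c: "continuous_on UNIV (\<lambda>x. f x *\<^sub>R grad g x + g x *\<^sub>R grad f x)"
    using Ck_on_1D(2,3)[OF assms(1)] Ck_on_1D(2,3)[OF assms(2)] by (intro continuous_intros)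
  show "Ck_on 1 UNIV (\<lambda>x. f x * g x)"
    by (rule C1_I(1)[OF d c])
  show "grad (\<lambda>x. f x * g x) x = f x *\<^sub>R grad g x + g x *\<^sub>R grad f x"
    by (rule C1_I(2)[OF d c])
qed

text \<open>In dimension at least 3 a point has zero capacity.\<close>

lemma punctured_inequality_extend:
  fixes \<zeta> V :: "'a::euclidean_space \<Rightarrow> real" and A k M :: real
  assumes d: "DIM('a) \<ge> 3" and \<zeta>: "Ck_on 1 UNIV \<zeta>" and C: "compact C" and \<zeta>0: "\<And>x. x \<notin> C \<Longrightarrow> \<zeta> x = 0"
    and V: "V \<in> borel_measurable borel" "\<And>x. x \<noteq> 0 \<Longrightarrow> \<bar>V x\<bar> \<le> M / (norm x)\<^sup>2"
    and ineq: "\<And>\<eta> S. Ck_on 1 UNIV \<eta> \<Longrightarrow> compact S \<Longrightarrow> 0 \<notin> S \<Longrightarrow> (\<And>x. x \<notin> S \<Longrightarrow> \<eta> x = 0) \<Longrightarrow>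
      A * (LINT x|lborel. (\<eta> x)\<^sup>2 * V x)
      \<le> (LINT x|lborel. (norm (grad \<eta> x))\<^sup>2) - k * (LINT x|lborel. (\<eta> x)\<^sup>2 / (norm x)\<^sup>2)"
  shows "integrable lborel (\<lambda>x. (\<zeta> x)\<^sup>2 * V x)"
    and "A * (LINT x|lborel. (\<zeta> x)\<^sup>2 * V x)
      \<le> (LINT x|lborel. (norm (grad \<zeta> x))\<^sup>2) - k * (LINT x|lborel. (\<zeta> x)\<^sup>2 / (norm x)\<^sup>2)"
proof -
  define e where "e n = inverse (real (Suc n))" for n
  have e: "0 < e n" for n by (simp add: e_def)
  have elim0: "(\<lambda>n. e n ^ 2) \<longlonglongrightarrow> 0"
    unfolding e_def using tendsto_power[OF LIMSEQ_inverse_real_of_nat, of 2] by simp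
  have "\<exists>\<xi>. \<forall>n. Ck_on 1 UNIV (\<xi> n) \<and> (\<forall>x. norm x < e n \<longrightarrow> \<xi> n x = 0) \<and> (\<forall>x. 0 \<le> \<xi> n x \<and> \<xi> n x \<le> 1)
    \<and> (\<forall>x. norm (grad (\<xi> n) x) \<le> 4 / norm x \<and> norm (grad (\<xi> n) x) \<le> 4 * (e n)\<^sup>2 / norm x ^ 3)
    \<and> (\<forall>x::'a. x \<noteq> 0 \<longrightarrow> 1 - 2 * (e n)\<^sup>2 / (norm x)\<^sup>2 \<le> \<xi> n x)"
  proof (rule choice, rule allI)
    show "\<exists>\<xi>. Ck_on 1 UNIV \<xi> \<and> (\<forall>x. norm x < e n \<longrightarrow> \<xi> x = 0) \<and> (\<forall>x. 0 \<le> \<xi> x \<and> \<xi> x \<le> 1)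
      \<and> (\<forall>x. norm (grad \<xi> x) \<le> 4 / norm x \<and> norm (grad \<xi> x) \<le> 4 * (e n)\<^sup>2 / norm x ^ 3)
      \<and> (\<forall>x::'a. x \<noteq> 0 \<longrightarrow> 1 - 2 * (e n)\<^sup>2 / (norm x)\<^sup>2 \<le> \<xi> x)" for n
      by (rule punctured_cutoff[OF e[of n], where 'a = 'a]) blast
  qed
  then obtain \<xi> where \<xi>: "\<And>n. Ck_on 1 UNIV (\<xi> n)" "\<And>n x. norm x < e n \<Longrightarrow> \<xi> n x = 0"
    "\<And>n x. 0 \<le> \<xi> n x" "\<And>n x. \<xi> n x \<le> 1"
    "\<And>n x. norm (grad (\<xi> n) x) \<le> 4 / norm x" "\<And>n x. norm (grad (\<xi> n) x) \<le> 4 * (e n)\<^sup>2 / norm x ^ 3"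
    "\<And>n x::'a. x \<noteq> 0 \<Longrightarrow> 1 - 2 * (e n)\<^sup>2 / (norm x)\<^sup>2 \<le> \<xi> n x"
    by blast
  have \<xi>lim: "(\<lambda>n. \<xi> n x) \<longlonglongrightarrow> 1" if "x \<noteq> 0" for x
  proof (rule tendsto_sandwich[OF _ _ _ tendsto_const[of 1]])
    have "(\<lambda>n. 1 - 2 * (e n)\<^sup>2 / (norm x)\<^sup>2) \<longlonglongrightarrow> 1 - 2 * 0 / (norm x)\<^sup>2"
      by (intro tendsto_intros elim0) (use that in auto)
    then show "(\<lambda>n. 1 - 2 * (e n)\<^sup>2 / (norm x)\<^sup>2) \<longlonglongrightarrow> 1" by simp
  qed (use \<xi>(4,7) that in \<open>auto intro: always_eventually\<close>)
  have glim: "(\<lambda>n. grad (\<xi> n) x) \<longlonglongrightarrow> 0" if "x \<noteq> 0" for x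
  proof (rule Lim_null_comparison)
    have "(\<lambda>n. 4 * (e n)\<^sup>2 / norm x ^ 3) \<longlonglongrightarrow> 4 * 0 / norm x ^ 3"
      by (intro tendsto_intros elim0) (use that in auto)
    then show "(\<lambda>n. 4 * (e n)\<^sup>2 / norm x ^ 3) \<longlonglongrightarrow> 0" by simp
  qed (use \<xi>(6) in \<open>auto intro: always_eventually\<close>)
  define \<eta> where "\<eta> n = (\<lambda>x. \<zeta> x * \<xi> n x)" for n
  have \<eta>: "Ck_on 1 UNIV (\<eta> n)" "grad (\<eta> n) x = \<zeta> x *\<^sub>R grad (\<xi> n) x + \<xi> n x *\<^sub>R grad \<zeta> x" for n x
    unfolding \<eta>_def by (rule C1_mult[OF \<zeta> \<xi>(1)])+
  have \<eta>S: "compact (C - ball 0 (e n))" "0 \<notin> C - ball 0 (e n)" "\<And>x. x \<notin> C - ball 0 (e n) \<Longrightarrow> \<eta> n x = 0" for n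
    using C e[of n] \<zeta>0 \<xi>(2)[of _ n] by (auto simp: \<eta>_def compact_diff)
  have ih: "integrable lborel (\<lambda>x. (\<zeta> x)\<^sup>2 / (norm x)\<^sup>2)"
    by (rule hardy_inequality(1)[OF d \<zeta> C \<zeta>0])
  have ig: "integrable lborel (\<lambda>x. (norm (grad \<zeta> x))\<^sup>2)"
    by (rule integrable_grad_square[OF \<zeta> C \<zeta>0])
  have meas: "\<zeta> \<in> borel_measurable borel" "\<xi> n \<in> borel_measurable borel" "\<eta> n \<in> borel_measurable borel"
    "grad (\<eta> n) \<in> borel_measurable borel" "grad \<zeta> \<in> borel_measurable borel" for n
    using Ck_on_1D(2,3)[OF \<zeta>] Ck_on_1D(2)[OF \<xi>(1)[of n]] Ck_on_1D(2,3)[OF \<eta>(1)[of n]]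
    by (auto intro: borel_measurable_continuous_onI)
  have AE0: "AE x::'a in lborel. x \<noteq> 0" by (rule AE_lborel_singleton)
  have \<xi>sq: "(\<xi> n x)\<^sup>2 \<le> 1" for n x using \<xi>(3,4) by (simp add: power_le_one)
  show iV: "integrable lborel (\<lambda>x. (\<zeta> x)\<^sup>2 * V x)"
  proof (rule Bochner_Integration.integrable_bound[OF integrable_mult_right[OF ih, of M]])
    show "AE x in lborel. norm ((\<zeta> x)\<^sup>2 * V x) \<le> norm (M * ((\<zeta> x)\<^sup>2 / (norm x)\<^sup>2))"
      using AE0
    proof eventually_elim
      case (elim x)
      have "(\<zeta> x)\<^sup>2 * \<bar>V x\<bar> \<le> (\<zeta> x)\<^sup>2 * (M / (norm x)\<^sup>2)"
        using V(2)[OF elim] by (rule mult_left_mono) simp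
      then have "norm ((\<zeta> x)\<^sup>2 * V x) \<le> M * ((\<zeta> x)\<^sup>2 / (norm x)\<^sup>2)"
        by (simp add: abs_mult mult.commute)
      also have "\<dots> \<le> norm (M * ((\<zeta> x)\<^sup>2 / (norm x)\<^sup>2))"
        by (simp only: real_norm_def abs_ge_self)
      finally show ?case .
    qed
  qed (use meas V in simp)
  have L1: "(\<lambda>n. LINT x|lborel. (\<eta> n x)\<^sup>2 * V x) \<longlonglongrightarrow> (LINT x|lborel. (\<zeta> x)\<^sup>2 * V x)"
  proof (rule integral_dominated_convergence[where w = "\<lambda>x. norm ((\<zeta> x)\<^sup>2 * V x)"])
    show "AE x in lborel. (\<lambda>n. (\<eta> n x)\<^sup>2 * V x) \<longlonglongrightarrow> (\<zeta> x)\<^sup>2 * V x"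
      using AE0
    proof eventually_elim
      case (elim x)
      have "(\<lambda>n. (\<zeta> x * \<xi> n x)\<^sup>2 * V x) \<longlonglongrightarrow> (\<zeta> x * 1)\<^sup>2 * V x"
        by (intro tendsto_intros \<xi>lim elim)
      then show ?case by (simp add: \<eta>_def)
    qed
    show "AE x in lborel. norm ((\<eta> n x)\<^sup>2 * V x) \<le> norm ((\<zeta> x)\<^sup>2 * V x)" for n
      using mult_left_mono[OF \<xi>sq, of "(\<zeta> x)\<^sup>2 * \<bar>V x\<bar>" for x]
      by (intro always_eventually allI) (auto simp: \<eta>_def power_mult_distrib abs_mult mult_ac)
  qed (use iV meas V in \<open>auto intro: integrable_abs\<close>)
  have L2: "(\<lambda>n. LINT x|lborel. (\<eta> n x)\<^sup>2 / (norm x)\<^sup>2) \<longlonglongrightarrow> (LINT x|lborel. (\<zeta> x)\<^sup>2 / (norm x)\<^sup>2)"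
  proof (rule integral_dominated_convergence[OF _ _ ih])
    show "AE x in lborel. (\<lambda>n. (\<eta> n x)\<^sup>2 / (norm x)\<^sup>2) \<longlonglongrightarrow> (\<zeta> x)\<^sup>2 / (norm x)\<^sup>2"
      using AE0
    proof eventually_elim
      case (elim x)
      have "(\<lambda>n. (\<zeta> x * \<xi> n x)\<^sup>2 / (norm x)\<^sup>2) \<longlonglongrightarrow> (\<zeta> x * 1)\<^sup>2 / (norm x)\<^sup>2"
        by (intro tendsto_intros \<xi>lim elim) (use elim in auto)
      then show ?case by (simp add: \<eta>_def)
    qed
    show "AE x in lborel. norm ((\<eta> n x)\<^sup>2 / (norm x)\<^sup>2) \<le> (\<zeta> x)\<^sup>2 / (norm x)\<^sup>2" for n
      using mult_left_mono[OF \<xi>sq, of "(\<zeta> x)\<^sup>2" for x]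
      by (intro always_eventually allI) (auto simp: \<eta>_def power_mult_distrib intro!: divide_right_mono)
  qed (use meas in auto)
  \<comment> \<open>The majorant comes from |a + b|^2 \<le> 2 |a|^2 + 2 |b|^2, with 32 = 2 * 4^2
    from the gradient bound 4/|x| of the cutoff. It is integrable by Hardy's inequality; the
    gradients of the cutoffs tend to 0 off the origin.\<close>
  have L3: "(\<lambda>n. LINT x|lborel. (norm (grad (\<eta> n) x))\<^sup>2) \<longlonglongrightarrow> (LINT x|lborel. (norm (grad \<zeta> x))\<^sup>2)"
  proof (rule integral_dominated_convergence[where
        w = "\<lambda>x. 32 * ((\<zeta> x)\<^sup>2 / (norm x)\<^sup>2) + 2 * (norm (grad \<zeta> x))\<^sup>2"])
    show "AE x in lborel. (\<lambda>n. (norm (grad (\<eta> n) x))\<^sup>2) \<longlonglongrightarrow> (norm (grad \<zeta> x))\<^sup>2"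
      using AE0
    proof eventually_elim
      case (elim x)
      have "(\<lambda>n. (norm (\<zeta> x *\<^sub>R grad (\<xi> n) x + \<xi> n x *\<^sub>R grad \<zeta> x))\<^sup>2)
          \<longlonglongrightarrow> (norm (\<zeta> x *\<^sub>R 0 + 1 *\<^sub>R grad \<zeta> x))\<^sup>2"
        by (intro tendsto_intros \<xi>lim glim elim)
      then show ?case by (simp add: \<eta>(2))
    qed
    show "AE x in lborel. norm ((norm (grad (\<eta> n) x))\<^sup>2)
        \<le> 32 * ((\<zeta> x)\<^sup>2 / (norm x)\<^sup>2) + 2 * (norm (grad \<zeta> x))\<^sup>2" for n
    proof (intro always_eventually allI)
      fix x
      let ?a = "\<zeta> x *\<^sub>R grad (\<xi> n) x" and ?b = "\<xi> n x *\<^sub>R grad \<zeta> x"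
      have "(norm (?a + ?b))\<^sup>2 \<le> (norm ?a + norm ?b)\<^sup>2"
        by (intro power_mono norm_triangle_ineq) simp
      also have "\<dots> \<le> 2 * (norm ?a)\<^sup>2 + 2 * (norm ?b)\<^sup>2"
        using zero_le_power2[of "norm ?a - norm ?b"] by (simp add: power2_eq_square algebra_simps)
      also have "(norm ?a)\<^sup>2 \<le> 16 * ((\<zeta> x)\<^sup>2 / (norm x)\<^sup>2)"
      proof -
        have "(norm (grad (\<xi> n) x))\<^sup>2 \<le> (4 / norm x)\<^sup>2"
          using \<xi>(5) by (intro power_mono) auto
        then have "(\<zeta> x)\<^sup>2 * (norm (grad (\<xi> n) x))\<^sup>2 \<le> (\<zeta> x)\<^sup>2 * (4 / norm x)\<^sup>2"
          by (rule mult_left_mono) simp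
        then show ?thesis by (simp add: power_mult_distrib power_divide mult.commute)
      qed
      also have "(norm ?b)\<^sup>2 \<le> (norm (grad \<zeta> x))\<^sup>2"
        using mult_right_mono[OF \<xi>sq, of "(norm (grad \<zeta> x))\<^sup>2" n x] by (simp add: power_mult_distrib)
      finally show "norm ((norm (grad (\<eta> n) x))\<^sup>2) \<le> 32 * ((\<zeta> x)\<^sup>2 / (norm x)\<^sup>2) + 2 * (norm (grad \<zeta> x))\<^sup>2"
        by (simp add: \<eta>(2))
    qed
    show "integrable lborel (\<lambda>x. 32 * ((\<zeta> x)\<^sup>2 / (norm x)\<^sup>2) + 2 * (norm (grad \<zeta> x))\<^sup>2)"
      using ih ig by (intro Bochner_Integration.integrable_add integrable_mult_right)
  qed (use meas in auto)
  show "A * (LINT x|lborel. (\<zeta> x)\<^sup>2 * V x)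
      \<le> (LINT x|lborel. (norm (grad \<zeta> x))\<^sup>2) - k * (LINT x|lborel. (\<zeta> x)\<^sup>2 / (norm x)\<^sup>2)"
    by (rule LIMSEQ_le[OF tendsto_mult_left[OF L1] tendsto_diff[OF L3 tendsto_mult_left[OF L2]]])
      (use ineq[OF \<eta>(1) \<eta>S] in auto)
qed

text \<open>The zero solution satisfies the hypotheses other than \<open>nontrivial\<close>, but for
  d = 2 the weight 1/|x|^2 is not integrable near the origin, so the conclusion fails for
  \<open>\<phi>\<close> with \<open>\<phi> 0\<close> nonzero. Integrability is part of the
  conclusion because the integral of a non-integrable function is 0 by convention, which would
  deprive the inequality of its meaning.\<close>

theorem theorem5:
  fixes p q \<alpha> \<beta> \<gamma> :: real
    and u v u_inf v_inf \<phi> :: "'a::euclidean_space \<Rightarrow> real"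
  assumes "DIM('a) \<ge> 2"
    and "p \<ge> q" and "q > 0" and "p * q > 1"
    and "\<alpha> = 2 * (p + 1) / (p * q - 1)"
    and "\<beta> = 2 * (q + 1) / (p * q - 1)"
    and "\<gamma> = \<alpha> - \<beta>"
    and "lane_emden_solution p q u v"
    and "\<forall>x. u x \<ge> 0 \<and> v x \<ge> 0"
    and nontrivial: "\<exists>x. u x \<noteq> 0 \<or> v x \<noteq> 0"
    and "stable_outside_compact p q u v"
    and "asymptotically_homogeneous \<alpha> \<beta> u v"
    and "blow_down_limit \<alpha> \<beta> u v u_inf v_inf"
    and "C1_compact_support \<phi>"
  shows "integrable lborel
           (\<lambda>x. \<bar>u_inf x\<bar> powr ((q - 1) / 2) * \<bar>v_inf x\<bar> powr ((p - 1) / 2) * (\<phi> x)\<^sup>2)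
         \<and> integrable lborel (\<lambda>x. (\<phi> x)\<^sup>2 / (norm x)\<^sup>2)
         \<and> integrable lborel (\<lambda>x. (norm (grad \<phi> x))\<^sup>2)
         \<and> (LINT x|lborel. \<bar>u_inf x\<bar> powr ((q - 1) / 2) * \<bar>v_inf x\<bar> powr ((p - 1) / 2) * (\<phi> x)\<^sup>2)
         \<le> 1 / sqrt (p * q) *
             ((LINT x|lborel. (norm (grad \<phi> x))\<^sup>2)
              - \<gamma>\<^sup>2 / 4 * (LINT x|lborel. (\<phi> x)\<^sup>2 / (norm x)\<^sup>2))"
proof -
  interpret lane_emden_exponents p q \<alpha> \<beta> \<gamma>
    by unfold_locales (use assms in auto)
  note sol = \<open>lane_emden_solution p q u v\<close> and lim = \<open>blow_down_limit \<alpha> \<beta> u v u_inf v_inf\<close>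
  have nonneg: "\<And>x. 0 \<le> u x" "\<And>x. 0 \<le> v x"
    using \<open>\<forall>x. u x \<ge> 0 \<and> v x \<ge> 0\<close> by auto
  obtain z where z: "u z \<noteq> 0 \<or> v z \<noteq> 0" using nontrivial by blast
  have pos: "\<And>x. 0 < u x" "\<And>x. 0 < v x"
    by (rule lane_emden_pos[OF sol nonneg z])+
  have d: "DIM('a) \<ge> 3"
    using lane_emden_dim_ne_2[OF sol nonneg z] \<open>DIM('a) \<ge> 2\<close> by linarith
  note sup = lane_emden_superharmonic[OF sol nonneg]
  define C where "C = closure {x. \<phi> x \<noteq> 0}"
  have \<phi>: "Ck_on 1 UNIV \<phi>" and C: "compact C"
    using \<open>C1_compact_support \<phi>\<close> by (auto simp: C1_compact_support_def C_def)
  have \<phi>0: "\<phi> x = 0" if "x \<notin> C" for x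
    using that closure_subset[of "{x. \<phi> x \<noteq> 0}"] by (auto simp: C_def)
  note hardy = hardy_inequality[OF d \<phi> C \<phi>0]
  have ig: "integrable lborel (\<lambda>x. (norm (grad \<phi> x))\<^sup>2)"
    by (rule integrable_grad_square[OF \<phi> C \<phi>0])
  have s0: "0 < sqrt (p * q)" using \<open>p * q > 1\<close> by simp
  define V where "V x = \<bar>u_inf x\<bar> powr ((q - 1) / 2) * \<bar>v_inf x\<bar> powr ((p - 1) / 2)" for x
  have "integrable lborel (\<lambda>x. (\<phi> x)\<^sup>2 * V x) \<and> sqrt (p * q) * (LINT x|lborel. (\<phi> x)\<^sup>2 * V x)
     \<le> (LINT x|lborel. (norm (grad \<phi> x))\<^sup>2) - \<gamma>\<^sup>2 / 4 * (LINT x|lborel. (\<phi> x)\<^sup>2 / (norm x)\<^sup>2)"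
  proof (cases "(\<forall>x. x \<noteq> 0 \<longrightarrow> u_inf x = 0) \<or> (\<forall>x. x \<noteq> 0 \<longrightarrow> v_inf x = 0)")
    case True
    \<comment> \<open>Since 0 powr s = 0 also for s \<le> 0, \<open>V\<close> vanishes off the
      origin as soon as one component does. At the origin the limit functions are arbitrary, but a
      single point has measure 0.\<close>
    then have "(\<lambda>x. (\<phi> x)\<^sup>2 * V x) = (\<lambda>x. (\<phi> 0)\<^sup>2 * V 0 * indicat_real {0} x)"
      by (auto simp: V_def indicator_def)
    then have "integrable lborel (\<lambda>x. (\<phi> x)\<^sup>2 * V x)" "(LINT x|lborel. (\<phi> x)\<^sup>2 * V x) = 0"
      by simp_all
    then show ?thesis
      using hardy_gamma[OF sol pos \<phi> C \<phi>0 d] by simp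
  next
    case False
    then obtain x1 x2 where x12: "x1 \<noteq> 0" "u_inf x1 \<noteq> 0" "x2 \<noteq> 0" "v_inf x2 \<noteq> 0" by blast
    obtain f g where fg: "C2_sphere f" "C2_sphere g"
      "\<And>r \<theta>. 0 < r \<Longrightarrow> \<theta> \<in> sphere 0 1 \<Longrightarrow> u_inf (r *\<^sub>R \<theta>) = r powr (- \<alpha>) * f \<theta>"
      "\<And>r \<theta>. 0 < r \<Longrightarrow> \<theta> \<in> sphere 0 1 \<Longrightarrow> v_inf (r *\<^sub>R \<theta>) = r powr (- \<beta>) * g \<theta>"
      using \<open>asymptotically_homogeneous \<alpha> \<beta> u v\<close> lim
      unfolding asymptotically_homogeneous_def homogeneous_pair_def by blast
    have hu: "continuous_on (- {0}) u_inf"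
        "\<And>r x. 0 < r \<Longrightarrow> x \<noteq> 0 \<Longrightarrow> u_inf (r *\<^sub>R x) = r powr (- \<alpha>) * u_inf x"
      and hv: "continuous_on (- {0}) v_inf"
        "\<And>r x. 0 < r \<Longrightarrow> x \<noteq> 0 \<Longrightarrow> v_inf (r *\<^sub>R x) = r powr (- \<beta>) * v_inf x"
      using homogeneous_continuous[OF fg(1,3)] homogeneous_continuous[OF fg(2,4)] by blast+
    have limu: "\<exists>\<^sub>F R in at_top. \<forall>x\<in>K. \<bar>rescaled \<alpha> u R x - u_inf x\<bar> < \<epsilon>"
      and limv: "\<exists>\<^sub>F R in at_top. \<forall>x\<in>K. \<bar>rescaled \<beta> v R x - v_inf x\<bar> < \<epsilon>"
      if "compact K" "0 \<notin> K" "0 < \<epsilon>" for K \<epsilon>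
    proof -
      have "\<exists>\<^sub>F R in at_top. \<forall>x\<in>K. \<bar>rescaled \<alpha> u R x - u_inf x\<bar> < \<epsilon> \<and> \<bar>rescaled \<beta> v R x - v_inf x\<bar> < \<epsilon>"
        using lim that unfolding blow_down_limit_def by blast
      then show "\<exists>\<^sub>F R in at_top. \<forall>x\<in>K. \<bar>rescaled \<alpha> u R x - u_inf x\<bar> < \<epsilon>"
        "\<exists>\<^sub>F R in at_top. \<forall>x\<in>K. \<bar>rescaled \<beta> v R x - v_inf x\<bar> < \<epsilon>"
        by (auto elim!: frequently_elim1)
    qed
    have upos: "0 < u_inf x" if "x \<noteq> 0" for x
      by (rule cluster_pos[OF sup(1,3) nonneg(1) limu hu(1) x12(1,2) that])
    have vpos: "0 < v_inf x" if "x \<noteq> 0" for x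
      by (rule cluster_pos[OF sup(2,4) nonneg(2) limv hv(1) x12(3,4) that])
    have Vpos: "V x = u_inf x powr ((q - 1) / 2) * v_inf x powr ((p - 1) / 2)" if "x \<noteq> 0" for x
      using upos[OF that] vpos[OF that] by (simp add: V_def)
    have Vc: "continuous_on (- {0}) V"
      unfolding V_def using upos vpos by (intro continuous_intros hu(1) hv(1)) force+
    then have Vm: "V \<in> borel_measurable borel"
      by (intro borel_measurable_continuous_countable_exceptions[of "{0}"]) auto
    have "sphere 0 1 \<subseteq> - {0::'a}" by auto
    then obtain l M where M: "\<And>x. x \<in> sphere 0 1 \<Longrightarrow> V x \<le> M"
      using compact_pos_bounds[OF compact_sphere continuous_on_subset[OF Vc]] upos vpos Vpos
      by (metis (no_types, lifting) ComplD insertI1 mult_pos_pos powr_gt_zero subsetD less_irrefl)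
    have Vb: "\<bar>V x\<bar> \<le> M / (norm x)\<^sup>2" if "x \<noteq> 0" for x
    proof -
      define y where "y = x /\<^sub>R norm x"
      have y: "y \<noteq> 0" "y \<in> sphere 0 1" "x = norm x *\<^sub>R y" "0 < norm x" using that by (auto simp: y_def)
      \<comment> \<open>\<open>V\<close> is homogeneous of degree -2, like the Hardy weight, so its
        maximum on the unit sphere bounds it by M/|x|^2; this is what the removal of the origin
        needs.\<close>
      have ex: "- \<alpha> * ((q - 1) / 2) + - \<beta> * ((p - 1) / 2) = - 2"
        using exponent_facts(4,5) by (simp add: field_simps)
      have "V x = norm x powr (- \<alpha> * ((q - 1) / 2) + - \<beta> * ((p - 1) / 2)) * V y"
        unfolding Vpos[OF that] Vpos[OF y(1)] powr_add
        using hu(2)[OF y(4,1)] hv(2)[OF y(4,1)] y(3) upos[OF y(1)] vpos[OF y(1)]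
        by (simp add: powr_mult powr_powr)
      also have "\<dots> = V y / (norm x)\<^sup>2"
        unfolding ex using y(4) by (simp add: powr_minus powr_numeral divide_inverse)
      also have "\<dots> \<le> M / (norm x)\<^sup>2"
        using M[OF y(2)] by (rule divide_right_mono) simp
      finally have "V x \<le> M / (norm x)\<^sup>2" .
      moreover have "0 \<le> V x" by (simp add: V_def)
      ultimately show ?thesis by simp
    qed
    have ineq: "sqrt (p * q) * (LINT x|lborel. (\<eta> x)\<^sup>2 * V x)
      \<le> (LINT x|lborel. (norm (grad \<eta> x))\<^sup>2) - \<gamma>\<^sup>2 / 4 * (LINT x|lborel. (\<eta> x)\<^sup>2 / (norm x)\<^sup>2)"
      if \<eta>: "Ck_on 1 UNIV \<eta>" "compact S" "0 \<notin> S" "\<And>x. x \<notin> S \<Longrightarrow> \<eta> x = 0" for \<eta> S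
    proof -
      have "(LINT x|lborel. (\<eta> x)\<^sup>2 * V x)
        = (LINT x|lborel. (\<eta> x)\<^sup>2 * (u_inf x powr ((q - 1) / 2) * v_inf x powr ((p - 1) / 2)))"
      proof (rule Bochner_Integration.integral_cong[OF refl])
        show "(\<eta> x)\<^sup>2 * V x = (\<eta> x)\<^sup>2 * (u_inf x powr ((q - 1) / 2) * v_inf x powr ((p - 1) / 2))" for x
          using \<eta>(3,4) Vpos[of x] by (cases "x = 0") auto
      qed
      then show ?thesis
        using positive_limit_inequality[OF Ck_on_2D(2)[OF sup(1)] Ck_on_2D(2)[OF sup(2)] pos
            \<open>stable_outside_compact p q u v\<close> lim hu(1) upos hu(2) hv(1) vpos hv(2) \<eta>] by simp
    qed
    show ?thesis
      by (rule conjI; rule punctured_inequality_extend[OF d \<phi> C \<phi>0 Vm Vb ineq])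
  qed
  then have V: "integrable lborel (\<lambda>x. V x * (\<phi> x)\<^sup>2)"
    "sqrt (p * q) * (LINT x|lborel. V x * (\<phi> x)\<^sup>2)
      \<le> (LINT x|lborel. (norm (grad \<phi> x))\<^sup>2) - \<gamma>\<^sup>2 / 4 * (LINT x|lborel. (\<phi> x)\<^sup>2 / (norm x)\<^sup>2)"
    by (simp_all only: mult.commute[of "V _"])
  have "I \<le> 1 / sqrt (p * q) * X" if "sqrt (p * q) * I \<le> X" for I X :: real
    using that s0 by (simp add: pos_le_divide_eq mult.commute)
  from this[OF V(2)] V(1) hardy(1) ig show ?thesis
    unfolding V_def by blast
qed

end
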